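(* Let $(M^m,g)$ be a Riemannian manifold and let $\phi:(M^m,g)\to\mathbb{R}^n$, $\phi(x)=(\phi^1(x),\phi^2(x),\dots,\phi^n(x))$, be a smooth map into Euclidean space. Then the following statements are equivalent: (i) $\phi$ is a generalized harmonic morphism; (ii) $\phi$ is a horizontally weakly conformal biharmonic map, and for all $\alpha\neq\beta$ in $\{1,\dots,n\}$ the map $(\phi^{\alpha}+i\phi^{\beta})^2:(M^m,g)\to\mathbb{C}$ is also a biharmonic map; (iii) there exists a function $\lambda:M\to[0,\infty)$, with $\lambda^2$ smooth, such that for every smooth function $f$ on an open subset $U\subseteq\mathbb{R}^n$ with $\phi^{-1}(U)\neq\emptyset$, one has on $\phi^{-1}(U)$ $$\Delta^{2}(f\circ\phi)=\lambda^4(\Delta^2 f)\circ\phi+2\sum_{\alpha=1}^n\left[\lambda^2\Delta\phi^{\alpha}+g(\nabla\lambda^2,\nabla\phi^{\alpha})\right](\partial_{\alpha}\Delta f)\circ\phi+\left[\Delta\lambda^2+2g(\nabla\phi^1,\nabla\Delta\phi^1)+(\Delta\phi^1)^2\right](\Delta f)\circ\phi .$$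
   Context: All manifolds, metrics and maps are smooth. $\Delta$ denotes the Laplace–Beltrami operator (of $(M,g)$ for functions on $M$, the Euclidean one for functions on $\mathbb{R}^n$), $\Delta^2=\Delta\circ\Delta$, $\nabla$ is the gradient on $(M,g)$, and $\partial_\alpha=\partial/\partial y^\alpha$ for the standard Cartesian coordinates $y^1,\dots,y^n$ on $\mathbb{R}^n$. A real- or complex-valued function $u$ is harmonic if $\Delta u=0$ and biharmonic if $\Delta^2u=0$. A map $\phi:(M^m,g)\to(N^n,h)$ between Riemannian manifolds is a generalized harmonic morphism if for every harmonic function $f:U\to\mathbb{R}$ on an open set $U\subseteq N$ with $V=\phi^{-1}(U)$ non-empty, the function $f\circ\phi:V\to\mathbb{R}$ is biharmonic on $V\subseteq M$. A map $\phi:(M,g)\to\mathbb{R}^n$ (or into $\mathbb{C}\cong\mathbb{R}^2$) is a biharmonic map if and only if each of its component functions is biharmonic. A map $\phi:(M,g)\to(N,h)$ is horizontally weakly conformal if there is a function $\lambda:M\to[0,\infty)$ such that at each $x\in M$ either $d\phi_x=0$, or $d\phi_x$ is surjective and $h(d\phi_x(X),d\phi_x(Y))=\lambda(x)^2g(X,Y)$ for all $X,Y\in(\ker d\phi_x)^{\perp}$. For $N=\mathbb{R}^n$ this means $g(\nabla\phi^\alpha,\nabla\phi^\beta)=\lambda^2\delta_{\alpha\beta}$ for all $\alpha,\beta$. *)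

theory Defs
  imports "HOL-Analysis.Analysis"
begin

section \<open>Smooth functions on open subsets of normed spaces\<close>

text \<open>The set \<open>S\<close> is meant to be open; then these are the usual classes \<open>C\<^sup>k(S)\<close>.\<close>

fun Ck_on :: "nat \<Rightarrow> 'a::real_normed_vector set \<Rightarrow> ('a \<Rightarrow> 'b::real_normed_vector) \<Rightarrow> bool" where
  "Ck_on 0 S f \<longleftrightarrow> continuous_on S f"
| "Ck_on (Suc k) S f \<longleftrightarrow>
     (\<forall>x\<in>S. f differentiable (at x)) \<and> (\<forall>v. Ck_on k S (\<lambda>x. frechet_derivative f (at x) v))"

definition smooth_on :: "'a::real_normed_vector set \<Rightarrow> ('a \<Rightarrow> 'b::real_normed_vector) \<Rightarrow> bool" where
  "smooth_on S f \<longleftrightarrow> (\<forall>k. Ck_on k S f)"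

definition pd :: "'k::finite \<Rightarrow> (real^'k \<Rightarrow> real) \<Rightarrow> real^'k \<Rightarrow> real" where
  "pd i f y = frechet_derivative f (at y) (axis i 1)"

section \<open>Riemannian manifolds\<close>

text \<open>A chart is a pair of its domain and a coordinate map; values of the latter outside the
  domain are irrelevant.\<close>

type_synonym ('a, 'm) chart = "'a set \<times> ('a \<Rightarrow> real^'m)"

abbreviation dom_chart :: "('a, 'm::finite) chart \<Rightarrow> 'a set" where
  "dom_chart \<equiv> fst"

abbreviation coord :: "('a, 'm::finite) chart \<Rightarrow> 'a \<Rightarrow> real^'m" where
  "coord \<equiv> snd"

definition coord_inv :: "('a, 'm::finite) chart \<Rightarrow> real^'m \<Rightarrow> 'a" where
  "coord_inv c = inv_into (dom_chart c) (coord c)"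

text \<open>An \<open>m\<close>-dimensional manifold, \<open>m = CARD('m)\<close>, consists of a topological space and a smooth
  atlas, which need not be maximal.  The metric is recorded through its components:
  \<open>metric_comp M c x $ i $ j = g\<^sub>i\<^sub>j(x)\<close> with respect to the chart \<open>c\<close>.\<close>

record ('a, 'm) rmanifold =
  mtop :: "'a topology"
  atlas :: "('a, 'm::finite) chart set"
  metric_comp :: "('a, 'm) chart \<Rightarrow> 'a \<Rightarrow> real^'m^'m"

abbreviation mcarrier :: "('a, 'm::finite) rmanifold \<Rightarrow> 'a set" where
  "mcarrier M \<equiv> topspace (mtop M)"

definition smooth_manifold :: "('a, 'm::finite) rmanifold \<Rightarrow> bool" where
  "smooth_manifold M \<longleftrightarrow>
     Hausdorff_space (mtop M) \<and> second_countable (mtop M) \<and>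
     \<Union> (dom_chart ` atlas M) = mcarrier M \<and>
     (\<forall>c\<in>atlas M. openin (mtop M) (dom_chart c) \<and> open (coord c ` dom_chart c) \<and>
        homeomorphic_map (subtopology (mtop M) (dom_chart c))
          (top_of_set (coord c ` dom_chart c)) (coord c)) \<and>
     (\<forall>c\<in>atlas M. \<forall>d\<in>atlas M.
        smooth_on (coord c ` (dom_chart c \<inter> dom_chart d)) (coord d \<circ> coord_inv c))"

text \<open>The last conjunct is the transformation law of a covariant 2-tensor.\<close>

definition riemannian_manifold :: "('a, 'm::finite) rmanifold \<Rightarrow> bool" where
  "riemannian_manifold M \<longleftrightarrow>
     smooth_manifold M \<and>
     (\<forall>c\<in>atlas M.
        smooth_on (coord c ` dom_chart c) (metric_comp M c \<circ> coord_inv c) \<and>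
        (\<forall>x\<in>dom_chart c. transpose (metric_comp M c x) = metric_comp M c x \<and>
           (\<forall>v. v \<noteq> 0 \<longrightarrow> v \<bullet> (metric_comp M c x *v v) > 0))) \<and>
     (\<forall>c\<in>atlas M. \<forall>d\<in>atlas M. \<forall>x\<in>dom_chart c \<inter> dom_chart d. \<forall>v w.
        let J = frechet_derivative (coord d \<circ> coord_inv c) (at (coord c x))
        in v \<bullet> (metric_comp M c x *v w) = J v \<bullet> (metric_comp M d x *v J w))"

definition smooth_fun_on ::
  "('a, 'm::finite) rmanifold \<Rightarrow> 'a set \<Rightarrow> ('a \<Rightarrow> 'b::real_normed_vector) \<Rightarrow> bool" where
  "smooth_fun_on M V u \<longleftrightarrow>
     openin (mtop M) V \<and> (\<forall>c\<in>atlas M. smooth_on (coord c ` (dom_chart c \<inter> V)) (u \<circ> coord_inv c))"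

text \<open>Below, pointwise objects at \<open>x\<close> are expressed in an arbitrarily chosen chart around \<open>x\<close>.  In
  particular the tangent space at \<open>x\<close> is identified with \<open>real^'m\<close> by means of this chart, so
  that components of tangent vectors must only be compared at one and the same point.
  All the scalar quantities defined are independent of the choice.\<close>

definition chart_at :: "('a, 'm::finite) rmanifold \<Rightarrow> 'a \<Rightarrow> ('a, 'm) chart" where
  "chart_at M x = (SOME c. c \<in> atlas M \<and> x \<in> dom_chart c)"

definition inner_at :: "('a, 'm::finite) rmanifold \<Rightarrow> 'a \<Rightarrow> real^'m \<Rightarrow> real^'m \<Rightarrow> real" where
  "inner_at M x v w = v \<bullet> (metric_comp M (chart_at M x) x *v w)"

definition grad :: "('a, 'm::finite) rmanifold \<Rightarrow> ('a \<Rightarrow> real) \<Rightarrow> 'a \<Rightarrow> real^'m" where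
  "grad M u x =
     (let c = chart_at M x
      in matrix_inv (metric_comp M c x) *v (\<chi> i. pd i (u \<circ> coord_inv c) (coord c x)))"

text \<open>Christoffel symbols of the Levi-Civita connection in the chart \<open>c\<close>: \<open>christoffel M c k i j\<close>
  is \<open>\<Gamma>\<^sup>k\<^sub>i\<^sub>j\<close> as a function of the coordinates.\<close>

definition christoffel ::
  "('a, 'm::finite) rmanifold \<Rightarrow> ('a, 'm) chart \<Rightarrow> 'm \<Rightarrow> 'm \<Rightarrow> 'm \<Rightarrow> real^'m \<Rightarrow> real" where
  "christoffel M c k i j y =
     (let G = metric_comp M c \<circ> coord_inv c
      in 1/2 * (\<Sum>l\<in>UNIV. matrix_inv (G y) $ k $ l *
           (pd i (\<lambda>z. G z $ j $ l) y + pd j (\<lambda>z. G z $ i $ l) y - pd l (\<lambda>z. G z $ i $ j) y)))"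

text \<open>Components of the covariant Hessian \<open>\<nabla>du\<close> in the chart \<open>c\<close>.\<close>

definition hessian_comp ::
  "('a, 'm::finite) rmanifold \<Rightarrow> ('a, 'm) chart \<Rightarrow> ('a \<Rightarrow> real) \<Rightarrow> 'm \<Rightarrow> 'm \<Rightarrow> real^'m \<Rightarrow> real" where
  "hessian_comp M c u i j y =
     pd i (pd j (u \<circ> coord_inv c)) y -
     (\<Sum>k\<in>UNIV. christoffel M c k i j y * pd k (u \<circ> coord_inv c) y)"

text \<open>The Laplace--Beltrami operator \<open>\<Delta>u = trace\<^sub>g \<nabla>du\<close>, so that \<open>\<Delta>\<close> is the sum of
  second partial derivatives on Euclidean space (no minus sign).\<close>

definition laplacian :: "('a, 'm::finite) rmanifold \<Rightarrow> ('a \<Rightarrow> real) \<Rightarrow> 'a \<Rightarrow> real" where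
  "laplacian M u x =
     (let c = chart_at M x
      in \<Sum>i\<in>UNIV. \<Sum>j\<in>UNIV. matrix_inv (metric_comp M c x) $ i $ j * hessian_comp M c u i j (coord c x))"

definition harmonic_on :: "('a, 'm::finite) rmanifold \<Rightarrow> 'a set \<Rightarrow> ('a \<Rightarrow> real) \<Rightarrow> bool" where
  "harmonic_on M V u \<longleftrightarrow> smooth_fun_on M V u \<and> (\<forall>x\<in>V. laplacian M u x = 0)"

definition biharmonic_on :: "('a, 'm::finite) rmanifold \<Rightarrow> 'a set \<Rightarrow> ('a \<Rightarrow> real) \<Rightarrow> bool" where
  "biharmonic_on M V u \<longleftrightarrow> smooth_fun_on M V u \<and> (\<forall>x\<in>V. laplacian M (laplacian M u) x = 0)"

section \<open>Classes of maps\<close>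

definition gen_harmonic_morphism ::
  "('a, 'm::finite) rmanifold \<Rightarrow> ('b, 'n::finite) rmanifold \<Rightarrow> ('a \<Rightarrow> 'b) \<Rightarrow> bool" where
  "gen_harmonic_morphism M N \<phi> \<longleftrightarrow>
     (\<forall>U f. openin (mtop N) U \<longrightarrow> mcarrier M \<inter> \<phi> -` U \<noteq> {} \<longrightarrow> harmonic_on N U f \<longrightarrow>
        biharmonic_on M (mcarrier M \<inter> \<phi> -` U) (f \<circ> \<phi>))"

definition differential ::
  "('a, 'm::finite) rmanifold \<Rightarrow> ('b, 'n::finite) rmanifold \<Rightarrow> ('a \<Rightarrow> 'b) \<Rightarrow> 'a \<Rightarrow> real^'m \<Rightarrow> real^'n" where
  "differential M N \<phi> x =
     (let c = chart_at M x
      in frechet_derivative (coord (chart_at N (\<phi> x)) \<circ> \<phi> \<circ> coord_inv c) (at (coord c x)))"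

definition horizontal_space ::
  "('a, 'm::finite) rmanifold \<Rightarrow> ('b, 'n::finite) rmanifold \<Rightarrow> ('a \<Rightarrow> 'b) \<Rightarrow> 'a \<Rightarrow> (real^'m) set" where
  "horizontal_space M N \<phi> x = {X. \<forall>V. differential M N \<phi> x V = 0 \<longrightarrow> inner_at M x X V = 0}"

definition horizontally_weakly_conformal ::
  "('a, 'm::finite) rmanifold \<Rightarrow> ('b, 'n::finite) rmanifold \<Rightarrow> ('a \<Rightarrow> 'b) \<Rightarrow> bool" where
  "horizontally_weakly_conformal M N \<phi> \<longleftrightarrow>
     (\<exists>lam::'a \<Rightarrow> real. \<forall>x\<in>mcarrier M. lam x \<ge> 0 \<and>
        ((\<forall>X. differential M N \<phi> x X = 0) \<or>
         surj (differential M N \<phi> x) \<and>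
         (\<forall>X\<in>horizontal_space M N \<phi> x. \<forall>Y\<in>horizontal_space M N \<phi> x.
            inner_at N (\<phi> x) (differential M N \<phi> x X) (differential M N \<phi> x Y) =
            (lam x)\<^sup>2 * inner_at M x X Y)))"

text \<open>Biharmonic maps into a Euclidean space, such as \<open>real^'n\<close> or \<open>complex\<close>; the components of a
  complex-valued map are its real and imaginary parts.\<close>

definition biharmonic_map ::
  "('a, 'm::finite) rmanifold \<Rightarrow> ('a \<Rightarrow> 'e::euclidean_space) \<Rightarrow> bool" where
  "biharmonic_map M \<psi> \<longleftrightarrow> (\<forall>b\<in>Basis. biharmonic_on M (mcarrier M) (\<lambda>x. \<psi> x \<bullet> b))"

section \<open>Euclidean space as a Riemannian manifold\<close>

definition eucl :: "(real^'n, 'n::finite) rmanifold" where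
  "eucl = \<lparr>mtop = euclidean, atlas = {(UNIV, \<lambda>y. y)}, metric_comp = (\<lambda>_ _. mat 1)\<rparr>"

lemma eucl_sel [simp]:
  "mtop (eucl :: (real^'n, 'n::finite) rmanifold) = euclidean"
  "atlas (eucl :: (real^'n, 'n) rmanifold) = {(UNIV, \<lambda>y. y)}"
  "metric_comp (eucl :: (real^'n, 'n) rmanifold) c y = mat 1"
  by (simp_all add: eucl_def)

lemma chart_at_eucl [simp]: "chart_at eucl y = (UNIV, \<lambda>y. y)"
  unfolding chart_at_def by (rule some_equality) auto

lemma coord_inv_ident [simp]: "coord_inv (UNIV, \<lambda>y. y) = (\<lambda>y. y)"
  by (metis coord_inv_def fst_conv id_apply inv_id snd_conv eq_id_iff)

lemma matrix_inv_mat_1 [simp]: "matrix_inv (mat 1 :: real^'n^'n) = mat 1"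
  unfolding matrix_inv_def by (rule some_equality) (simp, metis matrix_mul_lid)

lemma pd_const [simp]: "pd i (\<lambda>_. c) = (\<lambda>_. 0)"
  by (simp add: pd_def fun_eq_iff)

lemma laplacian_eucl:
  fixes f :: "real^'n::finite \<Rightarrow> real"
  shows "laplacian eucl f y = (\<Sum>\<alpha>\<in>UNIV. pd \<alpha> (pd \<alpha> f) y)"
proof -
  have "christoffel (eucl :: (real^'n, 'n) rmanifold) (UNIV, \<lambda>y. y) k i j z = 0" for k i j z
    by (simp add: christoffel_def comp_def)
  then show ?thesis
    by (simp add: laplacian_def hessian_comp_def comp_def)
      (simp add: mat_def if_distrib[of "\<lambda>t. t * _"] sum.delta cong: if_cong)
qed

lemma inner_at_eucl: "inner_at eucl y v w = v \<bullet> w"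
  by (simp add: inner_at_def)

lemma Ck_on_const: "Ck_on k S (\<lambda>_. c)"
  by (induction k arbitrary: c) auto

lemma smooth_on_ident: "smooth_on S (\<lambda>y. y)"
proof -
  have "Ck_on k S (\<lambda>y. y)" for k
    by (cases k) (auto simp: Ck_on_const frechet_derivative_ident)
  then show ?thesis
    by (simp add: smooth_on_def)
qed

lemma riemannian_manifold_eucl: "riemannian_manifold (eucl :: (real^'n, 'n::finite) rmanifold)"
proof -
  have "second_countable (euclidean :: (real^'n) topology)"
  proof -
    obtain B :: "(real^'n) set set" where B: "countable B" "\<And>C. C \<in> B \<Longrightarrow> open C"
      "\<And>S. open S \<Longrightarrow> \<exists>U. U \<subseteq> B \<and> S = \<Union>U"
      by (rule univ_second_countable) blast
    have "\<exists>V\<in>B. x \<in> V \<and> V \<subseteq> U" if "open U" "x \<in> U" for U x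
      using B(3)[OF that(1)] that(2) by blast
    then show ?thesis
      unfolding second_countable_def open_openin[symmetric]
      by (intro exI[of _ B]) (simp add: B(1,2))
  qed
  moreover have "homeomorphic_map euclidean euclidean (\<lambda>y::real^'n. y)"
    using homeomorphic_map_id[of euclidean euclidean] by (simp add: id_def)
  ultimately show ?thesis
    by (auto simp: riemannian_manifold_def smooth_manifold_def smooth_on_ident comp_def
        Hausdorff_space_euclidean smooth_on_def Ck_on_const frechet_derivative_ident Let_def)
qed

text \<open>A linear order on the index type identifies it with \<open>{1,\<dots>,n}\<close>; this is the index \<open>1\<close>.\<close>

definition first_index :: "'n::{finite,linorder}" where
  "first_index = Min UNIV"

end

theory Submission
  imports Defs
begin

text \<open>
  Write \<open>\<Gamma>(u,v) = g(\<nabla>u,\<nabla>v)\<close> (\<open>grad_inner\<close> below) and \<open>\<Gamma>\<^sub>\<alpha>\<^sub>\<beta> = \<Gamma>(\<phi>\<^sup>\<alpha>,\<phi>\<^sup>\<beta>)\<close>.  Everything rests on three rules: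
  \<open>\<Delta>(uv) = u\<Delta>v + v\<Delta>u + 2\<Gamma>(u,v)\<close>, the Leibniz rule for \<open>\<Gamma>\<close>, and the chain rule
  \<open>\<Delta>(f \<circ> \<phi>) = \<Sum>\<^sub>\<alpha>\<^sub>\<beta> (\<partial>\<^sub>\<beta>\<partial>\<^sub>\<alpha>f \<circ> \<phi>) \<Gamma>\<^sub>\<beta>\<^sub>\<alpha> + \<Sum>\<^sub>\<alpha> (\<partial>\<^sub>\<alpha>f \<circ> \<phi>) \<Delta>\<phi>\<^sup>\<alpha>\<close>.  Horizontal weak conformality is equivalent to
  \<open>\<Gamma>\<^sub>\<alpha>\<^sub>\<beta> = \<mu> \<delta>\<^sub>\<alpha>\<^sub>\<beta>\<close> for a function \<open>\<mu>\<close>, which can serve as \<open>\<lambda>\<^sup>2\<close> (\<open>horizontally_weakly_conformal_iff\<close>).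

  From (i) to (ii), three kinds of harmonic polynomials are composed with \<open>\<phi>\<close>: the coordinates, the real and
  imaginary parts of \<open>(y\<^sub>\<alpha> + i y\<^sub>\<beta>)\<^sup>2\<close>, and, for the conformality at a point \<open>x\<close> with \<open>\<phi>(x) = c\<close>, those of
  \<open>((y\<^sub>\<alpha> - c\<^sub>\<alpha>) + i (y\<^sub>\<beta> - c\<^sub>\<beta>))\<^sup>4\<close>.  A product of four functions that vanish at \<open>x\<close> has a bilaplacian at \<open>x\<close> that
  depends on their gradients only (\<open>bilaplacian_quartic_at_zero\<close>), and for the last polynomial it equals
  \<open>24 (\<Gamma>\<^sub>\<alpha>\<^sub>\<alpha> - \<Gamma>\<^sub>\<beta>\<^sub>\<beta> + 2i \<Gamma>\<^sub>\<alpha>\<^sub>\<beta>)\<^sup>2\<close>.  This vanishes exactly if \<open>\<Gamma>\<^sub>\<alpha>\<^sub>\<alpha> = \<Gamma>\<^sub>\<beta>\<^sub>\<beta>\<close> and \<open>\<Gamma>\<^sub>\<alpha>\<^sub>\<beta> = 0\<close>.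

  From (ii) to (iii), the chain rule becomes \<open>\<Delta>(f \<circ> \<phi>) = \<mu> (\<Delta>f \<circ> \<phi>) + \<Sum>\<^sub>\<alpha> (\<partial>\<^sub>\<alpha>f \<circ> \<phi>) \<Delta>\<phi>\<^sup>\<alpha>\<close>.  Applying it a
  second time gives the formula of (iii), except that its last summand contains
  \<open>\<Sum>\<^sub>\<alpha>\<^sub>\<beta> (\<partial>\<^sub>\<beta>\<partial>\<^sub>\<alpha>f \<circ> \<phi>) T\<^sub>\<alpha>\<^sub>\<beta>\<close> with the symmetric matrix
  \<open>T\<^sub>\<alpha>\<^sub>\<beta> = \<Delta>\<phi>\<^sup>\<alpha>\<Delta>\<phi>\<^sup>\<beta> + \<Gamma>(\<phi>\<^sup>\<alpha>,\<Delta>\<phi>\<^sup>\<beta>) + \<Gamma>(\<phi>\<^sup>\<beta>,\<Delta>\<phi>\<^sup>\<alpha>)\<close>.  Since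
  \<open>\<Delta>\<^sup>2(\<phi>\<^sup>\<alpha>\<phi>\<^sup>\<beta>) = 2T\<^sub>\<alpha>\<^sub>\<beta> + 2\<delta>\<^sub>\<alpha>\<^sub>\<beta>\<Delta>\<mu>\<close>, biharmonicity of \<open>(\<phi>\<^sup>\<alpha> + i\<phi>\<^sup>\<beta>)\<^sup>2\<close> says that \<open>T\<close> is a multiple of the
  identity (\<open>second_coeff_scalar\<close>), and the sum collapses to \<open>T\<^sub>1\<^sub>1 (\<Delta>f \<circ> \<phi>)\<close>.

  From (iii) to (i) nothing is left to do: each summand contains \<open>\<Delta>f\<close> or one of its derivatives.

  The three rules are local computations in one chart.  They can be iterated because \<open>\<Delta>u\<close> and \<open>\<Gamma>(u,v)\<close> do not
  depend on the chart (\<open>laplacian_in_chart\<close>, \<open>grad_inner_in_chart\<close>), so that they are again smooth functions.  For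
  \<open>\<Delta>\<close> this rests on the transformation law of the Christoffel symbols (\<open>coord_christoffel_vec_pullback\<close>).
\<close>

section \<open>Calculus of \<open>C\<^sup>k\<close> functions\<close>

lemma frechet_derivative_cong_open:
  assumes "open S" "x \<in> S" "\<And>y. y \<in> S \<Longrightarrow> f y = g y"
  shows "frechet_derivative f (at x) = frechet_derivative g (at x)"
proof -
  have "(f has_derivative D) (at x) \<longleftrightarrow> (g has_derivative D) (at x)" for D
    using has_derivative_transform_within_open[OF _ assms(1,2), of f D UNIV g]
      has_derivative_transform_within_open[OF _ assms(1,2), of g D UNIV f] assms(3) by auto
  then show ?thesis
    by (simp add: frechet_derivative_def)
qed

lemma Ck_on_cong:
  assumes "open S" "\<And>y. y \<in> S \<Longrightarrow> f y = g y" "Ck_on k S f"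
  shows "Ck_on k S g"
  using assms(2,3)
proof (induction k arbitrary: f g)
  case 0
  then show ?case
    using continuous_on_cong by force
next
  case (Suc k)
  have "g differentiable (at x)" if x: "x \<in> S" for x
  proof -
    obtain D where "(f has_derivative D) (at x)"
      using Suc.prems(2) x by (auto simp: differentiable_def)
    then have "(g has_derivative D) (at x)"
      using has_derivative_transform_within_open[of f D x UNIV S g] assms(1) Suc.prems(1) x by blast
    then show ?thesis
      by (auto simp: differentiable_def)
  qed
  moreover have "Ck_on k S (\<lambda>x. frechet_derivative g (at x) v)" for v
  proof (rule Suc.IH)
    show "frechet_derivative f (at x) v = frechet_derivative g (at x) v" if "x \<in> S" for x
      by (rule fun_cong[OF frechet_derivative_cong_open[OF assms(1) that Suc.prems(1)]])
  qed (use Suc.prems(2) in simp)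
  ultimately show ?case
    by simp
qed

lemma Ck_on_Suc_imp: "Ck_on (Suc k) S f \<Longrightarrow> Ck_on k S f"
proof (induction k arbitrary: f)
  case 0
  then show ?case
    by (auto intro!: continuous_at_imp_continuous_on differentiable_imp_continuous_within)
next
  case (Suc k)
  then show ?case
    by (metis Ck_on.simps(2))
qed

lemma Ck_on_subset: "Ck_on k S f \<Longrightarrow> T \<subseteq> S \<Longrightarrow> Ck_on k T f"
  by (induction k arbitrary: f) (auto intro: continuous_on_subset)

text \<open>A derivative is usually known in closed form on \<open>S\<close> only, while \<open>Ck_on\<close> speaks of
  \<open>frechet_derivative\<close>; on an open set the two are interchangeable.\<close>

lemma Ck_on_SucI:
  assumes "open S" "\<And>x. x \<in> S \<Longrightarrow> (f has_derivative D x) (at x)" "\<And>v. Ck_on k S (\<lambda>x. D x v)"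
  shows "Ck_on (Suc k) S f"
proof -
  have "Ck_on k S (\<lambda>x. frechet_derivative f (at x) v)" for v
    by (rule Ck_on_cong[OF assms(1) _ assms(3)[of v]])
      (use assms(2) frechet_derivative_at in fastforce)
  then show ?thesis
    using assms(2) by (auto simp: differentiable_def)
qed

lemma Ck_on_SucD:
  assumes "Ck_on (Suc k) S f" "x \<in> S"
  shows "(f has_derivative frechet_derivative f (at x)) (at x)"
  using assms frechet_derivative_works by auto

lemma Ck_on_add:
  assumes "open S" "Ck_on k S f" "Ck_on k S g"
  shows "Ck_on k S (\<lambda>x. f x + g x)"
  using assms(2,3)
proof (induction k arbitrary: f g)
  case 0
  then show ?case by (auto intro: continuous_intros)
next
  case (Suc k)
  show ?case
    by (rule Ck_on_SucI[OF assms(1) has_derivative_add[OF Ck_on_SucD Ck_on_SucD]])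
      (use Suc in auto)
qed

lemma Ck_on_bounded_linear:
  assumes "open S" "bounded_linear h" "Ck_on k S f"
  shows "Ck_on k S (\<lambda>x. h (f x))"
  using assms(3)
proof (induction k arbitrary: f)
  case 0
  then show ?case
    using bounded_linear.continuous_on[OF assms(2)] by auto
next
  case (Suc k)
  show ?case
    by (rule Ck_on_SucI[OF assms(1) bounded_linear.has_derivative[OF assms(2) Ck_on_SucD]])
      (use Suc in auto)
qed

lemma Ck_on_bounded_bilinear:
  assumes "open S" "bounded_bilinear h" "Ck_on k S f" "Ck_on k S g"
  shows "Ck_on k S (\<lambda>x. h (f x) (g x))"
  using assms(3,4)
proof (induction k arbitrary: f g)
  case 0
  then show ?case
    using bounded_bilinear.continuous_on[OF assms(2)] by auto
next
  case (Suc k)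
  have fg: "Ck_on k S f" "Ck_on k S g"
    using Suc.prems Ck_on_Suc_imp by blast+
  show ?case
    by (rule Ck_on_SucI[OF assms(1) bounded_bilinear.FDERIV[OF assms(2) Ck_on_SucD Ck_on_SucD]])
      (use Suc fg in \<open>auto intro!: Ck_on_add[OF assms(1)]\<close>)
qed

lemma Ck_on_sum:
  assumes "open S" "\<And>i. i \<in> I \<Longrightarrow> Ck_on k S (f i)"
  shows "Ck_on k S (\<lambda>x. \<Sum>i\<in>I. f i x)"
  using assms(2)
  by (induction I rule: infinite_finite_induct) (auto intro: Ck_on_const Ck_on_add[OF assms(1)])

lemma Ck_on_prod:
  fixes f :: "'i \<Rightarrow> 'a::real_normed_vector \<Rightarrow> real"
  assumes "open S" "\<And>i. i \<in> I \<Longrightarrow> Ck_on k S (f i)"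
  shows "Ck_on k S (\<lambda>x. \<Prod>i\<in>I. f i x)"
  using assms(2)
  by (induction I rule: infinite_finite_induct)
    (auto intro: Ck_on_const Ck_on_bounded_bilinear[OF assms(1) bounded_bilinear_mult])

lemma Ck_on_inverse:
  fixes f :: "'a::real_normed_vector \<Rightarrow> real"
  assumes "open S" "\<And>x. x \<in> S \<Longrightarrow> f x \<noteq> 0" "Ck_on k S f"
  shows "Ck_on k S (\<lambda>x. inverse (f x))"
  using assms(3)
proof (induction k)
  case 0
  then show ?case
    using assms(2) by (auto intro: continuous_intros)
next
  case (Suc k)
  \<comment> \<open>The derivative of \<open>1/f\<close> is a polynomial in \<open>1/f\<close> and \<open>f'\<close>, so its regularity is that of \<open>1/f\<close> one order below.\<close>
  have "Ck_on k S (\<lambda>x. inverse (f x))"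
    using Suc Ck_on_Suc_imp by blast
  then have "Ck_on k S (\<lambda>x. inverse (f x) * frechet_derivative f (at x) v * inverse (f x))" for v
    using Suc.prems by (auto intro!: Ck_on_bounded_bilinear[OF assms(1) bounded_bilinear_mult])
  then have "Ck_on k S (\<lambda>x. - (inverse (f x) * frechet_derivative f (at x) v * inverse (f x)))" for v
    by (rule Ck_on_bounded_linear[OF assms(1) bounded_linear_minus[OF bounded_linear_ident]])
  then show ?case
    by (intro Ck_on_SucI[OF assms(1) Deriv.has_derivative_inverse[OF assms(2) Ck_on_SucD[OF Suc.prems]]]) auto
qed

text \<open>Since only directional derivatives enter \<open>Ck_on\<close>, the chain rule has to be expanded in a basis of the
  intermediate space before the induction hypothesis applies.\<close>

lemma Ck_on_compose:
  fixes g :: "'a::real_normed_vector \<Rightarrow> 'b::euclidean_space"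
  assumes "open S" "open T" "g ` S \<subseteq> T" "Ck_on k T f" "Ck_on k S g"
  shows "Ck_on k S (\<lambda>x. f (g x))"
  using assms(4,5)
proof (induction k arbitrary: f)
  case 0
  then show ?case
    using continuous_on_compose2 assms(3) by auto
next
  case (Suc k)
  have g: "Ck_on k S g"
    using Suc.prems Ck_on_Suc_imp by blast
  have lin: "linear (frechet_derivative f (at (g x)))" if "x \<in> S" for x
    using Ck_on_SucD[OF Suc.prems(1)] assms(3) that has_derivative_linear by blast
  define D where "D x v = (\<Sum>b\<in>Basis. (frechet_derivative g (at x) v \<bullet> b) *\<^sub>R frechet_derivative f (at (g x)) b)" for x v
  have "((\<lambda>x. f (g x)) has_derivative D x) (at x)" if "x \<in> S" for x
  proof -
    have chain: "((\<lambda>x. f (g x)) has_derivative (\<lambda>v. frechet_derivative f (at (g x)) (frechet_derivative g (at x) v))) (at x)"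
      using diff_chain_at[OF Ck_on_SucD[OF Suc.prems(2) that] Ck_on_SucD[OF Suc.prems(1)]] assms(3) that
      by (auto simp: o_def)
    have expand: "frechet_derivative f (at (g x)) w = (\<Sum>b\<in>Basis. (w \<bullet> b) *\<^sub>R frechet_derivative f (at (g x)) b)" for w
    proof -
      have "frechet_derivative f (at (g x)) (\<Sum>b\<in>Basis. (w \<bullet> b) *\<^sub>R b) =
          (\<Sum>b\<in>Basis. (w \<bullet> b) *\<^sub>R frechet_derivative f (at (g x)) b)"
        by (simp only: linear_sum[OF lin[OF that]] linear_scale[OF lin[OF that]])
      then show ?thesis
        by (simp only: euclidean_representation)
    qed
    have "(\<lambda>v. frechet_derivative f (at (g x)) (frechet_derivative g (at x) v)) = D x"
      unfolding D_def by (rule ext, rule expand)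
    with chain show ?thesis
      by (simp only:)
  qed
  moreover have "Ck_on k S (\<lambda>x. D x v)" for v
    unfolding D_def
  proof (rule Ck_on_sum[OF assms(1)])
    fix b :: 'b assume "b \<in> Basis"
    have "Ck_on k S (\<lambda>x. frechet_derivative g (at x) v \<bullet> b)"
      by (rule Ck_on_bounded_linear[OF assms(1) bounded_linear_inner_left]) (use Suc.prems(2) in auto)
    moreover have "Ck_on k S (\<lambda>x. frechet_derivative f (at (g x)) b)"
      using Suc.IH[of "\<lambda>y. frechet_derivative f (at y) b"] Suc.prems(1) g by auto
    ultimately show "Ck_on k S (\<lambda>x. (frechet_derivative g (at x) v \<bullet> b) *\<^sub>R frechet_derivative f (at (g x)) b)"
      by (rule Ck_on_bounded_bilinear[OF assms(1) bounded_bilinear_scaleR])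
  qed
  ultimately show ?case
    using Ck_on_SucI[OF assms(1)] by blast
qed

lemma smooth_on_cong: "open S \<Longrightarrow> (\<And>y. y \<in> S \<Longrightarrow> f y = g y) \<Longrightarrow> smooth_on S f \<Longrightarrow> smooth_on S g"
  unfolding smooth_on_def using Ck_on_cong by blast

lemma smooth_on_subset: "smooth_on S f \<Longrightarrow> T \<subseteq> S \<Longrightarrow> smooth_on T f"
  unfolding smooth_on_def using Ck_on_subset by blast

lemma smooth_on_const: "smooth_on S (\<lambda>_. c)"
  by (simp add: smooth_on_def Ck_on_const)

lemma smooth_on_add: "open S \<Longrightarrow> smooth_on S f \<Longrightarrow> smooth_on S g \<Longrightarrow> smooth_on S (\<lambda>x. f x + g x)"
  by (simp add: smooth_on_def Ck_on_add)

lemma smooth_on_bounded_linear: "open S \<Longrightarrow> bounded_linear h \<Longrightarrow> smooth_on S f \<Longrightarrow> smooth_on S (\<lambda>x. h (f x))"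
  by (simp add: smooth_on_def Ck_on_bounded_linear)

lemma smooth_on_bounded_bilinear:
  "open S \<Longrightarrow> bounded_bilinear h \<Longrightarrow> smooth_on S f \<Longrightarrow> smooth_on S g \<Longrightarrow> smooth_on S (\<lambda>x. h (f x) (g x))"
  by (simp add: smooth_on_def Ck_on_bounded_bilinear)

lemma smooth_on_mult:
  fixes f g :: "'a::real_normed_vector \<Rightarrow> real"
  shows "open S \<Longrightarrow> smooth_on S f \<Longrightarrow> smooth_on S g \<Longrightarrow> smooth_on S (\<lambda>x. f x * g x)"
  by (rule smooth_on_bounded_bilinear[OF _ bounded_bilinear_mult])

lemma smooth_on_minus: "open S \<Longrightarrow> smooth_on S f \<Longrightarrow> smooth_on S (\<lambda>x. - f x)"
  by (rule smooth_on_bounded_linear[OF _ bounded_linear_minus[OF bounded_linear_ident]])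

lemma smooth_on_diff: "open S \<Longrightarrow> smooth_on S f \<Longrightarrow> smooth_on S g \<Longrightarrow> smooth_on S (\<lambda>x. f x - g x)"
  using smooth_on_add[OF _ _ smooth_on_minus] by fastforce

lemma smooth_on_sum: "open S \<Longrightarrow> (\<And>i. i \<in> I \<Longrightarrow> smooth_on S (f i)) \<Longrightarrow> smooth_on S (\<lambda>x. \<Sum>i\<in>I. f i x)"
  by (simp add: smooth_on_def Ck_on_sum)

lemma smooth_on_prod:
  fixes f :: "'i \<Rightarrow> 'a::real_normed_vector \<Rightarrow> real"
  shows "open S \<Longrightarrow> (\<And>i. i \<in> I \<Longrightarrow> smooth_on S (f i)) \<Longrightarrow> smooth_on S (\<lambda>x. \<Prod>i\<in>I. f i x)"
  by (simp add: smooth_on_def Ck_on_prod)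

lemma smooth_on_divide:
  fixes f g :: "'a::real_normed_vector \<Rightarrow> real"
  assumes "open S" "smooth_on S f" "smooth_on S g" "\<And>x. x \<in> S \<Longrightarrow> g x \<noteq> 0"
  shows "smooth_on S (\<lambda>x. f x / g x)"
  unfolding divide_inverse using assms
  by (intro smooth_on_mult) (auto simp: smooth_on_def Ck_on_inverse)

lemma smooth_on_compose:
  fixes g :: "'a::real_normed_vector \<Rightarrow> 'b::euclidean_space"
  shows "open S \<Longrightarrow> open T \<Longrightarrow> g ` S \<subseteq> T \<Longrightarrow> smooth_on T f \<Longrightarrow> smooth_on S g \<Longrightarrow> smooth_on S (\<lambda>x. f (g x))"
  by (simp add: smooth_on_def Ck_on_compose)

lemma smooth_on_nth: "open S \<Longrightarrow> smooth_on S f \<Longrightarrow> smooth_on S (\<lambda>x. f x $ i)"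
  by (rule smooth_on_bounded_linear[OF _ bounded_linear_vec_nth])

lemma smooth_on_frechet_derivative: "smooth_on S f \<Longrightarrow> smooth_on S (\<lambda>x. frechet_derivative f (at x) v)"
  unfolding smooth_on_def using Ck_on.simps(2) by blast

lemma smooth_on_pd: "smooth_on S f \<Longrightarrow> smooth_on S (pd i f)"
  using smooth_on_frechet_derivative[of S f "axis i 1"] by (simp add: pd_def[abs_def])

lemma smooth_on_has_derivative:
  "smooth_on S f \<Longrightarrow> x \<in> S \<Longrightarrow> (f has_derivative frechet_derivative f (at x)) (at x)"
  unfolding smooth_on_def using Ck_on_SucD by blast

lemma smooth_on_continuous_on: "smooth_on S f \<Longrightarrow> continuous_on S f"
  unfolding smooth_on_def using Ck_on.simps(1) by blast

lemma linear_frechet_derivative: "smooth_on S f \<Longrightarrow> x \<in> S \<Longrightarrow> linear (frechet_derivative f (at x))"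
  using smooth_on_has_derivative has_derivative_linear by blast

lemma smooth_on_det:
  fixes A :: "'a::real_normed_vector \<Rightarrow> real^'n^'n"
  assumes "open S" "\<And>i j. smooth_on S (\<lambda>x. A x $ i $ j)"
  shows "smooth_on S (\<lambda>x. det (A x))"
  unfolding det_def using assms
  by (intro smooth_on_sum smooth_on_mult smooth_on_prod smooth_on_const) auto

lemma matrix_inv_inverse:
  fixes A :: "real^'n^'n"
  assumes "invertible A"
  shows "A ** matrix_inv A = mat 1" "matrix_inv A ** A = mat 1"
proof -
  have "\<exists>B. A ** B = mat 1 \<and> B ** A = mat 1"
    using assms by (simp add: invertible_def)
  then have "A ** matrix_inv A = mat 1 \<and> matrix_inv A ** A = mat 1"
    unfolding matrix_inv_def by (rule someI_ex)
  then show "A ** matrix_inv A = mat 1" "matrix_inv A ** A = mat 1"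
    by auto
qed

lemma matrix_inv_unique:
  fixes A B :: "real^'n^'n"
  assumes "A ** B = mat 1"
  shows "matrix_inv A = B"
proof -
  have "invertible A"
    using assms invertible_right_inverse by blast
  then have "matrix_inv A ** (A ** B) = B"
    by (simp add: matrix_mul_assoc matrix_inv_inverse)
  then show ?thesis
    by (simp add: assms)
qed

text \<open>By Cramer's rule, the entries of the inverse are quotients of polynomials in the entries of the matrix.\<close>

lemma smooth_on_matrix_inv:
  fixes A :: "'a::real_normed_vector \<Rightarrow> real^'n^'n"
  assumes "open S" "\<And>i j. smooth_on S (\<lambda>x. A x $ i $ j)" "\<And>x. x \<in> S \<Longrightarrow> invertible (A x)"
  shows "smooth_on S (\<lambda>x. matrix_inv (A x) $ i $ j)"
proof -
  have nz: "det (A x) \<noteq> 0" if "x \<in> S" for x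
    using assms(3)[OF that] invertible_det_nz by blast
  let ?C = "\<lambda>x. \<chi> r s. if s = i then axis j 1 $ r else A x $ r $ s"
  have *: "matrix_inv (A x) $ i $ j = det (?C x) / det (A x)" if "x \<in> S" for x
  proof -
    have "A x *v (matrix_inv (A x) *v axis j 1) = axis j 1"
      using assms(3)[OF that] by (simp add: matrix_vector_mul_assoc matrix_inv_inverse)
    then have "matrix_inv (A x) *v axis j 1 = (\<chi> k. det (\<chi> r s. if s = k then axis j 1 $ r else A x $ r $ s) / det (A x))"
      using cramer[OF nz[OF that]] by blast
    then have "(matrix_inv (A x) *v axis j 1) $ i = det (?C x) / det (A x)"
      by simp
    then show ?thesis
      by (simp add: matrix_vector_mul_component inner_axis)
  qed
  have "smooth_on S (\<lambda>x. det (?C x))"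
  proof (rule smooth_on_det[OF assms(1)])
    show "smooth_on S (\<lambda>x. ?C x $ r $ s)" for r s
      by (cases "s = i") (simp_all add: smooth_on_const assms(2))
  qed
  then have "smooth_on S (\<lambda>x. det (?C x) / det (A x))"
    by (rule smooth_on_divide[OF assms(1) _ smooth_on_det[OF assms(1,2)] nz])
  then show ?thesis
    using * by (intro smooth_on_cong[OF assms(1) _ \<open>smooth_on S (\<lambda>x. det (?C x) / det (A x))\<close>]) auto
qed


section \<open>Equality of mixed derivatives\<close>

lemma has_real_derivative_along_line:
  fixes f :: "'a::real_normed_vector \<Rightarrow> real"
  assumes "smooth_on S f" "a + s *\<^sub>R v \<in> S"
  shows "((\<lambda>s. f (a + s *\<^sub>R v)) has_real_derivative frechet_derivative f (at (a + s *\<^sub>R v)) v) (at s)"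
proof -
  have "((\<lambda>s. a + s *\<^sub>R v) has_derivative (\<lambda>h. h *\<^sub>R v)) (at s)"
    by (auto intro!: derivative_eq_intros)
  from diff_chain_at[OF this smooth_on_has_derivative[OF assms]]
  have "((\<lambda>s. f (a + s *\<^sub>R v)) has_derivative (\<lambda>h. frechet_derivative f (at (a + s *\<^sub>R v)) (h *\<^sub>R v))) (at s)"
    by (simp add: o_def)
  then show ?thesis
    by (simp add: has_field_derivative_def linear_scale[OF linear_frechet_derivative[OF assms]] mult_commute_abs)
qed

text \<open>Two applications of the mean value theorem evaluate a second difference, which is symmetric in \<open>v\<close>
  and \<open>w\<close>, by a mixed derivative at a nearby point.\<close>

lemma second_difference_mean_value:
  fixes f :: "'a::real_normed_vector \<Rightarrow> real"
  assumes "smooth_on S f" "0 < e"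
    and S: "\<And>s t. 0 \<le> s \<Longrightarrow> s \<le> e \<Longrightarrow> 0 \<le> t \<Longrightarrow> t \<le> e \<Longrightarrow> x + s *\<^sub>R v + t *\<^sub>R w \<in> S"
  obtains s t where "0 < s" "s < e" "0 < t" "t < e"
    "f (x + e *\<^sub>R v + e *\<^sub>R w) - f (x + e *\<^sub>R v) - f (x + e *\<^sub>R w) + f x =
       e\<^sup>2 * frechet_derivative (\<lambda>y. frechet_derivative f (at y) v) (at (x + s *\<^sub>R v + t *\<^sub>R w)) w"
proof -
  let ?F = "\<lambda>y. frechet_derivative f (at y) v"
  have "((\<lambda>s. f (x + e *\<^sub>R w + s *\<^sub>R v) - f (x + s *\<^sub>R v)) has_real_derivative
      ?F (x + e *\<^sub>R w + s *\<^sub>R v) - ?F (x + s *\<^sub>R v)) (at s)" if "0 \<le> s" "s \<le> e" for s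
    using S[of s e] S[of s 0] that assms(1,2)
    by (intro DERIV_diff has_real_derivative_along_line) (auto simp: algebra_simps)
  from MVT2[OF assms(2) this] obtain s where s: "0 < s" "s < e"
    and 1: "f (x + e *\<^sub>R w + e *\<^sub>R v) - f (x + e *\<^sub>R v) - (f (x + e *\<^sub>R w + 0 *\<^sub>R v) - f (x + 0 *\<^sub>R v)) =
      (e - 0) * (?F (x + e *\<^sub>R w + s *\<^sub>R v) - ?F (x + s *\<^sub>R v))"
    by blast
  have "((\<lambda>t. ?F (x + s *\<^sub>R v + t *\<^sub>R w)) has_real_derivative
      frechet_derivative ?F (at (x + s *\<^sub>R v + t *\<^sub>R w)) w) (at t)" if "0 \<le> t" "t \<le> e" for t
    using S[of s t] that s
    by (intro has_real_derivative_along_line[OF smooth_on_frechet_derivative[OF assms(1)]]) auto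
  from MVT2[OF assms(2) this] obtain t where t: "0 < t" "t < e"
    and 2: "?F (x + s *\<^sub>R v + e *\<^sub>R w) - ?F (x + s *\<^sub>R v + 0 *\<^sub>R w) =
      (e - 0) * frechet_derivative ?F (at (x + s *\<^sub>R v + t *\<^sub>R w)) w"
    by blast
  have "f (x + e *\<^sub>R v + e *\<^sub>R w) - f (x + e *\<^sub>R v) - f (x + e *\<^sub>R w) + f x =
      e * (?F (x + s *\<^sub>R v + e *\<^sub>R w) - ?F (x + s *\<^sub>R v + 0 *\<^sub>R w))"
    using 1 by (simp add: algebra_simps)
  also have "\<dots> = e\<^sup>2 * frechet_derivative ?F (at (x + s *\<^sub>R v + t *\<^sub>R w)) w"
    unfolding 2 by (simp add: power2_eq_square)
  finally show ?thesis
    using that s t by blast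
qed

text \<open>The same second difference equals \<open>e\<^sup>2\<close> times either mixed derivative at points that tend to \<open>x\<close> with \<open>e\<close>;
  by continuity the two limits agree.\<close>

lemma frechet_derivative_commute:
  fixes f :: "'a::real_normed_vector \<Rightarrow> real"
  assumes "open S" "x \<in> S" "smooth_on S f"
  shows "frechet_derivative (\<lambda>y. frechet_derivative f (at y) v) (at x) w =
         frechet_derivative (\<lambda>y. frechet_derivative f (at y) w) (at x) v" (is "?H v w x = ?H w v x")
proof (rule ccontr)
  assume neq: "?H v w x \<noteq> ?H w v x"
  define d where "d = \<bar>?H v w x - ?H w v x\<bar> / 2"
  have "d > 0"
    using neq by (simp add: d_def)
  have "isCont (?H v w) x" "isCont (?H w v) x"
    using smooth_on_continuous_on[OF smooth_on_frechet_derivative[OF smooth_on_frechet_derivative[OF assms(3)]]]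
      continuous_on_eq_continuous_at[OF assms(1)] assms(2) by blast+
  then obtain r1 r2 where r: "r1 > 0" "r2 > 0"
    "\<And>y. dist y x < r1 \<Longrightarrow> dist (?H v w y) (?H v w x) < d"
    "\<And>y. dist y x < r2 \<Longrightarrow> dist (?H w v y) (?H w v x) < d"
    using \<open>d > 0\<close> unfolding continuous_at_eps_delta by (metis (no_types, lifting))
  obtain r3 where r3: "r3 > 0" "\<And>y. dist y x < r3 \<Longrightarrow> y \<in> S"
    using assms(1,2) open_dist by blast
  define R where "R = min r1 (min r2 r3)"
  define e where "e = R / (2 * (norm v + norm w + 1))"
  have R: "R > 0" "R \<le> r1" "R \<le> r2" "R \<le> r3"
    using r r3 by (auto simp: R_def)
  have pos: "norm v + norm w + 1 > 0"
    using norm_ge_zero[of v] norm_ge_zero[of w] by linarith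
  then have e: "e > 0"
    using R by (simp add: e_def)
  have close: "dist (x + s *\<^sub>R v' + t *\<^sub>R w') x < R"
    if "0 \<le> s" "s \<le> e" "0 \<le> t" "t \<le> e" "norm v' + norm w' = norm v + norm w" for s t v' w'
  proof -
    have "dist (x + s *\<^sub>R v' + t *\<^sub>R w') x = norm (s *\<^sub>R v' + t *\<^sub>R w')"
      by (simp add: dist_norm)
    also have "\<dots> \<le> s * norm v' + t * norm w'"
      using norm_triangle_ineq[of "s *\<^sub>R v'" "t *\<^sub>R w'"] that by simp
    also have "\<dots> \<le> e * norm v' + e * norm w'"
      using that by (intro add_mono mult_right_mono) auto
    also have "\<dots> \<le> e * (norm v + norm w + 1)"
      using that(5) e by (simp add: distrib_left[symmetric])
    also have "\<dots> = R / 2"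
      using pos by (simp add: e_def field_simps)
    finally show ?thesis
      using R by linarith
  qed
  have S: "x + s *\<^sub>R v' + t *\<^sub>R w' \<in> S"
    if "0 \<le> s" "s \<le> e" "0 \<le> t" "t \<le> e" "norm v' + norm w' = norm v + norm w" for s t v' w'
    by (rule r3(2), rule less_le_trans[OF close[OF that] R(4)])
  obtain s t where st: "0 < s" "s < e" "0 < t" "t < e"
    and 1: "f (x + e *\<^sub>R v + e *\<^sub>R w) - f (x + e *\<^sub>R v) - f (x + e *\<^sub>R w) + f x = e\<^sup>2 * ?H v w (x + s *\<^sub>R v + t *\<^sub>R w)"
    by (rule second_difference_mean_value[OF assms(3) e, of x v w]) (auto intro: S)
  obtain s' t' where st': "0 < s'" "s' < e" "0 < t'" "t' < e"
    and 2: "f (x + e *\<^sub>R w + e *\<^sub>R v) - f (x + e *\<^sub>R w) - f (x + e *\<^sub>R v) + f x = e\<^sup>2 * ?H w v (x + s' *\<^sub>R w + t' *\<^sub>R v)"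
    by (rule second_difference_mean_value[OF assms(3) e, of x w v]) (auto intro: S)
  have "x + e *\<^sub>R w + e *\<^sub>R v = x + e *\<^sub>R v + e *\<^sub>R w"
    by (simp add: algebra_simps)
  from 1 2[unfolded this] have "e\<^sup>2 * ?H v w (x + s *\<^sub>R v + t *\<^sub>R w) = e\<^sup>2 * ?H w v (x + s' *\<^sub>R w + t' *\<^sub>R v)"
    by linarith
  then have "?H v w (x + s *\<^sub>R v + t *\<^sub>R w) = ?H w v (x + s' *\<^sub>R w + t' *\<^sub>R v)"
    using e by simp
  moreover have "dist (?H v w (x + s *\<^sub>R v + t *\<^sub>R w)) (?H v w x) < d"
    using r(3) close[of s t v w] st R by simp
  moreover have "dist (?H w v (x + s' *\<^sub>R w + t' *\<^sub>R v)) (?H w v x) < d"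
    using r(4) close[of s' t' w v] st' R by simp
  ultimately have "dist (?H v w x) (?H w v x) < d + d"
    using dist_triangle3[of "?H v w x" "?H w v x" "?H v w (x + s *\<^sub>R v + t *\<^sub>R w)"] by simp
  then show False
    by (simp add: dist_real_def d_def)
qed

lemma pd_commute:
  assumes "open S" "x \<in> S" "smooth_on S f"
  shows "pd i (pd j f) x = pd j (pd i f) x"
  using frechet_derivative_commute[OF assms] by (simp add: pd_def[abs_def])

lemma frechet_derivative_nth:
  fixes f :: "'a::real_normed_vector \<Rightarrow> real^'n"
  assumes "(f has_derivative D) (at x)"
  shows "frechet_derivative (\<lambda>y. f y $ i) (at x) v = D v $ i"
  using frechet_derivative_at[OF bounded_linear.has_derivative[OF bounded_linear_vec_nth assms]] by metis

lemma frechet_derivative_commute_vec: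
  fixes f :: "'a::real_normed_vector \<Rightarrow> real^'n"
  assumes "open S" "x \<in> S" "smooth_on S f"
  shows "frechet_derivative (\<lambda>y. frechet_derivative f (at y) v) (at x) w =
         frechet_derivative (\<lambda>y. frechet_derivative f (at y) w) (at x) v"
proof (rule vec_eq_iff[THEN iffD2], rule allI)
  fix i
  have *: "frechet_derivative (\<lambda>y. frechet_derivative (\<lambda>y. f y $ i) (at y) v) (at x) w =
      frechet_derivative (\<lambda>y. frechet_derivative f (at y) v) (at x) w $ i" for v w
  proof -
    have "frechet_derivative (\<lambda>y. frechet_derivative (\<lambda>y. f y $ i) (at y) v) (at x) w =
       frechet_derivative (\<lambda>y. frechet_derivative f (at y) v $ i) (at x) w"
      by (subst frechet_derivative_cong_open[OF assms(1,2)])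
        (auto simp: frechet_derivative_nth[OF smooth_on_has_derivative[OF assms(3)]])
    also have "\<dots> = frechet_derivative (\<lambda>y. frechet_derivative f (at y) v) (at x) w $ i"
      by (rule frechet_derivative_nth[OF smooth_on_has_derivative[OF smooth_on_frechet_derivative[OF assms(3)] assms(2)]])
    finally show ?thesis .
  qed
  show "frechet_derivative (\<lambda>y. frechet_derivative f (at y) v) (at x) w $ i =
         frechet_derivative (\<lambda>y. frechet_derivative f (at y) w) (at x) v $ i"
    unfolding *[symmetric]
    by (rule frechet_derivative_commute[OF assms(1,2) smooth_on_nth[OF assms(1,3)]])
qed

section \<open>Metrics in coordinates\<close>

lemma pd_eqI: "(f has_derivative D) (at y) \<Longrightarrow> pd i f y = D (axis i 1)"
  unfolding pd_def using frechet_derivative_at by metis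

lemma pd_cong_open: "open S \<Longrightarrow> y \<in> S \<Longrightarrow> (\<And>z. z \<in> S \<Longrightarrow> f z = g z) \<Longrightarrow> pd i f y = pd i g y"
  unfolding pd_def using frechet_derivative_cong_open by metis

lemma frechet_derivative_pd:
  fixes f :: "real^'m \<Rightarrow> real"
  assumes "smooth_on S f" "y \<in> S"
  shows "frechet_derivative f (at y) v = (\<Sum>i\<in>UNIV. pd i f y * v $ i)"
proof -
  note lin = linear_frechet_derivative[OF assms]
  have "frechet_derivative f (at y) v = frechet_derivative f (at y) (\<Sum>i\<in>UNIV. v $ i *\<^sub>R axis i 1)"
    using basis_expansion[of v] by (simp add: scalar_mult_eq_scaleR)
  also have "\<dots> = (\<Sum>i\<in>UNIV. pd i f y * v $ i)"
    by (simp only: linear_sum[OF lin] linear_scale[OF lin] pd_def real_scaleR_def mult.commute)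
  finally show ?thesis .
qed

lemma bounded_bilinear_matrix_vector_mult: "bounded_bilinear ((*v) :: real^'m^'k \<Rightarrow> real^'m \<Rightarrow> real^'k)"
  unfolding bilinear_conv_bounded_bilinear[symmetric] bilinear_def
  by (auto intro!: linearI simp: matrix_vector_mult_add_rdistrib matrix_vector_right_distrib
      matrix_vector_mult_scaleR scaleR_matrix_vector_assoc)

definition coordinate_metric :: "(real^'m) set \<Rightarrow> (real^'m \<Rightarrow> real^'m^'m) \<Rightarrow> bool" where
  "coordinate_metric S G \<longleftrightarrow> open S \<and> smooth_on S G \<and>
     (\<forall>y\<in>S. transpose (G y) = G y \<and> (\<forall>v. v \<noteq> 0 \<longrightarrow> v \<bullet> (G y *v v) > 0))"

lemma coordinate_metricD:
  assumes "coordinate_metric S G"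
  shows "open S" "smooth_on S G"
    "y \<in> S \<Longrightarrow> transpose (G y) = G y" "y \<in> S \<Longrightarrow> v \<noteq> 0 \<Longrightarrow> v \<bullet> (G y *v v) > 0"
  using assms by (auto simp: coordinate_metric_def)

lemma coordinate_metric_sym:
  assumes "coordinate_metric S G" "y \<in> S"
  shows "v \<bullet> (G y *v w) = w \<bullet> (G y *v v)"
  using coordinate_metricD(3)[OF assms] dot_lmul_matrix[of v "G y" w] 
  by (simp add: inner_commute vector_transpose_matrix[symmetric] del: vector_transpose_matrix)

lemma coordinate_metric_invertible:
  assumes "coordinate_metric S G" "y \<in> S"
  shows "invertible (G y)"
proof -
  have "x = 0" if "G y *v x = 0" for x
    using coordinate_metricD(4)[OF assms, of x] that by force
  then show ?thesis
    unfolding invertible_left_inverse matrix_left_invertible_ker by blast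
qed

lemma coordinate_metric_inv_sym:
  assumes "coordinate_metric S G" "y \<in> S"
  shows "matrix_inv (G y) $ i $ j = matrix_inv (G y) $ j $ i"
proof -
  have "G y ** transpose (matrix_inv (G y)) = transpose (matrix_inv (G y) ** G y)"
    using coordinate_metricD(3)[OF assms] by (simp add: matrix_transpose_mul)
  also have "\<dots> = mat 1"
    by (simp add: matrix_inv_inverse(2)[OF coordinate_metric_invertible[OF assms]])
  finally have "matrix_inv (G y) = transpose (matrix_inv (G y))"
    by (rule matrix_inv_unique)
  then have "matrix_inv (G y) $ i $ j = transpose (matrix_inv (G y)) $ i $ j"
    by simp
  then show ?thesis
    by (simp add: transpose_def)
qed

lemma smooth_on_inverse_metric:
  assumes "coordinate_metric S G"
  shows "smooth_on S (\<lambda>y. matrix_inv (G y) $ i $ j)"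
  using coordinate_metricD(1,2)[OF assms] coordinate_metric_invertible[OF assms]
  by (intro smooth_on_matrix_inv) (auto intro: smooth_on_nth[OF _ smooth_on_nth])

text \<open>The classical coordinate expressions, detached from any manifold: the metric is a matrix-valued function on
  an open subset of \<open>real^'m\<close>.  \<open>coord_grad_inner\<close> is \<open>g(\<nabla>u,\<nabla>v)\<close>, computed by contracting the two differentials
  with the inverse metric.\<close>

definition coord_christoffel :: "(real^'m \<Rightarrow> real^'m^'m) \<Rightarrow> 'm \<Rightarrow> 'm \<Rightarrow> 'm \<Rightarrow> real^'m \<Rightarrow> real" where
  "coord_christoffel G k i j y = 1/2 * (\<Sum>l\<in>UNIV. matrix_inv (G y) $ k $ l *
     (pd i (\<lambda>z. G z $ j $ l) y + pd j (\<lambda>z. G z $ i $ l) y - pd l (\<lambda>z. G z $ i $ j) y))"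

definition coord_hessian :: "(real^'m \<Rightarrow> real^'m^'m) \<Rightarrow> 'm \<Rightarrow> 'm \<Rightarrow> (real^'m \<Rightarrow> real) \<Rightarrow> real^'m \<Rightarrow> real" where
  "coord_hessian G i j u y = pd i (pd j u) y - (\<Sum>k\<in>UNIV. coord_christoffel G k i j y * pd k u y)"

definition coord_laplacian :: "(real^'m \<Rightarrow> real^'m^'m) \<Rightarrow> (real^'m \<Rightarrow> real) \<Rightarrow> real^'m \<Rightarrow> real" where
  "coord_laplacian G u y = (\<Sum>i\<in>UNIV. \<Sum>j\<in>UNIV. matrix_inv (G y) $ i $ j * coord_hessian G i j u y)"

definition coord_grad_inner :: "(real^'m \<Rightarrow> real^'m^'m) \<Rightarrow> (real^'m \<Rightarrow> real) \<Rightarrow> (real^'m \<Rightarrow> real) \<Rightarrow> real^'m \<Rightarrow> real" where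
  "coord_grad_inner G u v y = (\<Sum>i\<in>UNIV. \<Sum>j\<in>UNIV. matrix_inv (G y) $ i $ j * (pd i u y * pd j v y))"

section \<open>Invariance under changes of coordinates\<close>

text \<open>The inverse of a pulled-back metric is the push-forward of the inverse metric, so metric traces of
  bilinear forms do not depend on coordinates.\<close>

lemma metric_trace_pullback:
  fixes A A' :: "real^'m^'m"
  assumes "invertible A" "linear J" "inj J" "bilinear B"
    and AA': "\<And>v w. v \<bullet> (A *v w) = J v \<bullet> (A' *v J w)"
  shows "(\<Sum>i\<in>UNIV. \<Sum>j\<in>UNIV. matrix_inv A $ i $ j * B (J (axis i 1)) (J (axis j 1))) =
         (\<Sum>i\<in>UNIV. \<Sum>j\<in>UNIV. matrix_inv A' $ i $ j * B (axis i 1) (axis j 1))"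
proof -
  define P where "P = matrix J"
  have P: "J v = P *v v" for v
    unfolding P_def using matrix_works[of J] assms(2) by (simp add: linear_linear)
  have "invertible P"
    unfolding P_def using det_nz_iff_inj[OF assms(2)] assms(3) invertible_det_nz by blast
  then obtain Q where Q: "P ** Q = mat 1" "Q ** P = mat 1"
    by (auto simp: invertible_def)
  have "v \<bullet> (A *v w) = v \<bullet> ((transpose P ** A' ** P) *v w)" for v w
    unfolding AA' P by (simp add: matrix_vector_mul_assoc[symmetric]) (metis dot_lmul_matrix inner_commute)
  then have A: "A = transpose P ** A' ** P"
    by (metis matrix_eq vector_eq_ldot)
  have QP: "transpose Q ** transpose P = mat 1"
    using Q by (metis matrix_transpose_mul transpose_mat)
  have "A' ** (P ** matrix_inv A ** transpose P) = (transpose Q ** transpose P) ** A' ** P ** matrix_inv A ** transpose P"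
    by (simp add: QP matrix_mul_assoc)
  also have "\<dots> = transpose Q ** (A ** matrix_inv A) ** transpose P"
    by (simp add: A matrix_mul_assoc)
  also have "\<dots> = mat 1"
    by (simp add: matrix_inv_inverse[OF assms(1)] QP)
  finally have "matrix_inv A' = P ** matrix_inv A ** transpose P"
    by (rule matrix_inv_unique)
  then have A': "matrix_inv A' $ a $ b = (\<Sum>j\<in>UNIV. \<Sum>i\<in>UNIV. P $ a $ i * matrix_inv A $ i $ j * P $ b $ j)" for a b
    by (simp add: matrix_matrix_mult_def transpose_def sum_distrib_right)
  have J: "J (axis i 1) = (\<Sum>a\<in>UNIV. P $ a $ i *\<^sub>R axis a 1)" for i
    using basis_expansion[of "J (axis i 1)"]
    by (simp add: P matrix_vector_mul_component inner_axis scalar_mult_eq_scaleR)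
  have "B (J (axis i 1)) (J (axis j 1)) = (\<Sum>a\<in>UNIV. \<Sum>b\<in>UNIV. P $ a $ i * P $ b $ j * B (axis a 1) (axis b 1))" for i j
    unfolding J using assms(4)
    by (simp add: bilinear_sum sum.cartesian_product bilinear_lmul bilinear_rmul mult.assoc)
  then have "(\<Sum>i\<in>UNIV. \<Sum>j\<in>UNIV. matrix_inv A $ i $ j * B (J (axis i 1)) (J (axis j 1))) =
    (\<Sum>i\<in>UNIV. \<Sum>j\<in>UNIV. \<Sum>a\<in>UNIV. \<Sum>b\<in>UNIV. P $ a $ i * matrix_inv A $ i $ j * P $ b $ j * B (axis a 1) (axis b 1))"
    by (simp add: sum_distrib_left ac_simps)
  also have "\<dots> = (\<Sum>i\<in>UNIV. \<Sum>a\<in>UNIV. \<Sum>j\<in>UNIV. \<Sum>b\<in>UNIV. P $ a $ i * matrix_inv A $ i $ j * P $ b $ j * B (axis a 1) (axis b 1))"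
    by (intro sum.cong refl sum.swap)
  also have "\<dots> = (\<Sum>a\<in>UNIV. \<Sum>i\<in>UNIV. \<Sum>b\<in>UNIV. \<Sum>j\<in>UNIV. P $ a $ i * matrix_inv A $ i $ j * P $ b $ j * B (axis a 1) (axis b 1))"
    by (subst sum.swap) (intro sum.cong refl sum.swap)
  also have "\<dots> = (\<Sum>a\<in>UNIV. \<Sum>b\<in>UNIV. \<Sum>j\<in>UNIV. \<Sum>i\<in>UNIV. P $ a $ i * matrix_inv A $ i $ j * P $ b $ j * B (axis a 1) (axis b 1))"
    by (rule sum.cong[OF refl], subst sum.swap) (intro sum.cong refl sum.swap)
  also have "\<dots> = (\<Sum>a\<in>UNIV. \<Sum>b\<in>UNIV. matrix_inv A' $ a $ b * B (axis a 1) (axis b 1))"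
    by (simp add: A' sum_distrib_right)
  finally show ?thesis .
qed

text \<open>A change of coordinates mixes all indices, so the transformation laws are derived for bilinear forms
  evaluated on arbitrary vectors; the components are recovered on the standard basis.\<close>

definition coord_christoffel_vec :: "(real^'m \<Rightarrow> real^'m^'m) \<Rightarrow> real^'m \<Rightarrow> real^'m \<Rightarrow> real^'m \<Rightarrow> real^'m" where
  "coord_christoffel_vec G y X Y = (\<chi> k. \<Sum>i\<in>UNIV. \<Sum>j\<in>UNIV. X $ i * Y $ j * coord_christoffel G k i j y)"

definition coord_hessian_form :: "(real^'m \<Rightarrow> real^'m^'m) \<Rightarrow> (real^'m \<Rightarrow> real) \<Rightarrow> real^'m \<Rightarrow> real^'m \<Rightarrow> real^'m \<Rightarrow> real" where
  "coord_hessian_form G u y X Y =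
     frechet_derivative (\<lambda>z. frechet_derivative u (at z) Y) (at y) X - frechet_derivative u (at y) (coord_christoffel_vec G y X Y)"

lemma metric_derivative_entry:
  assumes "smooth_on S G" "y \<in> S"
  shows "Y \<bullet> (frechet_derivative G (at y) X *v Z) =
    (\<Sum>i\<in>UNIV. \<Sum>j\<in>UNIV. \<Sum>l\<in>UNIV. X $ i * Y $ j * Z $ l * pd i (\<lambda>z. G z $ j $ l) y)"
proof -
  note D = smooth_on_has_derivative[OF assms]
  have "((\<lambda>z. G z $ j $ l) has_derivative (\<lambda>v. frechet_derivative G (at y) v $ j $ l)) (at y)" for j l
    using bounded_linear.has_derivative[OF bounded_linear_vec_nth bounded_linear.has_derivative[OF bounded_linear_vec_nth D]] .
  then have pd: "pd i (\<lambda>z. G z $ j $ l) y = frechet_derivative G (at y) (axis i 1) $ j $ l" for i j l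
    by (rule pd_eqI)
  have "frechet_derivative G (at y) X = frechet_derivative G (at y) (\<Sum>i\<in>UNIV. X $ i *\<^sub>R axis i 1)"
    using basis_expansion[of X] by (simp add: scalar_mult_eq_scaleR)
  also have "\<dots> = (\<Sum>i\<in>UNIV. X $ i *\<^sub>R frechet_derivative G (at y) (axis i 1))"
    using linear_frechet_derivative[OF assms] by (simp only: linear_sum linear_scale)
  finally have X: "frechet_derivative G (at y) X $ j $ l = (\<Sum>i\<in>UNIV. X $ i * pd i (\<lambda>z. G z $ j $ l) y)" for j l
    by (simp add: pd)
  have "Y \<bullet> (frechet_derivative G (at y) X *v Z) =
    (\<Sum>j\<in>UNIV. \<Sum>l\<in>UNIV. \<Sum>i\<in>UNIV. X $ i * Y $ j * Z $ l * pd i (\<lambda>z. G z $ j $ l) y)"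
    by (simp add: inner_vec_def matrix_vector_mult_def X sum_distrib_left sum_distrib_right ac_simps)
  also have "\<dots> = (\<Sum>j\<in>UNIV. \<Sum>i\<in>UNIV. \<Sum>l\<in>UNIV. X $ i * Y $ j * Z $ l * pd i (\<lambda>z. G z $ j $ l) y)"
    by (intro sum.cong refl sum.swap)
  also have "\<dots> = (\<Sum>i\<in>UNIV. \<Sum>j\<in>UNIV. \<Sum>l\<in>UNIV. X $ i * Y $ j * Z $ l * pd i (\<lambda>z. G z $ j $ l) y)"
    by (rule sum.swap)
  finally show ?thesis .
qed

text \<open>The Koszul formula.  Contracting the Christoffel symbols with the metric cancels the inverse metric in their
  definition, and what remains involves derivatives of the metric only.\<close>

lemma metric_coord_christoffel_vec:
  assumes G: "coordinate_metric S G" and y: "y \<in> S"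
  shows "2 * (Z \<bullet> (G y *v coord_christoffel_vec G y X Y)) =
    Y \<bullet> (frechet_derivative G (at y) X *v Z) + X \<bullet> (frechet_derivative G (at y) Y *v Z) -
    X \<bullet> (frechet_derivative G (at y) Z *v Y)"
proof -
  note inv = matrix_inv_inverse(1)[OF coordinate_metric_invertible[OF G y]]
  define C where "C i j l = pd i (\<lambda>z. G z $ j $ l) y + pd j (\<lambda>z. G z $ i $ l) y - pd l (\<lambda>z. G z $ i $ j) y" for i j l
  have coord_christoffel: "2 * coord_christoffel G k i j y = (\<Sum>l\<in>UNIV. matrix_inv (G y) $ k $ l * C i j l)" for i j k
    by (simp add: coord_christoffel_def C_def)
  have low: "(\<Sum>k\<in>UNIV. G y $ l $ k * (2 * coord_christoffel G k i j y)) = C i j l" for i j l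
  proof -
    have "(\<Sum>k\<in>UNIV. G y $ l $ k * (2 * coord_christoffel G k i j y)) = (\<Sum>k\<in>UNIV. \<Sum>l'\<in>UNIV. G y $ l $ k * matrix_inv (G y) $ k $ l' * C i j l')"
      by (simp only: coord_christoffel sum_distrib_left mult.assoc)
    also have "\<dots> = (\<Sum>l'\<in>UNIV. (\<Sum>k\<in>UNIV. G y $ l $ k * matrix_inv (G y) $ k $ l') * C i j l')"
      by (subst sum.swap) (simp only: sum_distrib_right)
    also have "\<dots> = (\<Sum>l'\<in>UNIV. (G y ** matrix_inv (G y)) $ l $ l' * C i j l')"
      by (simp add: matrix_matrix_mult_def)
    also have "\<dots> = C i j l"
      by (simp add: inv mat_def if_distrib[of "\<lambda>t. t * _"] sum.delta cong: if_cong)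
    finally show ?thesis .
  qed
  have "2 * (G y *v coord_christoffel_vec G y X Y) $ l = (\<Sum>i\<in>UNIV. \<Sum>j\<in>UNIV. X $ i * Y $ j * C i j l)" for l
  proof -
    have "2 * (G y *v coord_christoffel_vec G y X Y) $ l =
      (\<Sum>k\<in>UNIV. \<Sum>i\<in>UNIV. \<Sum>j\<in>UNIV. X $ i * Y $ j * (G y $ l $ k * (2 * coord_christoffel G k i j y)))"
      by (simp add: matrix_vector_mult_def coord_christoffel_vec_def sum_distrib_left ac_simps)
    also have "\<dots> = (\<Sum>i\<in>UNIV. \<Sum>k\<in>UNIV. \<Sum>j\<in>UNIV. X $ i * Y $ j * (G y $ l $ k * (2 * coord_christoffel G k i j y)))"
      by (rule sum.swap)
    also have "\<dots> = (\<Sum>i\<in>UNIV. \<Sum>j\<in>UNIV. \<Sum>k\<in>UNIV. X $ i * Y $ j * (G y $ l $ k * (2 * coord_christoffel G k i j y)))"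
      by (intro sum.cong refl sum.swap)
    also have "\<dots> = (\<Sum>i\<in>UNIV. \<Sum>j\<in>UNIV. X $ i * Y $ j * C i j l)"
      by (simp only: sum_distrib_left[symmetric] low)
    finally show ?thesis .
  qed
  then have "2 * (Z \<bullet> (G y *v coord_christoffel_vec G y X Y)) = (\<Sum>l\<in>UNIV. Z $ l * (\<Sum>i\<in>UNIV. \<Sum>j\<in>UNIV. X $ i * Y $ j * C i j l))"
    by (simp add: inner_vec_def sum_distrib_left mult.left_commute)
  also have "\<dots> = (\<Sum>l\<in>UNIV. \<Sum>i\<in>UNIV. \<Sum>j\<in>UNIV. X $ i * Y $ j * Z $ l * C i j l)"
    by (simp add: sum_distrib_left ac_simps)
  also have "\<dots> = (\<Sum>i\<in>UNIV. \<Sum>l\<in>UNIV. \<Sum>j\<in>UNIV. X $ i * Y $ j * Z $ l * C i j l)"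
    by (rule sum.swap)
  also have "\<dots> = (\<Sum>i\<in>UNIV. \<Sum>j\<in>UNIV. \<Sum>l\<in>UNIV. X $ i * Y $ j * Z $ l * C i j l)"
    by (intro sum.cong refl sum.swap)
  finally have 1: "2 * (Z \<bullet> (G y *v coord_christoffel_vec G y X Y)) = \<dots>" .
  have 2: "X \<bullet> (frechet_derivative G (at y) Y *v Z) =
    (\<Sum>i\<in>UNIV. \<Sum>j\<in>UNIV. \<Sum>l\<in>UNIV. X $ i * Y $ j * Z $ l * pd j (\<lambda>z. G z $ i $ l) y)"
    unfolding metric_derivative_entry[OF coordinate_metricD(2)[OF G] y]
    by (subst sum.swap) (simp add: ac_simps)
  have "X \<bullet> (frechet_derivative G (at y) Z *v Y) =
    (\<Sum>i\<in>UNIV. \<Sum>l\<in>UNIV. \<Sum>j\<in>UNIV. X $ i * Y $ j * Z $ l * pd l (\<lambda>z. G z $ i $ j) y)"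
    unfolding metric_derivative_entry[OF coordinate_metricD(2)[OF G] y]
    by (subst sum.swap) (simp add: ac_simps)
  also have "\<dots> = (\<Sum>i\<in>UNIV. \<Sum>j\<in>UNIV. \<Sum>l\<in>UNIV. X $ i * Y $ j * Z $ l * pd l (\<lambda>z. G z $ i $ j) y)"
    by (intro sum.cong refl sum.swap)
  finally have 3: "X \<bullet> (frechet_derivative G (at y) Z *v Y) = \<dots>" .
  show ?thesis
    unfolding 1 2 3 unfolding metric_derivative_entry[OF coordinate_metricD(2)[OF G] y] C_def
    by (simp add: sum.distrib sum_subtractf distrib_left right_diff_distrib)
qed


lemma coord_christoffel_vec_axis: "coord_christoffel_vec G y (axis i 1) (axis j 1) $ k = coord_christoffel G k i j y"
proof -
  have "coord_christoffel_vec G y (axis i 1) (axis j 1) $ k =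
    (\<Sum>i'\<in>UNIV. axis i 1 $ i' * (\<Sum>j'\<in>UNIV. axis j 1 $ j' * coord_christoffel G k i' j' y))"
    by (simp add: coord_christoffel_vec_def sum_distrib_left mult.assoc)
  also have "\<dots> = (\<Sum>i'\<in>UNIV. if i' = i then (\<Sum>j'\<in>UNIV. if j' = j then coord_christoffel G k i' j' y else 0) else 0)"
    by (simp add: axis_def if_distrib[of "\<lambda>t. t * _"] cong: if_cong)
  also have "\<dots> = coord_christoffel G k i j y"
    by simp
  finally show ?thesis .
qed

lemma coord_hessian_form_axis:
  assumes "smooth_on S u" "y \<in> S"
  shows "coord_hessian_form G u y (axis i 1) (axis j 1) = coord_hessian G i j u y"
  using frechet_derivative_pd[OF assms, of "coord_christoffel_vec G y (axis i 1) (axis j 1)"]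
  by (simp add: coord_hessian_form_def coord_hessian_def coord_christoffel_vec_axis pd_def[abs_def] mult.commute)

text \<open>The situation of two overlapping charts: \<open>\<tau>\<close> is the transition map, and the two coordinate expressions of
  the metric correspond to each other under its differential \<open>J\<close>.\<close>

locale isometric_transition =
  fixes S S' :: "(real^'m) set" and G G' :: "real^'m \<Rightarrow> real^'m^'m" and \<tau> :: "real^'m \<Rightarrow> real^'m"
  assumes G: "coordinate_metric S G" and G': "coordinate_metric S' G'"
    and smooth: "smooth_on S \<tau>" and maps: "\<tau> ` S \<subseteq> S'"
    and isometry: "\<And>y v w. y \<in> S \<Longrightarrow>
      v \<bullet> (G y *v w) = frechet_derivative \<tau> (at y) v \<bullet> (G' (\<tau> y) *v frechet_derivative \<tau> (at y) w)"
begin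

abbreviation J :: "real^'m \<Rightarrow> real^'m \<Rightarrow> real^'m" where
  "J y \<equiv> frechet_derivative \<tau> (at y)"

abbreviation K :: "real^'m \<Rightarrow> real^'m \<Rightarrow> real^'m \<Rightarrow> real^'m" where
  "K y X Y \<equiv> frechet_derivative (\<lambda>z. frechet_derivative \<tau> (at z) Y) (at y) X"

lemma in_target: "y \<in> S \<Longrightarrow> \<tau> y \<in> S'"
  using maps by blast

lemma linear_J: "y \<in> S \<Longrightarrow> linear (J y)"
  using linear_frechet_derivative[OF smooth] .

text \<open>Invertibility of \<open>J\<close> follows from the definiteness of the pulled-back metric.\<close>

lemma inj_J:
  assumes y: "y \<in> S"
  shows "inj (J y)"
proof (rule linear_injective_0[OF linear_J[OF y], THEN iffD2], intro allI impI)
  fix v assume "J y v = 0"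
  then have "v \<bullet> (G y *v v) = 0"
    by (simp add: isometry[OF y])
  then show "v = 0"
    using coordinate_metricD(4)[OF G y] by force
qed

lemma surj_J: "y \<in> S \<Longrightarrow> surj (J y)"
  using linear_injective_imp_surjective linear_J inj_J by blast

lemma smooth_pullback: "smooth_on S' u \<Longrightarrow> smooth_on S (\<lambda>z. u (\<tau> z))"
  by (rule smooth_on_compose[OF coordinate_metricD(1)[OF G] coordinate_metricD(1)[OF G'] maps _ smooth])

lemma has_derivative_pullback:
  assumes "smooth_on S' u" "y \<in> S"
  shows "((\<lambda>z. u (\<tau> z)) has_derivative (\<lambda>X. frechet_derivative u (at (\<tau> y)) (J y X))) (at y)"
  using diff_chain_at[OF smooth_on_has_derivative[OF smooth assms(2)]
      smooth_on_has_derivative[OF assms(1) in_target[OF assms(2)]]]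
  by (simp add: o_def)

lemma first_derivative_pullback:
  assumes "smooth_on S' u" "y \<in> S"
  shows "frechet_derivative (\<lambda>z. u (\<tau> z)) (at y) v = frechet_derivative u (at (\<tau> y)) (J y v)"
  by (rule frechet_derivative_at[OF has_derivative_pullback[OF assms], THEN fun_cong, symmetric])

text \<open>The term with \<open>K\<close>, the second derivative of \<open>\<tau>\<close>, is what keeps the naive second derivative from being
  tensorial.\<close>

lemma second_derivative_pullback:
  fixes u :: "real^'m \<Rightarrow> real"
  assumes u: "smooth_on S' u" and y: "y \<in> S"
  shows "frechet_derivative (\<lambda>z. frechet_derivative (\<lambda>z. u (\<tau> z)) (at z) Y) (at y) X =
    frechet_derivative (\<lambda>z. frechet_derivative u (at z) (J y Y)) (at (\<tau> y)) (J y X) +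
    frechet_derivative u (at (\<tau> y)) (K y X Y)"
proof -
  note S = coordinate_metricD(1)[OF G] and S' = coordinate_metricD(1)[OF G']
  have dpd: "((\<lambda>z. pd a u (\<tau> z)) has_derivative (\<lambda>X. frechet_derivative (pd a u) (at (\<tau> y)) (J y X))) (at y)" for a
    by (rule has_derivative_pullback[OF smooth_on_pd[OF u] y])
  have dJ: "((\<lambda>z. J z Y $ a) has_derivative (\<lambda>X. K y X Y $ a)) (at y)" for a
    by (rule bounded_linear.has_derivative[OF bounded_linear_vec_nth
          smooth_on_has_derivative[OF smooth_on_frechet_derivative[OF smooth] y]])
  have "frechet_derivative (\<lambda>z. frechet_derivative (\<lambda>z. u (\<tau> z)) (at z) Y) (at y) =
    frechet_derivative (\<lambda>z. \<Sum>a\<in>UNIV. pd a u (\<tau> z) * J z Y $ a) (at y)"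
    by (rule frechet_derivative_cong_open[OF S y])
      (simp add: first_derivative_pullback[OF u] frechet_derivative_pd[OF u in_target])
  also have "\<dots> = (\<lambda>X. \<Sum>a\<in>UNIV. pd a u (\<tau> y) * K y X Y $ a + frechet_derivative (pd a u) (at (\<tau> y)) (J y X) * J y Y $ a)"
    by (rule frechet_derivative_at[symmetric]) (intro has_derivative_sum has_derivative_mult dpd dJ)
  finally have 1: "frechet_derivative (\<lambda>z. frechet_derivative (\<lambda>z. u (\<tau> z)) (at z) Y) (at y) X =
    (\<Sum>a\<in>UNIV. pd a u (\<tau> y) * K y X Y $ a + frechet_derivative (pd a u) (at (\<tau> y)) (J y X) * J y Y $ a)"
    by simp
  have "frechet_derivative (\<lambda>z. frechet_derivative u (at z) V) (at (\<tau> y)) =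
    frechet_derivative (\<lambda>z. \<Sum>a\<in>UNIV. pd a u z * V $ a) (at (\<tau> y))" for V
    by (rule frechet_derivative_cong_open[OF S' in_target[OF y]]) (rule frechet_derivative_pd[OF u])
  also have "frechet_derivative (\<lambda>z. \<Sum>a\<in>UNIV. pd a u z * V $ a) (at (\<tau> y)) =
    (\<lambda>W. \<Sum>a\<in>UNIV. frechet_derivative (pd a u) (at (\<tau> y)) W * V $ a)" for V
    by (rule frechet_derivative_at[symmetric])
      (intro has_derivative_sum has_derivative_mult_left smooth_on_has_derivative[OF smooth_on_pd[OF u] in_target[OF y]])
  finally have 2: "frechet_derivative (\<lambda>z. frechet_derivative u (at z) V) (at (\<tau> y)) W =
    (\<Sum>a\<in>UNIV. frechet_derivative (pd a u) (at (\<tau> y)) W * V $ a)" for V W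
    by simp
  show ?thesis
    unfolding 1 2 frechet_derivative_pd[OF u in_target[OF y]] by (simp add: sum.distrib)
qed

lemma metric_derivative_pullback:
  assumes y: "y \<in> S"
  shows "Y \<bullet> (frechet_derivative G (at y) X *v Z) =
    K y X Y \<bullet> (G' (\<tau> y) *v J y Z) + J y Y \<bullet> (frechet_derivative G' (at (\<tau> y)) (J y X) *v J y Z) +
    J y Y \<bullet> (G' (\<tau> y) *v K y X Z)"
proof -
  note S = coordinate_metricD(1)[OF G]
  note mv = bounded_bilinear.FDERIV[OF bounded_bilinear_matrix_vector_mult]
  have dJ: "((\<lambda>z. J z Y) has_derivative (\<lambda>X. K y X Y)) (at y)" for Y
    by (rule smooth_on_has_derivative[OF smooth_on_frechet_derivative[OF smooth] y])
  have dG': "((\<lambda>z. G' (\<tau> z)) has_derivative (\<lambda>X. frechet_derivative G' (at (\<tau> y)) (J y X))) (at y)"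
    by (rule has_derivative_pullback[OF coordinate_metricD(2)[OF G'] y])
  have "((\<lambda>z. Y \<bullet> (G z *v Z)) has_derivative (\<lambda>X. Y \<bullet> (frechet_derivative G (at y) X *v Z))) (at y)"
    by (rule bounded_linear.has_derivative[OF bounded_linear_inner_right
          bounded_linear.has_derivative[OF bounded_bilinear.bounded_linear_left[OF bounded_bilinear_matrix_vector_mult]
            smooth_on_has_derivative[OF coordinate_metricD(2)[OF G] y]]])
  then have 1: "frechet_derivative (\<lambda>z. Y \<bullet> (G z *v Z)) (at y) X = Y \<bullet> (frechet_derivative G (at y) X *v Z)"
    using frechet_derivative_at by metis
  have "((\<lambda>z. J z Y \<bullet> (G' (\<tau> z) *v J z Z)) has_derivative
    (\<lambda>X. J y Y \<bullet> (G' (\<tau> y) *v K y X Z + frechet_derivative G' (at (\<tau> y)) (J y X) *v J y Z) +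
       K y X Y \<bullet> (G' (\<tau> y) *v J y Z))) (at y)"
    by (rule has_derivative_inner[OF dJ mv[OF dG' dJ]])
  then have 2: "frechet_derivative (\<lambda>z. J z Y \<bullet> (G' (\<tau> z) *v J z Z)) (at y) X =
    J y Y \<bullet> (G' (\<tau> y) *v K y X Z + frechet_derivative G' (at (\<tau> y)) (J y X) *v J y Z) +
       K y X Y \<bullet> (G' (\<tau> y) *v J y Z)"
    by (rule frechet_derivative_at[THEN fun_cong, symmetric])
  have "frechet_derivative (\<lambda>z. Y \<bullet> (G z *v Z)) (at y) = frechet_derivative (\<lambda>z. J z Y \<bullet> (G' (\<tau> z) *v J z Z)) (at y)"
    by (rule frechet_derivative_cong_open[OF S y]) (rule isometry)
  with 1 2 show ?thesis
    by (simp add: inner_add_right)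
qed

text \<open>The classical transformation law.  Differentiating the pulled-back metric produces six terms with the second
  derivative \<open>K\<close> of \<open>\<tau>\<close> in the Koszul formula; as \<open>K\<close> and the metric are symmetric, four of them cancel in pairs
  and the other two are equal.\<close>

lemma coord_christoffel_vec_pullback:
  assumes y: "y \<in> S"
  shows "J y (coord_christoffel_vec G y X Y) = coord_christoffel_vec G' (\<tau> y) (J y X) (J y Y) + K y X Y"
proof -
  note y' = in_target[OF y]
  have K: "K y A B = K y B A" for A B
    by (rule frechet_derivative_commute_vec[OF coordinate_metricD(1)[OF G] y smooth])
  have sym: "v \<bullet> (G' (\<tau> y) *v w) = w \<bullet> (G' (\<tau> y) *v v)" for v w
    by (rule coordinate_metric_sym[OF G' y'])
  let ?E = "J y (coord_christoffel_vec G y X Y) - (coord_christoffel_vec G' (\<tau> y) (J y X) (J y Y) + K y X Y)"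
  have orth: "J y Z \<bullet> (G' (\<tau> y) *v ?E) = 0" for Z
  proof -
    have "2 * (J y Z \<bullet> (G' (\<tau> y) *v J y (coord_christoffel_vec G y X Y))) =
        2 * (J y Z \<bullet> (G' (\<tau> y) *v coord_christoffel_vec G' (\<tau> y) (J y X) (J y Y))) + 2 * (J y Z \<bullet> (G' (\<tau> y) *v K y X Y))"
      unfolding isometry[OF y, symmetric] metric_coord_christoffel_vec[OF G y] metric_coord_christoffel_vec[OF G' y'] metric_derivative_pullback[OF y]
      using K[of X Y] K[of X Z] K[of Y Z] sym[of "K y X Y"] sym[of "K y X Z"] sym[of "K y Y Z"] by simp
    then show ?thesis
      by (simp add: matrix_vector_mult_diff_distrib matrix_vector_right_distrib inner_diff_right inner_add_right)
  qed
  \<comment> \<open>Since \<open>J\<close> is onto, the error is orthogonal to itself.\<close>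
  obtain Z where Z: "?E = J y Z"
    using surj_J[OF y] unfolding surj_def by blast
  have "?E \<bullet> (G' (\<tau> y) *v ?E) = 0"
    using orth[of Z] unfolding Z[symmetric] .
  then have "?E = 0"
    using coordinate_metricD(4)[OF G' y', of ?E] by linarith
  then show ?thesis
    by simp
qed

text \<open>The two occurrences of \<open>K\<close>, one from the second derivative of \<open>u \<circ> \<tau>\<close> and one from the Christoffel symbols,
  cancel.\<close>

lemma coord_hessian_form_pullback:
  fixes u :: "real^'m \<Rightarrow> real"
  assumes u: "smooth_on S' u" and y: "y \<in> S"
  shows "coord_hessian_form G (\<lambda>z. u (\<tau> z)) y X Y = coord_hessian_form G' u (\<tau> y) (J y X) (J y Y)"
  unfolding coord_hessian_form_def second_derivative_pullback[OF u y] first_derivative_pullback[OF u y] coord_christoffel_vec_pullback[OF y]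
  using linear_frechet_derivative[OF u in_target[OF y]] by (simp add: linear_add)

lemma bilinear_coord_hessian_form:
  assumes u: "smooth_on S' u" and y: "y \<in> S'"
  shows "bilinear (coord_hessian_form G' u y)"
proof -
  note lin = linear_frechet_derivative[OF u y]
  note lin2 = linear_frechet_derivative[OF smooth_on_frechet_derivative[OF u] y]
  have c: "coord_christoffel_vec G' y (A + A') B = coord_christoffel_vec G' y A B + coord_christoffel_vec G' y A' B"
    "coord_christoffel_vec G' y B (A + A') = coord_christoffel_vec G' y B A + coord_christoffel_vec G' y B A'"
    "coord_christoffel_vec G' y (r *\<^sub>R A) B = r *\<^sub>R coord_christoffel_vec G' y A B" "coord_christoffel_vec G' y B (r *\<^sub>R A) = r *\<^sub>R coord_christoffel_vec G' y B A" for A A' B r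
    by (simp_all add: coord_christoffel_vec_def vec_eq_iff sum.distrib sum_distrib_left algebra_simps)
  have d: "frechet_derivative (\<lambda>z. frechet_derivative u (at z) Y) (at y) X =
    frechet_derivative (\<lambda>z. frechet_derivative u (at z) X) (at y) Y" for X Y
    by (rule frechet_derivative_commute[OF coordinate_metricD(1)[OF G'] y u])
  have l1: "linear (\<lambda>X. coord_hessian_form G' u y X Y)" for Y
    by (intro linearI) (simp_all add: coord_hessian_form_def c linear_add[OF lin] linear_scale[OF lin] linear_add[OF lin2] linear_scale[OF lin2] algebra_simps)
  have l2: "linear (coord_hessian_form G' u y X)" for X
    by (intro linearI) (simp_all add: coord_hessian_form_def c d[of _ X] linear_add[OF lin] linear_scale[OF lin] linear_add[OF lin2] linear_scale[OF lin2] algebra_simps)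
  from l1 l2 show ?thesis
    by (simp add: bilinear_def)
qed

theorem coord_laplacian_pullback:
  assumes u: "smooth_on S' u" and y: "y \<in> S"
  shows "coord_laplacian G (\<lambda>z. u (\<tau> z)) y = coord_laplacian G' u (\<tau> y)"
proof -
  have "coord_laplacian G (\<lambda>z. u (\<tau> z)) y = (\<Sum>i\<in>UNIV. \<Sum>j\<in>UNIV. matrix_inv (G y) $ i $ j *
      coord_hessian_form G' u (\<tau> y) (J y (axis i 1)) (J y (axis j 1)))"
    unfolding coord_laplacian_def coord_hessian_form_axis[OF smooth_pullback[OF u] y, symmetric] coord_hessian_form_pullback[OF u y] ..
  also have "\<dots> = (\<Sum>i\<in>UNIV. \<Sum>j\<in>UNIV. matrix_inv (G' (\<tau> y)) $ i $ j * coord_hessian_form G' u (\<tau> y) (axis i 1) (axis j 1))"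
    by (rule metric_trace_pullback[OF coordinate_metric_invertible[OF G y] linear_J[OF y] inj_J[OF y]
          bilinear_coord_hessian_form[OF u in_target[OF y]] isometry[OF y]])
  also have "\<dots> = coord_laplacian G' u (\<tau> y)"
    unfolding coord_laplacian_def coord_hessian_form_axis[OF u in_target[OF y]] ..
  finally show ?thesis .
qed

theorem coord_grad_inner_pullback:
  assumes u: "smooth_on S' u" and v: "smooth_on S' v" and y: "y \<in> S"
  shows "coord_grad_inner G (\<lambda>z. u (\<tau> z)) (\<lambda>z. v (\<tau> z)) y = coord_grad_inner G' u v (\<tau> y)"
proof -
  let ?B = "\<lambda>X Y. frechet_derivative u (at (\<tau> y)) X * frechet_derivative v (at (\<tau> y)) Y"
  note lin = linear_frechet_derivative[OF u in_target[OF y]] linear_frechet_derivative[OF v in_target[OF y]]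
  have "bilinear ?B"
    unfolding bilinear_def
    by (auto intro!: linearI simp: linear_add[OF lin(1)] linear_scale[OF lin(1)] linear_add[OF lin(2)] linear_scale[OF lin(2)] algebra_simps)
  from metric_trace_pullback[OF coordinate_metric_invertible[OF G y] linear_J[OF y] inj_J[OF y] this isometry[OF y]]
  show ?thesis
    by (simp add: coord_grad_inner_def pd_def first_derivative_pullback[OF u y] first_derivative_pullback[OF v y])
qed

end

section \<open>Product and chain rules in coordinates\<close>

lemma pd_add:
  assumes "smooth_on S u" "smooth_on S v" "y \<in> S"
  shows "pd i (\<lambda>z. u z + v z) y = pd i u y + pd i v y"
  using pd_eqI[OF has_derivative_add[OF smooth_on_has_derivative[OF assms(1,3)] smooth_on_has_derivative[OF assms(2,3)]]]
  by (simp add: pd_def)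

lemma pd_mult:
  assumes "smooth_on S u" "smooth_on S v" "y \<in> S"
  shows "pd i (\<lambda>z. u z * v z) y = u y * pd i v y + pd i u y * v y"
  using pd_eqI[OF has_derivative_mult[OF smooth_on_has_derivative[OF assms(1,3)] smooth_on_has_derivative[OF assms(2,3)]]]
  by (simp add: pd_def)

lemma pd_sum:
  assumes "\<And>a. a \<in> A \<Longrightarrow> smooth_on S (u a)" "y \<in> S"
  shows "pd i (\<lambda>z. \<Sum>a\<in>A. u a z) y = (\<Sum>a\<in>A. pd i (u a) y)"
  using pd_eqI[OF has_derivative_sum[OF smooth_on_has_derivative[OF assms]]]
  by (simp add: pd_def)

lemma pd_compose:
  fixes \<phi> :: "real^'m \<Rightarrow> real^'n"
  assumes "open S" "open T" "\<phi> ` S \<subseteq> T" "smooth_on S \<phi>" "smooth_on T f" "y \<in> S"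
  shows "pd i (\<lambda>z. f (\<phi> z)) y = (\<Sum>\<alpha>\<in>UNIV. pd \<alpha> f (\<phi> y) * pd i (\<lambda>z. \<phi> z $ \<alpha>) y)"
proof -
  have y: "\<phi> y \<in> T"
    using assms by blast
  note D\<phi> = smooth_on_has_derivative[OF assms(4,6)]
  have "pd i (\<lambda>z. f (\<phi> z)) y = frechet_derivative f (at (\<phi> y)) (frechet_derivative \<phi> (at y) (axis i 1))"
    using pd_eqI[OF diff_chain_at[OF D\<phi> smooth_on_has_derivative[OF assms(5) y]]] by (simp add: o_def)
  also have "\<dots> = (\<Sum>\<alpha>\<in>UNIV. pd \<alpha> f (\<phi> y) * frechet_derivative \<phi> (at y) (axis i 1) $ \<alpha>)"
    by (rule frechet_derivative_pd[OF assms(5) y])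
  finally show ?thesis
    by (simp add: pd_def frechet_derivative_nth[OF D\<phi>])
qed

lemma coord_hessian_add:
  assumes "open S" "smooth_on S u" "smooth_on S v" "y \<in> S"
  shows "coord_hessian G i j (\<lambda>z. u z + v z) y = coord_hessian G i j u y + coord_hessian G i j v y"
proof -
  have "pd i (pd j (\<lambda>z. u z + v z)) y = pd i (\<lambda>z. pd j u z + pd j v z) y"
    using pd_add[OF assms(2,3)] by (intro pd_cong_open[OF assms(1,4)])
  then show ?thesis
    by (simp add: coord_hessian_def pd_add[OF assms(2-4)] pd_add[OF smooth_on_pd[OF assms(2)] smooth_on_pd[OF assms(3)] assms(4)]
        algebra_simps sum.distrib)
qed

lemma coord_hessian_mult:
  assumes "open S" "smooth_on S u" "smooth_on S v" "y \<in> S"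
  shows "coord_hessian G i j (\<lambda>z. u z * v z) y =
    u y * coord_hessian G i j v y + coord_hessian G i j u y * v y + (pd i u y * pd j v y + pd i v y * pd j u y)"
proof -
  note s = smooth_on_pd[OF assms(2)] smooth_on_pd[OF assms(3)]
  have "pd i (pd j (\<lambda>z. u z * v z)) y = pd i (\<lambda>z. u z * pd j v z + pd j u z * v z) y"
    using pd_mult[OF assms(2,3)] by (intro pd_cong_open[OF assms(1,4)])
  also have "\<dots> = u y * pd i (pd j v) y + pd i u y * pd j v y + (pd j u y * pd i v y + pd i (pd j u) y * v y)"
    using assms s by (simp add: pd_add[of S] pd_mult[of S] smooth_on_mult)
  finally show ?thesis
    by (simp add: coord_hessian_def pd_mult[OF assms(2-4)] algebra_simps sum.distrib sum_distrib_left)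
qed

lemma coord_hessian_compose:
  fixes \<phi> :: "real^'m \<Rightarrow> real^'n"
  assumes "open S" "open T" "\<phi> ` S \<subseteq> T" "smooth_on S \<phi>" "smooth_on T f" "y \<in> S"
  shows "coord_hessian G i j (\<lambda>z. f (\<phi> z)) y =
    (\<Sum>\<alpha>\<in>UNIV. \<Sum>\<beta>\<in>UNIV. pd \<beta> (pd \<alpha> f) (\<phi> y) * (pd i (\<lambda>z. \<phi> z $ \<beta>) y * pd j (\<lambda>z. \<phi> z $ \<alpha>) y)) +
    (\<Sum>\<alpha>\<in>UNIV. pd \<alpha> f (\<phi> y) * coord_hessian G i j (\<lambda>z. \<phi> z $ \<alpha>) y)"
proof -
  note s = smooth_on_nth[OF assms(1,4)]
  have sf: "smooth_on S (\<lambda>z. pd \<alpha> f (\<phi> z))" for \<alpha>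
    by (rule smooth_on_compose[OF assms(1-3) smooth_on_pd[OF assms(5)] assms(4)])
  have "pd i (pd j (\<lambda>z. f (\<phi> z))) y = pd i (\<lambda>z. \<Sum>\<alpha>\<in>UNIV. pd \<alpha> f (\<phi> z) * pd j (\<lambda>z. \<phi> z $ \<alpha>) z) y"
    using pd_compose[OF assms(1-5)] by (intro pd_cong_open[OF assms(1,6)])
  also have "\<dots> = (\<Sum>\<alpha>\<in>UNIV. pd i (\<lambda>z. pd \<alpha> f (\<phi> z) * pd j (\<lambda>z. \<phi> z $ \<alpha>) z) y)"
    by (rule pd_sum[OF _ assms(6)]) (intro smooth_on_mult assms(1) sf smooth_on_pd s)
  also have "\<dots> = (\<Sum>\<alpha>\<in>UNIV. pd \<alpha> f (\<phi> y) * pd i (pd j (\<lambda>z. \<phi> z $ \<alpha>)) y +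
      pd i (\<lambda>z. pd \<alpha> f (\<phi> z)) y * pd j (\<lambda>z. \<phi> z $ \<alpha>) y)"
    using pd_mult[OF sf smooth_on_pd[OF s] assms(6)] by simp
  finally have "pd i (pd j (\<lambda>z. f (\<phi> z))) y = (\<Sum>\<alpha>\<in>UNIV. pd \<alpha> f (\<phi> y) * pd i (pd j (\<lambda>z. \<phi> z $ \<alpha>)) y) +
      (\<Sum>\<alpha>\<in>UNIV. \<Sum>\<beta>\<in>UNIV. pd \<beta> (pd \<alpha> f) (\<phi> y) * (pd i (\<lambda>z. \<phi> z $ \<beta>) y * pd j (\<lambda>z. \<phi> z $ \<alpha>) y))"
    using pd_compose[OF assms(1-4) smooth_on_pd[OF assms(5)] assms(6)]
    by (simp add: sum.distrib sum_distrib_right mult.assoc)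
  moreover have "(\<Sum>k\<in>UNIV. coord_christoffel G k i j y * pd k (\<lambda>z. f (\<phi> z)) y) =
    (\<Sum>\<alpha>\<in>UNIV. pd \<alpha> f (\<phi> y) * (\<Sum>k\<in>UNIV. coord_christoffel G k i j y * pd k (\<lambda>z. \<phi> z $ \<alpha>) y))"
    unfolding pd_compose[OF assms] sum_distrib_left by (subst sum.swap) (simp add: mult.left_commute)
  ultimately show ?thesis
    by (simp add: coord_hessian_def right_diff_distrib sum_subtractf)
qed

lemma coord_laplacian_add:
  assumes "open S" "smooth_on S u" "smooth_on S v" "y \<in> S"
  shows "coord_laplacian G (\<lambda>z. u z + v z) y = coord_laplacian G u y + coord_laplacian G v y"
  by (simp add: coord_laplacian_def coord_hessian_add[OF assms] distrib_left sum.distrib)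

lemma coord_grad_inner_commute:
  assumes "coordinate_metric S G" "y \<in> S"
  shows "coord_grad_inner G u v y = coord_grad_inner G v u y"
  unfolding coord_grad_inner_def
  by (subst sum.swap) (simp add: coordinate_metric_inv_sym[OF assms] mult.commute)

text \<open>The Hessian of \<open>uv\<close> has the two cross terms \<open>\<partial>\<^sub>iu\<partial>\<^sub>jv\<close> and \<open>\<partial>\<^sub>iv\<partial>\<^sub>ju\<close>; they contribute equally because the
  inverse metric is symmetric.\<close>

lemma coord_laplacian_mult:
  assumes G: "coordinate_metric S G" and "smooth_on S u" "smooth_on S v" "y \<in> S"
  shows "coord_laplacian G (\<lambda>z. u z * v z) y = u y * coord_laplacian G v y + coord_laplacian G u y * v y + 2 * coord_grad_inner G u v y"
proof -
  have "coord_laplacian G (\<lambda>z. u z * v z) y = u y * coord_laplacian G v y + coord_laplacian G u y * v y + (coord_grad_inner G u v y + coord_grad_inner G v u y)"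
    by (simp add: coord_laplacian_def coord_grad_inner_def coord_hessian_mult[OF coordinate_metricD(1)[OF G] assms(2-4)] distrib_left sum.distrib
        sum_distrib_left sum_distrib_right ac_simps)
  then show ?thesis
    using coord_grad_inner_commute[OF G assms(4), of v u] by simp
qed

lemma coord_laplacian_compose:
  fixes \<phi> :: "real^'m \<Rightarrow> real^'n"
  assumes G: "coordinate_metric S G" and "open T" "\<phi> ` S \<subseteq> T" "smooth_on S \<phi>" "smooth_on T f" "y \<in> S"
  shows "coord_laplacian G (\<lambda>z. f (\<phi> z)) y =
    (\<Sum>\<alpha>\<in>UNIV. \<Sum>\<beta>\<in>UNIV. pd \<beta> (pd \<alpha> f) (\<phi> y) * coord_grad_inner G (\<lambda>z. \<phi> z $ \<beta>) (\<lambda>z. \<phi> z $ \<alpha>) y) +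
    (\<Sum>\<alpha>\<in>UNIV. pd \<alpha> f (\<phi> y) * coord_laplacian G (\<lambda>z. \<phi> z $ \<alpha>) y)"
proof -
  let ?g = "matrix_inv (G y)"
  let ?b = "\<lambda>i j \<alpha> \<beta>. pd \<beta> (pd \<alpha> f) (\<phi> y) * (pd i (\<lambda>z. \<phi> z $ \<beta>) y * pd j (\<lambda>z. \<phi> z $ \<alpha>) y)"
  have "coord_laplacian G (\<lambda>z. f (\<phi> z)) y =
    (\<Sum>i\<in>UNIV. \<Sum>j\<in>UNIV. \<Sum>\<alpha>\<in>UNIV. \<Sum>\<beta>\<in>UNIV. ?g $ i $ j * ?b i j \<alpha> \<beta>) +
    (\<Sum>i\<in>UNIV. \<Sum>j\<in>UNIV. \<Sum>\<alpha>\<in>UNIV. pd \<alpha> f (\<phi> y) * (?g $ i $ j * coord_hessian G i j (\<lambda>z. \<phi> z $ \<alpha>) y))"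
    by (simp add: coord_laplacian_def coord_hessian_compose[OF coordinate_metricD(1)[OF G] assms(2-6)] distrib_left sum.distrib
        sum_distrib_left mult.left_commute)
  also have "(\<Sum>i\<in>UNIV. \<Sum>j\<in>UNIV. \<Sum>\<alpha>\<in>UNIV. pd \<alpha> f (\<phi> y) * (?g $ i $ j * coord_hessian G i j (\<lambda>z. \<phi> z $ \<alpha>) y)) =
      (\<Sum>i\<in>UNIV. \<Sum>\<alpha>\<in>UNIV. \<Sum>j\<in>UNIV. pd \<alpha> f (\<phi> y) * (?g $ i $ j * coord_hessian G i j (\<lambda>z. \<phi> z $ \<alpha>) y))"
    by (intro sum.cong refl sum.swap)
  also have "\<dots> = (\<Sum>\<alpha>\<in>UNIV. \<Sum>i\<in>UNIV. \<Sum>j\<in>UNIV. pd \<alpha> f (\<phi> y) * (?g $ i $ j * coord_hessian G i j (\<lambda>z. \<phi> z $ \<alpha>) y))"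
    by (rule sum.swap)
  also have "\<dots> = (\<Sum>\<alpha>\<in>UNIV. pd \<alpha> f (\<phi> y) * coord_laplacian G (\<lambda>z. \<phi> z $ \<alpha>) y)"
    by (simp add: coord_laplacian_def sum_distrib_left)
  also have "(\<Sum>i\<in>UNIV. \<Sum>j\<in>UNIV. \<Sum>\<alpha>\<in>UNIV. \<Sum>\<beta>\<in>UNIV. ?g $ i $ j * ?b i j \<alpha> \<beta>) =
      (\<Sum>i\<in>UNIV. \<Sum>\<alpha>\<in>UNIV. \<Sum>\<beta>\<in>UNIV. \<Sum>j\<in>UNIV. ?g $ i $ j * ?b i j \<alpha> \<beta>)"
    by (rule sum.cong[OF refl], subst sum.swap) (intro sum.cong refl sum.swap)
  also have "\<dots> = (\<Sum>\<alpha>\<in>UNIV. \<Sum>\<beta>\<in>UNIV. \<Sum>i\<in>UNIV. \<Sum>j\<in>UNIV. ?g $ i $ j * ?b i j \<alpha> \<beta>)"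
    by (subst sum.swap) (intro sum.cong refl sum.swap)
  also have "\<dots> = (\<Sum>\<alpha>\<in>UNIV. \<Sum>\<beta>\<in>UNIV. pd \<beta> (pd \<alpha> f) (\<phi> y) * coord_grad_inner G (\<lambda>z. \<phi> z $ \<beta>) (\<lambda>z. \<phi> z $ \<alpha>) y)"
    by (simp add: coord_grad_inner_def sum_distrib_left mult.left_commute)
  finally show ?thesis .
qed

lemma coord_grad_inner_add:
  assumes "smooth_on S u" "smooth_on S v" "y \<in> S"
  shows "coord_grad_inner G (\<lambda>z. u z + v z) w y = coord_grad_inner G u w y + coord_grad_inner G v w y"
  by (simp add: coord_grad_inner_def pd_add[OF assms] distrib_left distrib_right sum.distrib)

lemma coord_grad_inner_mult:
  assumes "smooth_on S u" "smooth_on S v" "y \<in> S"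
  shows "coord_grad_inner G (\<lambda>z. u z * v z) w y = u y * coord_grad_inner G v w y + v y * coord_grad_inner G u w y"
  by (simp add: coord_grad_inner_def pd_mult[OF assms] distrib_left distrib_right sum.distrib sum_distrib_left ac_simps)

lemma coord_grad_inner_compose:
  fixes \<phi> :: "real^'m \<Rightarrow> real^'n"
  assumes "open S" "open T" "\<phi> ` S \<subseteq> T" "smooth_on S \<phi>" "smooth_on T f" "y \<in> S"
  shows "coord_grad_inner G (\<lambda>z. f (\<phi> z)) w y = (\<Sum>\<alpha>\<in>UNIV. pd \<alpha> f (\<phi> y) * coord_grad_inner G (\<lambda>z. \<phi> z $ \<alpha>) w y)"
proof -
  let ?t = "\<lambda>\<alpha> i j. pd \<alpha> f (\<phi> y) * (matrix_inv (G y) $ i $ j * (pd i (\<lambda>z. \<phi> z $ \<alpha>) y * pd j w y))"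
  have "coord_grad_inner G (\<lambda>z. f (\<phi> z)) w y = (\<Sum>i\<in>UNIV. \<Sum>j\<in>UNIV. \<Sum>\<alpha>\<in>UNIV. ?t \<alpha> i j)"
    by (simp add: coord_grad_inner_def pd_compose[OF assms] sum_distrib_left sum_distrib_right ac_simps)
  also have "\<dots> = (\<Sum>i\<in>UNIV. \<Sum>\<alpha>\<in>UNIV. \<Sum>j\<in>UNIV. ?t \<alpha> i j)"
    by (intro sum.cong refl sum.swap)
  also have "\<dots> = (\<Sum>\<alpha>\<in>UNIV. \<Sum>i\<in>UNIV. \<Sum>j\<in>UNIV. ?t \<alpha> i j)"
    by (rule sum.swap)
  finally show ?thesis
    by (simp add: coord_grad_inner_def sum_distrib_left)
qed

lemma coord_hessian_cong_open:
  assumes "open S" "y \<in> S" "\<And>z. z \<in> S \<Longrightarrow> u z = v z"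
  shows "coord_hessian G i j u y = coord_hessian G i j v y"
proof -
  have "pd k u z = pd k v z" if "z \<in> S" for k z
    by (rule pd_cong_open[OF assms(1) that assms(3)])
  moreover from this have "pd i (pd j u) y = pd i (pd j v) y"
    by (intro pd_cong_open[OF assms(1,2)])
  ultimately show ?thesis
    using assms(2) by (simp add: coord_hessian_def)
qed

lemma coord_laplacian_cong_open:
  assumes "open S" "y \<in> S" "\<And>z. z \<in> S \<Longrightarrow> u z = v z"
  shows "coord_laplacian G u y = coord_laplacian G v y"
  using coord_hessian_cong_open[OF assms] by (simp add: coord_laplacian_def)

lemma coord_grad_inner_cong_open:
  assumes "open S" "y \<in> S" "\<And>z. z \<in> S \<Longrightarrow> u z = v z" "\<And>z. z \<in> S \<Longrightarrow> u' z = v' z"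
  shows "coord_grad_inner G u u' y = coord_grad_inner G v v' y"
  using pd_cong_open[OF assms(1,2,3)] pd_cong_open[OF assms(1,2,4)] by (simp add: coord_grad_inner_def)

lemma smooth_on_coord_christoffel:
  assumes G: "coordinate_metric S G"
  shows "smooth_on S (coord_christoffel G k i j)"
proof -
  note o = coordinate_metricD(1)[OF G]
  have "smooth_on S (\<lambda>z. pd i (\<lambda>z. G z $ j $ l) z)" for i j l
    by (rule smooth_on_pd[OF smooth_on_nth[OF o smooth_on_nth[OF o coordinate_metricD(2)[OF G]]]])
  then show ?thesis
    unfolding coord_christoffel_def[abs_def]
    by (intro smooth_on_mult smooth_on_const smooth_on_sum smooth_on_diff smooth_on_add smooth_on_inverse_metric[OF G] o)
qed

lemma smooth_on_coord_laplacian: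
  assumes G: "coordinate_metric S G" and u: "smooth_on S u"
  shows "smooth_on S (coord_laplacian G u)"
  unfolding coord_laplacian_def[abs_def] coord_hessian_def
  by (intro smooth_on_sum smooth_on_mult smooth_on_diff smooth_on_inverse_metric[OF G] smooth_on_pd[OF smooth_on_pd[OF u]]
      smooth_on_pd[OF u] smooth_on_coord_christoffel[OF G] coordinate_metricD(1)[OF G])

lemma smooth_on_coord_grad_inner:
  assumes G: "coordinate_metric S G" and u: "smooth_on S u" and v: "smooth_on S v"
  shows "smooth_on S (coord_grad_inner G u v)"
  unfolding coord_grad_inner_def[abs_def]
  by (intro smooth_on_sum smooth_on_mult smooth_on_inverse_metric[OF G] 
      smooth_on_pd[OF u] smooth_on_pd[OF v] coordinate_metricD(1)[OF G])

section \<open>The Laplacian and the gradient product on a Riemannian manifold\<close>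

abbreviation metric_in :: "('a, 'm::finite) rmanifold \<Rightarrow> ('a, 'm) chart \<Rightarrow> real^'m \<Rightarrow> real^'m^'m" where
  "metric_in M c \<equiv> (\<lambda>z. metric_comp M c (coord_inv c z))"

text \<open>The carre du champ \<open>g(\<nabla>u,\<nabla>v)\<close>.\<close>

definition grad_inner :: "('a, 'm::finite) rmanifold \<Rightarrow> ('a \<Rightarrow> real) \<Rightarrow> ('a \<Rightarrow> real) \<Rightarrow> 'a \<Rightarrow> real" where
  "grad_inner M u v x = inner_at M x (grad M u x) (grad M v x)"

lemma coordinate_metric_subset: "coordinate_metric S G \<Longrightarrow> open T \<Longrightarrow> T \<subseteq> S \<Longrightarrow> coordinate_metric T G"
  unfolding coordinate_metric_def using smooth_on_subset by blast

text \<open>Raising the index of \<open>p\<close> and pairing with \<open>w\<close> by the metric is the duality pairing of \<open>p\<close> and \<open>w\<close>.\<close>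

lemma metric_gradient_inner:
  assumes "coordinate_metric S G" "y \<in> S"
  shows "(matrix_inv (G y) *v p) \<bullet> (G y *v w) = p \<bullet> w"
proof -
  have "(matrix_inv (G y) *v p) \<bullet> (G y *v w) = w \<bullet> (G y *v (matrix_inv (G y) *v p))"
    by (rule coordinate_metric_sym[OF assms])
  then show ?thesis
    by (simp add: matrix_vector_mul_assoc matrix_inv_inverse[OF coordinate_metric_invertible[OF assms]] inner_commute)
qed

context
  fixes M :: "('a, 'm::finite) rmanifold"
  assumes M: "riemannian_manifold M"
begin

lemma manifold: "smooth_manifold M"
  using M by (simp add: riemannian_manifold_def)

lemma chart_inj:
  assumes "c \<in> atlas M"
  shows "inj_on (coord c) (dom_chart c)"
proof -
  have "homeomorphic_map (subtopology (mtop M) (dom_chart c)) (top_of_set (coord c ` dom_chart c)) (coord c)"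
    "openin (mtop M) (dom_chart c)"
    using manifold assms by (auto simp: smooth_manifold_def)
  then show ?thesis
    using homeomorphic_imp_injective_map by (metis inf.absorb_iff2 openin_subset topspace_subtopology)
qed

lemma coord_inv_coord: "c \<in> atlas M \<Longrightarrow> x \<in> dom_chart c \<Longrightarrow> coord_inv c (coord c x) = x"
  unfolding coord_inv_def using chart_inj inv_into_f_f by metis

lemma dom_chart_open: "c \<in> atlas M \<Longrightarrow> openin (mtop M) (dom_chart c)"
  using manifold by (auto simp: smooth_manifold_def)

lemma coord_image_open: "c \<in> atlas M \<Longrightarrow> open (coord c ` dom_chart c)"
  using manifold by (auto simp: smooth_manifold_def)

lemma openin_iff_open_coord:
  assumes c: "c \<in> atlas M" and A: "A \<subseteq> dom_chart c"
  shows "openin (mtop M) A \<longleftrightarrow> open (coord c ` A)"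
proof -
  have hom: "homeomorphic_map (subtopology (mtop M) (dom_chart c)) (top_of_set (coord c ` dom_chart c)) (coord c)"
    using manifold c by (auto simp: smooth_manifold_def)
  have "A \<subseteq> topspace (subtopology (mtop M) (dom_chart c))"
    using A openin_subset[OF dom_chart_open[OF c]] by auto
  from homeomorphic_map_openness[OF hom this]
  have "openin (subtopology (mtop M) (dom_chart c)) A \<longleftrightarrow> openin (top_of_set (coord c ` dom_chart c)) (coord c ` A)"
    by simp
  then show ?thesis
    using A by (simp add: openin_open_subtopology[OF dom_chart_open[OF c]] openin_open_eq[OF coord_image_open[OF c]] image_mono)
qed

lemma open_coord_image: "c \<in> atlas M \<Longrightarrow> openin (mtop M) V \<Longrightarrow> open (coord c ` (dom_chart c \<inter> V))"
  using openin_iff_open_coord[of c "dom_chart c \<inter> V"] openin_Int[OF dom_chart_open] by blast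

lemma chart_at:
  assumes "x \<in> mcarrier M"
  shows "chart_at M x \<in> atlas M \<and> x \<in> dom_chart (chart_at M x)"
proof -
  have "x \<in> \<Union> (dom_chart ` atlas M)"
    using manifold assms by (simp add: smooth_manifold_def)
  then have "\<exists>c. c \<in> atlas M \<and> x \<in> dom_chart c"
    by blast
  then show ?thesis
    unfolding chart_at_def by (rule someI_ex)
qed

lemma coordinate_metric_chart:
  assumes c: "c \<in> atlas M"
  shows "coordinate_metric (coord c ` dom_chart c) (metric_in M c)"
  using M c coord_image_open[OF c]
  by (auto simp: riemannian_manifold_def coordinate_metric_def comp_def coord_inv_coord)

lemma coordinate_metric_chart_on:
  "c \<in> atlas M \<Longrightarrow> openin (mtop M) V \<Longrightarrow> coordinate_metric (coord c ` (dom_chart c \<inter> V)) (metric_in M c)"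
  by (rule coordinate_metric_subset[OF coordinate_metric_chart open_coord_image]) auto

lemma smooth_fun_onD:
  assumes "smooth_fun_on M V u"
  shows "openin (mtop M) V" "c \<in> atlas M \<Longrightarrow> smooth_on (coord c ` (dom_chart c \<inter> V)) (\<lambda>z. u (coord_inv c z))"
  using assms by (auto simp: smooth_fun_on_def comp_def)

lemma smooth_fun_onI:
  "openin (mtop M) V \<Longrightarrow> (\<And>c. c \<in> atlas M \<Longrightarrow> smooth_on (coord c ` (dom_chart c \<inter> V)) (\<lambda>z. u (coord_inv c z))) \<Longrightarrow>
   smooth_fun_on M V u"
  by (auto simp: smooth_fun_on_def comp_def)

lemma isometric_transition_charts:
  assumes c: "c \<in> atlas M" and d: "d \<in> atlas M" and V: "openin (mtop M) V"
  shows "isometric_transition (coord c ` (dom_chart c \<inter> (dom_chart d \<inter> V))) (coord d ` (dom_chart d \<inter> V))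
    (metric_in M c) (metric_in M d) (\<lambda>z. coord d (coord_inv c z))"
proof
  show "coordinate_metric (coord c ` (dom_chart c \<inter> (dom_chart d \<inter> V))) (metric_in M c)"
    using V dom_chart_open[OF d] by (intro coordinate_metric_chart_on[OF c]) auto
  show "coordinate_metric (coord d ` (dom_chart d \<inter> V)) (metric_in M d)"
    by (rule coordinate_metric_chart_on[OF d V])
  have "smooth_on (coord c ` (dom_chart c \<inter> dom_chart d)) (\<lambda>z. coord d (coord_inv c z))"
    using manifold c d by (auto simp: smooth_manifold_def comp_def)
  then show "smooth_on (coord c ` (dom_chart c \<inter> (dom_chart d \<inter> V))) (\<lambda>z. coord d (coord_inv c z))"
    by (rule smooth_on_subset) auto
  show "(\<lambda>z. coord d (coord_inv c z)) ` coord c ` (dom_chart c \<inter> (dom_chart d \<inter> V)) \<subseteq> coord d ` (dom_chart d \<inter> V)"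
    using coord_inv_coord[OF c] by auto
  fix y v w assume "y \<in> coord c ` (dom_chart c \<inter> (dom_chart d \<inter> V))"
  then obtain x where x: "x \<in> dom_chart c" "x \<in> dom_chart d" "y = coord c x"
    by auto
  have "\<forall>c\<in>atlas M. \<forall>d\<in>atlas M. \<forall>x\<in>dom_chart c \<inter> dom_chart d. \<forall>v w.
        let J = frechet_derivative (coord d \<circ> coord_inv c) (at (coord c x))
        in v \<bullet> (metric_comp M c x *v w) = J v \<bullet> (metric_comp M d x *v J w)"
    using M unfolding riemannian_manifold_def by (elim conjE) assumption
  then have "let J = frechet_derivative (coord d \<circ> coord_inv c) (at (coord c x))
        in v \<bullet> (metric_comp M c x *v w) = J v \<bullet> (metric_comp M d x *v J w)"
    using c d x(1,2) by blast
  then show "v \<bullet> (metric_in M c y *v w) =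
    frechet_derivative (\<lambda>z. coord d (coord_inv c z)) (at y) v \<bullet>
      (metric_in M d (coord d (coord_inv c y)) *v frechet_derivative (\<lambda>z. coord d (coord_inv c z)) (at y) w)"
    using x by (simp add: Let_def comp_def coord_inv_coord c d)
qed

lemma laplacian_chart_at:
  assumes "x \<in> mcarrier M" "c = chart_at M x"
  shows "laplacian M u x = coord_laplacian (metric_in M c) (\<lambda>z. u (coord_inv c z)) (coord c x)"
  using coord_inv_coord[of c x] chart_at[OF assms(1)] assms(2)
  by (simp add: laplacian_def coord_laplacian_def coord_hessian_def hessian_comp_def christoffel_def coord_christoffel_def comp_def Let_def)

lemma grad_inner_chart_at:
  assumes "x \<in> mcarrier M" "c = chart_at M x"
  shows "grad_inner M u v x = coord_grad_inner (metric_in M c) (\<lambda>z. u (coord_inv c z)) (\<lambda>z. v (coord_inv c z)) (coord c x)"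
proof -
  have c: "c \<in> atlas M" "x \<in> dom_chart c"
    using chart_at[OF assms(1)] assms(2) by auto
  let ?g = "matrix_inv (metric_comp M c x)"
  let ?p = "\<lambda>u. \<chi> i. pd i (\<lambda>z. u (coord_inv c z)) (coord c x)"
  have y: "coord c x \<in> coord c ` dom_chart c"
    using c by simp
  have "grad_inner M u v x = (?g *v ?p u) \<bullet> (metric_comp M c x *v (?g *v ?p v))"
    by (simp add: grad_inner_def grad_def inner_at_def comp_def Let_def assms(2)[symmetric])
  also have "\<dots> = ?p u \<bullet> (?g *v ?p v)"
    using metric_gradient_inner[OF coordinate_metric_chart[OF c(1)] y] by (simp add: coord_inv_coord c)
  also have "\<dots> = coord_grad_inner (metric_in M c) (\<lambda>z. u (coord_inv c z)) (\<lambda>z. v (coord_inv c z)) (coord c x)"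
    by (simp add: coord_grad_inner_def inner_vec_def matrix_vector_mult_def sum_distrib_left ac_simps coord_inv_coord c)
  finally show ?thesis .
qed

text \<open>By definition, the values of \<open>laplacian M u\<close> at different points refer to unrelated charts.  Before this
  function can be differentiated, as \<open>\<Delta>\<^sup>2\<close> does, a single chart must be shown to give all its values on the domain
  of that chart.\<close>

lemma laplacian_in_chart:
  assumes u: "smooth_fun_on M V u" and c: "c \<in> atlas M" and x: "x \<in> dom_chart c" "x \<in> V"
  shows "laplacian M u x = coord_laplacian (metric_in M c) (\<lambda>z. u (coord_inv c z)) (coord c x)"
proof -
  have V: "openin (mtop M) V"
    by (rule smooth_fun_onD(1)[OF u])
  define d where "d = chart_at M x"
  have xM: "x \<in> mcarrier M"
    using openin_subset[OF V] x by blast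
  then have d: "d \<in> atlas M" "x \<in> dom_chart d"
    using chart_at by (auto simp: d_def)
  interpret isometric_transition "coord c ` (dom_chart c \<inter> (dom_chart d \<inter> V))" "coord d ` (dom_chart d \<inter> V)"
    "metric_in M c" "metric_in M d" "\<lambda>z. coord d (coord_inv c z)"
    by (rule isometric_transition_charts[OF c d(1) V])
  have y: "coord c x \<in> coord c ` (dom_chart c \<inter> (dom_chart d \<inter> V))"
    using x d by auto
  have "laplacian M u x = coord_laplacian (metric_in M d) (\<lambda>z. u (coord_inv d z)) (coord d x)"
    by (rule laplacian_chart_at[OF xM d_def])
  also have "\<dots> = coord_laplacian (metric_in M c) (\<lambda>z. u (coord_inv d (coord d (coord_inv c z)))) (coord c x)"
    using coord_laplacian_pullback[OF smooth_fun_onD(2)[OF u d(1)] y] by (simp add: coord_inv_coord c x)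
  also have "\<dots> = coord_laplacian (metric_in M c) (\<lambda>z. u (coord_inv c z)) (coord c x)"
    by (rule coord_laplacian_cong_open[OF coordinate_metricD(1)[OF G] y]) (auto simp: coord_inv_coord c d)
  finally show ?thesis .
qed

lemma grad_inner_in_chart:
  assumes u: "smooth_fun_on M V u" and v: "smooth_fun_on M V v" and c: "c \<in> atlas M" and x: "x \<in> dom_chart c" "x \<in> V"
  shows "grad_inner M u v x = coord_grad_inner (metric_in M c) (\<lambda>z. u (coord_inv c z)) (\<lambda>z. v (coord_inv c z)) (coord c x)"
proof -
  have V: "openin (mtop M) V"
    by (rule smooth_fun_onD(1)[OF u])
  define d where "d = chart_at M x"
  have xM: "x \<in> mcarrier M"
    using openin_subset[OF V] x by blast
  then have d: "d \<in> atlas M" "x \<in> dom_chart d"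
    using chart_at by (auto simp: d_def)
  interpret isometric_transition "coord c ` (dom_chart c \<inter> (dom_chart d \<inter> V))" "coord d ` (dom_chart d \<inter> V)"
    "metric_in M c" "metric_in M d" "\<lambda>z. coord d (coord_inv c z)"
    by (rule isometric_transition_charts[OF c d(1) V])
  have y: "coord c x \<in> coord c ` (dom_chart c \<inter> (dom_chart d \<inter> V))"
    using x d by auto
  have "grad_inner M u v x = coord_grad_inner (metric_in M d) (\<lambda>z. u (coord_inv d z)) (\<lambda>z. v (coord_inv d z)) (coord d x)"
    by (rule grad_inner_chart_at[OF xM d_def])
  also have "\<dots> = coord_grad_inner (metric_in M c) (\<lambda>z. u (coord_inv d (coord d (coord_inv c z))))
      (\<lambda>z. v (coord_inv d (coord d (coord_inv c z)))) (coord c x)"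
    using coord_grad_inner_pullback[OF smooth_fun_onD(2)[OF u d(1)] smooth_fun_onD(2)[OF v d(1)] y] by (simp add: coord_inv_coord c x)
  also have "\<dots> = coord_grad_inner (metric_in M c) (\<lambda>z. u (coord_inv c z)) (\<lambda>z. v (coord_inv c z)) (coord c x)"
    by (rule coord_grad_inner_cong_open[OF coordinate_metricD(1)[OF G] y]) (auto simp: coord_inv_coord c d)
  finally show ?thesis .
qed

section \<open>Smooth functions\<close>

lemma smooth_fun_on_laplacian:
  assumes u: "smooth_fun_on M V u"
  shows "smooth_fun_on M V (laplacian M u)"
proof (rule smooth_fun_onI)
  show V: "openin (mtop M) V"
    by (rule smooth_fun_onD(1)[OF u])
  fix c assume c: "c \<in> atlas M"
  show "smooth_on (coord c ` (dom_chart c \<inter> V)) (\<lambda>z. laplacian M u (coord_inv c z))"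
    by (rule smooth_on_cong[OF open_coord_image[OF c V] _
          smooth_on_coord_laplacian[OF coordinate_metric_chart_on[OF c V] smooth_fun_onD(2)[OF u c]]])
      (auto simp: coord_inv_coord c laplacian_in_chart[OF u c])
qed

lemma smooth_fun_on_grad_inner:
  assumes u: "smooth_fun_on M V u" and v: "smooth_fun_on M V v"
  shows "smooth_fun_on M V (grad_inner M u v)"
proof (rule smooth_fun_onI)
  show V: "openin (mtop M) V"
    by (rule smooth_fun_onD(1)[OF u])
  fix c assume c: "c \<in> atlas M"
  show "smooth_on (coord c ` (dom_chart c \<inter> V)) (\<lambda>z. grad_inner M u v (coord_inv c z))"
    by (rule smooth_on_cong[OF open_coord_image[OF c V] _
          smooth_on_coord_grad_inner[OF coordinate_metric_chart_on[OF c V] smooth_fun_onD(2)[OF u c] smooth_fun_onD(2)[OF v c]]])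
      (auto simp: coord_inv_coord c grad_inner_in_chart[OF u v c])
qed

lemma smooth_fun_on_const: "openin (mtop M) V \<Longrightarrow> smooth_fun_on M V (\<lambda>_. k)"
  by (intro smooth_fun_onI smooth_on_const)

lemma smooth_fun_on_add:
  assumes u: "smooth_fun_on M V u" and v: "smooth_fun_on M V v"
  shows "smooth_fun_on M V (\<lambda>x. u x + v x)"
  by (intro smooth_fun_onI smooth_on_add open_coord_image smooth_fun_onD(1)[OF u] smooth_fun_onD(2)[OF u] smooth_fun_onD(2)[OF v])

lemma smooth_fun_on_mult:
  fixes u v :: "'a \<Rightarrow> real"
  assumes u: "smooth_fun_on M V u" and v: "smooth_fun_on M V v"
  shows "smooth_fun_on M V (\<lambda>x. u x * v x)"
  by (intro smooth_fun_onI smooth_on_mult open_coord_image smooth_fun_onD(1)[OF u] smooth_fun_onD(2)[OF u] smooth_fun_onD(2)[OF v])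

lemma smooth_fun_on_sum:
  "openin (mtop M) V \<Longrightarrow> (\<And>i. i \<in> I \<Longrightarrow> smooth_fun_on M V (u i)) \<Longrightarrow> smooth_fun_on M V (\<lambda>x. \<Sum>i\<in>I. u i x)"
  by (intro smooth_fun_onI smooth_on_sum open_coord_image) (auto intro: smooth_fun_onD)

lemma smooth_fun_on_nth:
  assumes "smooth_fun_on M V \<phi>"
  shows "smooth_fun_on M V (\<lambda>x. \<phi> x $ \<alpha>)"
  by (intro smooth_fun_onI smooth_on_nth open_coord_image smooth_fun_onD(1)[OF assms] smooth_fun_onD(2)[OF assms])

lemma smooth_fun_on_subset: "smooth_fun_on M V u \<Longrightarrow> openin (mtop M) W \<Longrightarrow> W \<subseteq> V \<Longrightarrow> smooth_fun_on M W u"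
  by (intro smooth_fun_onI) (auto intro: smooth_on_subset[OF smooth_fun_onD(2)])

lemma smooth_fun_on_cong:
  assumes "smooth_fun_on M V u" "\<And>x. x \<in> V \<Longrightarrow> u x = v x"
  shows "smooth_fun_on M V v"
proof (rule smooth_fun_onI[OF smooth_fun_onD(1)[OF assms(1)]])
  fix c assume c: "c \<in> atlas M"
  show "smooth_on (coord c ` (dom_chart c \<inter> V)) (\<lambda>z. v (coord_inv c z))"
    by (rule smooth_on_cong[OF open_coord_image[OF c smooth_fun_onD(1)[OF assms(1)]] _ smooth_fun_onD(2)[OF assms(1) c]])
      (auto simp: coord_inv_coord c assms(2))
qed

lemma chart_image_subset:
  "c \<in> atlas M \<Longrightarrow> \<phi> ` V \<subseteq> T \<Longrightarrow> (\<lambda>z. \<phi> (coord_inv c z)) ` coord c ` (dom_chart c \<inter> V) \<subseteq> T"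
  by (auto simp: coord_inv_coord)

lemma smooth_fun_on_compose:
  fixes \<phi> :: "'a \<Rightarrow> 'e::euclidean_space"
  assumes \<phi>: "smooth_fun_on M V \<phi>" and "open T" "\<phi> ` V \<subseteq> T" "smooth_on T f"
  shows "smooth_fun_on M V (\<lambda>x. f (\<phi> x))"
proof (rule smooth_fun_onI[OF smooth_fun_onD(1)[OF \<phi>]])
  fix c assume c: "c \<in> atlas M"
  show "smooth_on (coord c ` (dom_chart c \<inter> V)) (\<lambda>z. f (\<phi> (coord_inv c z)))"
    by (rule smooth_on_compose[OF open_coord_image[OF c smooth_fun_onD(1)[OF \<phi>]] assms(2)
          chart_image_subset[OF c assms(3)] assms(4) smooth_fun_onD(2)[OF \<phi> c]])
qed

text \<open>Smooth maps are continuous.  Openness is checked chart by chart, in coordinates.\<close>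

lemma openin_preimage:
  fixes \<phi> :: "'a \<Rightarrow> 'e::euclidean_space"
  assumes \<phi>: "smooth_fun_on M (mcarrier M) \<phi>" and U: "open U"
  shows "openin (mtop M) (mcarrier M \<inter> \<phi> -` U)"
proof -
  have "openin (mtop M) (dom_chart c \<inter> \<phi> -` U)" if c: "c \<in> atlas M" for c
  proof -
    have "dom_chart c \<inter> mcarrier M = dom_chart c"
      using openin_subset[OF dom_chart_open[OF c]] by auto
    then have "continuous_on (coord c ` dom_chart c) (\<lambda>z. \<phi> (coord_inv c z))"
      using smooth_on_continuous_on[OF smooth_fun_onD(2)[OF \<phi> c]] by simp
    then have "open (coord c ` dom_chart c \<inter> (\<lambda>z. \<phi> (coord_inv c z)) -` U)"
      using continuous_on_open_vimage[OF coord_image_open[OF c]] U by (metis inf_commute)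
    moreover have "coord c ` dom_chart c \<inter> (\<lambda>z. \<phi> (coord_inv c z)) -` U = coord c ` (dom_chart c \<inter> \<phi> -` U)"
      by (auto simp: coord_inv_coord c)
    ultimately show ?thesis
      using openin_iff_open_coord[OF c, of "dom_chart c \<inter> \<phi> -` U"] by simp
  qed
  then have "openin (mtop M) (\<Union>c\<in>atlas M. dom_chart c \<inter> \<phi> -` U)"
    by blast
  moreover have "(\<Union>c\<in>atlas M. dom_chart c \<inter> \<phi> -` U) = mcarrier M \<inter> \<phi> -` U"
    using manifold by (auto simp: smooth_manifold_def)
  ultimately show ?thesis
    by simp
qed

section \<open>Product and chain rules\<close>

context
  fixes V :: "'a set"
  assumes V: "openin (mtop M) V"
begin

private lemma in_carrier: "x \<in> V \<Longrightarrow> x \<in> mcarrier M"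
  using openin_subset[OF V] by blast

private lemmas at = chart_at[OF in_carrier, THEN conjunct1] chart_at[OF in_carrier, THEN conjunct2]

private lemma in_image: "x \<in> V \<Longrightarrow> coord (chart_at M x) x \<in> coord (chart_at M x) ` (dom_chart (chart_at M x) \<inter> V)"
  using at by blast

lemma laplacian_cong:
  assumes "x \<in> V" "\<And>z. z \<in> V \<Longrightarrow> u z = v z"
  shows "laplacian M u x = laplacian M v x"
  unfolding laplacian_chart_at[OF in_carrier[OF assms(1)] refl]
  by (rule coord_laplacian_cong_open[OF open_coord_image[OF at(1) V] in_image]) (auto simp: coord_inv_coord at assms)

lemma grad_inner_cong:
  assumes "x \<in> V" "\<And>z. z \<in> V \<Longrightarrow> u z = v z" "\<And>z. z \<in> V \<Longrightarrow> u' z = v' z"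
  shows "grad_inner M u u' x = grad_inner M v v' x"
  unfolding grad_inner_chart_at[OF in_carrier[OF assms(1)] refl]
  by (rule coord_grad_inner_cong_open[OF open_coord_image[OF at(1) V] in_image]) (auto simp: coord_inv_coord at assms)

lemma grad_inner_commute:
  assumes x: "x \<in> V"
  shows "grad_inner M u v x = grad_inner M v u x"
  unfolding grad_inner_chart_at[OF in_carrier[OF x] refl]
  by (rule coord_grad_inner_commute[OF coordinate_metric_chart_on[OF at(1)[OF x] V] in_image[OF x]])

lemma laplacian_const: "x \<in> V \<Longrightarrow> laplacian M (\<lambda>_. k) x = 0"
  by (simp add: laplacian_chart_at[OF in_carrier refl] coord_laplacian_def coord_hessian_def)

lemma grad_inner_const: "x \<in> V \<Longrightarrow> grad_inner M (\<lambda>_. k) u x = 0"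
  by (simp add: grad_inner_chart_at[OF in_carrier refl] coord_grad_inner_def)

lemma laplacian_add:
  assumes u: "smooth_fun_on M V u" and v: "smooth_fun_on M V v" and x: "x \<in> V"
  shows "laplacian M (\<lambda>z. u z + v z) x = laplacian M u x + laplacian M v x"
  unfolding laplacian_chart_at[OF in_carrier[OF x] refl]
  by (rule coord_laplacian_add[OF open_coord_image[OF at(1)[OF x] V] smooth_fun_onD(2)[OF u at(1)[OF x]]
        smooth_fun_onD(2)[OF v at(1)[OF x]] in_image[OF x]])

lemma laplacian_mult:
  assumes u: "smooth_fun_on M V u" and v: "smooth_fun_on M V v" and x: "x \<in> V"
  shows "laplacian M (\<lambda>z. u z * v z) x = u x * laplacian M v x + laplacian M u x * v x + 2 * grad_inner M u v x"
  unfolding laplacian_chart_at[OF in_carrier[OF x] refl] grad_inner_chart_at[OF in_carrier[OF x] refl]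
  using coord_laplacian_mult[OF coordinate_metric_chart_on[OF at(1)[OF x] V] smooth_fun_onD(2)[OF u at(1)[OF x]]
        smooth_fun_onD(2)[OF v at(1)[OF x]] in_image[OF x]] 
  by (simp add: coord_inv_coord at x)

lemma grad_inner_add:
  assumes u: "smooth_fun_on M V u" and v: "smooth_fun_on M V v" and x: "x \<in> V"
  shows "grad_inner M (\<lambda>z. u z + v z) w x = grad_inner M u w x + grad_inner M v w x"
  unfolding grad_inner_chart_at[OF in_carrier[OF x] refl]
  by (rule coord_grad_inner_add[OF smooth_fun_onD(2)[OF u at(1)[OF x]] smooth_fun_onD(2)[OF v at(1)[OF x]] in_image[OF x]])

lemma grad_inner_mult:
  assumes u: "smooth_fun_on M V u" and v: "smooth_fun_on M V v" and x: "x \<in> V"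
  shows "grad_inner M (\<lambda>z. u z * v z) w x = u x * grad_inner M v w x + v x * grad_inner M u w x"
  unfolding grad_inner_chart_at[OF in_carrier[OF x] refl]
  using coord_grad_inner_mult[OF smooth_fun_onD(2)[OF u at(1)[OF x]] smooth_fun_onD(2)[OF v at(1)[OF x]] in_image[OF x]]
  by (simp add: coord_inv_coord at x)

lemma laplacian_cmult:
  assumes u: "smooth_fun_on M V u" and x: "x \<in> V"
  shows "laplacian M (\<lambda>z. k * u z) x = k * laplacian M u x"
  using laplacian_mult[OF smooth_fun_on_const[OF V] u x] by (simp add: laplacian_const grad_inner_const x)

lemma grad_inner_cmult:
  assumes u: "smooth_fun_on M V u" and x: "x \<in> V"
  shows "grad_inner M (\<lambda>z. k * u z) w x = k * grad_inner M u w x"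
  using grad_inner_mult[OF smooth_fun_on_const[OF V] u x] by (simp add: grad_inner_const x)

lemma laplacian_sum:
  assumes "\<And>i. i \<in> I \<Longrightarrow> smooth_fun_on M V (u i)" and x: "x \<in> V"
  shows "laplacian M (\<lambda>z. \<Sum>i\<in>I. u i z) x = (\<Sum>i\<in>I. laplacian M (u i) x)"
  using assms(1)
proof (induction I rule: infinite_finite_induct)
  case (insert i I)
  then have "laplacian M (\<lambda>z. u i z + (\<Sum>j\<in>I. u j z)) x = laplacian M (u i) x + laplacian M (\<lambda>z. \<Sum>j\<in>I. u j z) x"
    by (intro laplacian_add smooth_fun_on_sum V x) auto
  with insert show ?case
    by simp
qed (simp_all add: laplacian_const x)

lemma laplacian_compose:
  fixes \<phi> :: "'a \<Rightarrow> real^'n"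
  assumes \<phi>: "smooth_fun_on M V \<phi>" and T: "open T" "\<phi> ` V \<subseteq> T" "smooth_on T f" and x: "x \<in> V"
  shows "laplacian M (\<lambda>z. f (\<phi> z)) x =
    (\<Sum>\<alpha>\<in>UNIV. \<Sum>\<beta>\<in>UNIV. pd \<beta> (pd \<alpha> f) (\<phi> x) * grad_inner M (\<lambda>z. \<phi> z $ \<beta>) (\<lambda>z. \<phi> z $ \<alpha>) x) +
    (\<Sum>\<alpha>\<in>UNIV. pd \<alpha> f (\<phi> x) * laplacian M (\<lambda>z. \<phi> z $ \<alpha>) x)"
  unfolding laplacian_chart_at[OF in_carrier[OF x] refl] grad_inner_chart_at[OF in_carrier[OF x] refl]
  using coord_laplacian_compose[OF coordinate_metric_chart_on[OF at(1)[OF x] V] T(1) chart_image_subset[OF at(1)[OF x] T(2)]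
        smooth_fun_onD(2)[OF \<phi> at(1)[OF x]] T(3) in_image[OF x]]
  by (simp add: coord_inv_coord at x)

lemma grad_inner_compose:
  fixes \<phi> :: "'a \<Rightarrow> real^'n"
  assumes \<phi>: "smooth_fun_on M V \<phi>" and T: "open T" "\<phi> ` V \<subseteq> T" "smooth_on T f" and x: "x \<in> V"
  shows "grad_inner M (\<lambda>z. f (\<phi> z)) w x = (\<Sum>\<alpha>\<in>UNIV. pd \<alpha> f (\<phi> x) * grad_inner M (\<lambda>z. \<phi> z $ \<alpha>) w x)"
  unfolding grad_inner_chart_at[OF in_carrier[OF x] refl]
  using coord_grad_inner_compose[OF open_coord_image[OF at(1)[OF x] V] T(1) chart_image_subset[OF at(1)[OF x] T(2)]
        smooth_fun_onD(2)[OF \<phi> at(1)[OF x]] T(3) in_image[OF x]]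
  by (simp add: coord_inv_coord at x)

end

end

section \<open>Horizontal weak conformality\<close>

text \<open>The next two lemmas are the linear algebra at one point: \<open>B\<close> is the metric, \<open>D\<close> the differential of \<open>\<phi>\<close> and
  \<open>W \<alpha>\<close> the gradient of \<open>\<phi>\<^sup>\<alpha>\<close>.  The gradients are horizontal, so conformality applied to them says that their Gram
  matrix \<open>A\<close> satisfies \<open>A\<^sup>2 = l A\<close>; surjectivity of \<open>D\<close> makes \<open>A\<close> nondegenerate, whence \<open>A = l\<close>.\<close>

lemma conformal_imp_gram_scalar:
  fixes D :: "real^'m \<Rightarrow> real^'n"
  assumes B: "bilinear B" "\<And>v w. B v w = B w v" "\<And>v. v \<noteq> 0 \<Longrightarrow> B v v > (0::real)"
    and D: "\<And>v \<alpha>. D v $ \<alpha> = B (W \<alpha>) v" and surj: "surj D"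
    and conf: "\<And>X Y. (\<And>v. D v = 0 \<Longrightarrow> B X v = 0) \<Longrightarrow> (\<And>v. D v = 0 \<Longrightarrow> B Y v = 0) \<Longrightarrow> D X \<bullet> D Y = l * B X Y"
  shows "B (W \<alpha>) (W \<beta>) = (if \<alpha> = \<beta> then l else 0)"
proof -
  have hor: "B (W \<alpha>) v = 0" if "D v = 0" for \<alpha> v
    using D[of v \<alpha>] that by simp
  have sq: "(\<Sum>\<gamma>\<in>UNIV. B (W \<alpha>) (W \<gamma>) * B (W \<gamma>) (W \<beta>)) = l * B (W \<alpha>) (W \<beta>)" for \<alpha>
    using conf[OF hor hor, of \<alpha> \<beta>] by (simp add: inner_vec_def D B(2)[of "W \<alpha>"])
  \<comment> \<open>A column of \<open>A - l\<close>.  It is killed by \<open>A\<close>, so the corresponding combination of gradients has length zero.\<close>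
  define r where "r \<gamma> = B (W \<gamma>) (W \<beta>) - (if \<gamma> = \<beta> then l else 0)" for \<gamma>
  let ?Z = "\<Sum>\<gamma>\<in>UNIV. r \<gamma> *\<^sub>R W \<gamma>"
  have lin: "linear (\<lambda>v. B v w)" "linear (B w)" for w
    using B(1) by (auto simp: bilinear_def)
  have BZ: "B ?Z v = (\<Sum>\<gamma>\<in>UNIV. r \<gamma> * B (W \<gamma>) v)" for v
    by (simp add: linear_sum[OF lin(1)] linear_scale[OF lin(1)])
  have "B (W \<alpha>) ?Z = 0" for \<alpha>
  proof -
    have "B (W \<alpha>) ?Z = (\<Sum>\<gamma>\<in>UNIV. r \<gamma> * B (W \<alpha>) (W \<gamma>))"
      by (simp add: linear_sum[OF lin(2)] linear_scale[OF lin(2)])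
    also have "\<dots> = (\<Sum>\<gamma>\<in>UNIV. B (W \<alpha>) (W \<gamma>) * B (W \<gamma>) (W \<beta>) - (if \<gamma> = \<beta> then l * B (W \<alpha>) (W \<gamma>) else 0))"
      by (intro sum.cong refl) (simp add: r_def algebra_simps)
    also have "\<dots> = (\<Sum>\<gamma>\<in>UNIV. B (W \<alpha>) (W \<gamma>) * B (W \<gamma>) (W \<beta>)) - l * B (W \<alpha>) (W \<beta>)"
      by (simp add: sum_subtractf)
    finally show ?thesis
      by (simp add: sq)
  qed
  then have "B ?Z ?Z = 0"
    by (simp add: BZ)
  then have Z: "?Z = 0"
    using B(3)[of ?Z] by force
  obtain v where v: "D v = (\<chi> \<gamma>. r \<gamma>)"
    using surj by (metis surjD)
  have "(\<Sum>\<gamma>\<in>UNIV. (r \<gamma>)\<^sup>2) = B ?Z v"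
    unfolding BZ D[symmetric] v by (simp add: power2_eq_square)
  also have "\<dots> = 0"
    by (simp only: Z linear_0[OF lin(1)])
  finally have "r \<alpha> = 0"
    by (simp add: sum_nonneg_eq_0_iff)
  then show ?thesis
    by (simp add: r_def)
qed

text \<open>Conversely, if the gradients are orthogonal of equal length, then \<open>L\<close>, which maps the \<open>\<alpha>\<close>-th standard basis
  vector to \<open>W \<alpha> / l\<close>, is a right inverse of \<open>D\<close> and parametrises the horizontal space.\<close>

lemma gram_scalar_imp_conformal:
  fixes D :: "real^'m \<Rightarrow> real^'n"
  assumes B: "bilinear B" "\<And>v. v \<noteq> 0 \<Longrightarrow> B v v > (0::real)"
    and D: "\<And>v \<alpha>. D v $ \<alpha> = B (W \<alpha>) v"
    and gram: "\<And>\<alpha> \<beta>. B (W \<alpha>) (W \<beta>) = (if \<alpha> = \<beta> then l else 0)" and l: "l > 0"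
  shows "surj D"
    and "(\<And>v. D v = 0 \<Longrightarrow> B X v = 0) \<Longrightarrow> D X \<bullet> D Y = l * B X Y"
proof -
  have lin: "linear (\<lambda>v. B v w)" "linear (B w)" for w
    using B(1) by (auto simp: bilinear_def)
  define L where "L w = (1 / l) *\<^sub>R (\<Sum>\<gamma>\<in>UNIV. w $ \<gamma> *\<^sub>R W \<gamma>)" for w :: "real^'n"
  have BL: "B (L w) v = (w \<bullet> D v) / l" for w v
    by (simp add: linear_sum[OF lin(1)] linear_scale[OF lin(1)] L_def inner_vec_def D)
  have DL: "D (L w) = w" for w
  proof -
    have "D (L w) $ \<alpha> = w $ \<alpha>" for \<alpha>
    proof -
      have "D (L w) $ \<alpha> = (1 / l) * (\<Sum>\<gamma>\<in>UNIV. w $ \<gamma> * B (W \<alpha>) (W \<gamma>))"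
        by (simp add: linear_sum[OF lin(2)] linear_scale[OF lin(2)] L_def D)
      also have "\<dots> = w $ \<alpha>"
        using l by (simp add: gram if_distrib cong: if_cong)
      finally show ?thesis .
    qed
    then show ?thesis
      by (simp add: vec_eq_iff)
  qed
  then show "surj D"
    by (metis surjI)
  assume hor: "\<And>v. D v = 0 \<Longrightarrow> B X v = 0"
  let ?Z = "X - L (D X)"
  have DZ: "D ?Z = 0"
    using DL[of "D X"] by (simp add: vec_eq_iff D linear_diff[OF lin(2)])
  have "B ?Z ?Z = B X ?Z - B (L (D X)) ?Z"
    by (simp add: linear_diff[OF lin(1)])
  also have "\<dots> = 0"
    using hor[OF DZ] by (simp add: BL DZ)
  finally have "X = L (D X)"
    using B(2)[of ?Z] by force
  then have "B X Y = (D X \<bullet> D Y) / l"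
    using BL[of "D X" Y] by simp
  then show "D X \<bullet> D Y = l * B X Y"
    using l by simp
qed

text \<open>The index \<open>\<kappa>\<close> only serves to name the common value of the diagonal entries.\<close>

lemma horizontally_weakly_conformal_iff:
  fixes M :: "('a, 'm::finite) rmanifold" and \<phi> :: "'a \<Rightarrow> real^'n"
  assumes M: "riemannian_manifold M" and \<phi>: "smooth_fun_on M (mcarrier M) \<phi>"
  shows "horizontally_weakly_conformal M eucl \<phi> \<longleftrightarrow>
    (\<forall>x\<in>mcarrier M. \<forall>\<alpha> \<beta>. grad_inner M (\<lambda>z. \<phi> z $ \<alpha>) (\<lambda>z. \<phi> z $ \<beta>) x =
       (if \<alpha> = \<beta> then grad_inner M (\<lambda>z. \<phi> z $ \<kappa>) (\<lambda>z. \<phi> z $ \<kappa>) x else 0))"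
proof -
  define W where "W x \<alpha> = grad M (\<lambda>z. \<phi> z $ \<alpha>) x" for x \<alpha>
  have gd: "grad_inner M (\<lambda>z. \<phi> z $ \<alpha>) (\<lambda>z. \<phi> z $ \<beta>) x = inner_at M x (W x \<alpha>) (W x \<beta>)" for x \<alpha> \<beta>
    by (simp add: grad_inner_def W_def)
  have B: "bilinear (inner_at M x)" for x
    by (auto simp: bilinear_def inner_at_def intro!: linearI simp: inner_add_left inner_add_right
        matrix_vector_right_distrib matrix_vector_mult_scaleR)
  have Bsym: "inner_at M x v w = inner_at M x w v" and Bpos: "v \<noteq> 0 \<Longrightarrow> inner_at M x v v > 0"
    and D: "differential M eucl \<phi> x v $ \<alpha> = inner_at M x (W x \<alpha>) v" if x: "x \<in> mcarrier M" for x v w \<alpha>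
  proof -
    define c where "c = chart_at M x"
    have c: "c \<in> atlas M" "x \<in> dom_chart c"
      using chart_at[OF M x] by (auto simp: c_def)
    note G = coordinate_metric_chart[OF M c(1)]
    have y: "coord c x \<in> coord c ` dom_chart c"
      using c by simp
    have Gx: "metric_in M c (coord c x) = metric_comp M c x"
      by (simp add: coord_inv_coord[OF M c])
    show "inner_at M x v w = inner_at M x w v"
      using coordinate_metric_sym[OF G y] by (simp add: inner_at_def c_def[symmetric] Gx)
    show "v \<noteq> 0 \<Longrightarrow> inner_at M x v v > 0"
      using coordinate_metricD(4)[OF G y] by (simp add: inner_at_def c_def[symmetric] Gx)
    have dom: "dom_chart c \<inter> mcarrier M = dom_chart c"
      using openin_subset[OF dom_chart_open[OF M c(1)]] by auto
    have s: "smooth_on (coord c ` dom_chart c) (\<lambda>z. \<phi> (coord_inv c z))"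
      "smooth_on (coord c ` dom_chart c) (\<lambda>z. \<phi> (coord_inv c z) $ \<alpha>)"
      using smooth_fun_onD(2)[OF M \<phi> c(1)] smooth_fun_onD(2)[OF M smooth_fun_on_nth[OF M \<phi>] c(1)] unfolding dom by auto
    have "differential M eucl \<phi> x v $ \<alpha> = frechet_derivative (\<lambda>z. \<phi> (coord_inv c z)) (at (coord c x)) v $ \<alpha>"
      by (simp add: differential_def c_def[symmetric] comp_def)
    also have "\<dots> = frechet_derivative (\<lambda>z. \<phi> (coord_inv c z) $ \<alpha>) (at (coord c x)) v"
      using frechet_derivative_nth[OF smooth_on_has_derivative[OF s(1) y]] by simp
    also have "\<dots> = (\<chi> i. pd i (\<lambda>z. \<phi> (coord_inv c z) $ \<alpha>) (coord c x)) \<bullet> v"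
      by (simp add: frechet_derivative_pd[OF s(2) y] inner_vec_def)
    also have "\<dots> = inner_at M x (W x \<alpha>) v"
      using metric_gradient_inner[OF G y] by (simp add: inner_at_def W_def grad_def c_def[symmetric] Gx comp_def Let_def)
    finally show "differential M eucl \<phi> x v $ \<alpha> = inner_at M x (W x \<alpha>) v" .
  qed
  show ?thesis
  proof
    assume "horizontally_weakly_conformal M eucl \<phi>"
    then obtain lam :: "'a \<Rightarrow> real" where lam: "\<And>x. x \<in> mcarrier M \<Longrightarrow> (\<forall>X. differential M eucl \<phi> x X = 0) \<or>
         surj (differential M eucl \<phi> x) \<and>
         (\<forall>X\<in>horizontal_space M eucl \<phi> x. \<forall>Y\<in>horizontal_space M eucl \<phi> x.
            differential M eucl \<phi> x X \<bullet> differential M eucl \<phi> x Y = (lam x)\<^sup>2 * inner_at M x X Y)"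
      unfolding horizontally_weakly_conformal_def inner_at_eucl by blast
    show "\<forall>x\<in>mcarrier M. \<forall>\<alpha> \<beta>. grad_inner M (\<lambda>z. \<phi> z $ \<alpha>) (\<lambda>z. \<phi> z $ \<beta>) x =
       (if \<alpha> = \<beta> then grad_inner M (\<lambda>z. \<phi> z $ \<kappa>) (\<lambda>z. \<phi> z $ \<kappa>) x else 0)"
    proof (intro ballI allI)
      fix x \<alpha> \<beta> assume x: "x \<in> mcarrier M"
      \<comment> \<open>Where the differential vanishes, the gradients vanish too and the factor is \<open>0\<close>.\<close>
      from lam[OF x] obtain l where "inner_at M x (W x \<alpha>) (W x \<beta>) = (if \<alpha> = \<beta> then l else 0)" for \<alpha> \<beta>
      proof (elim disjE conjE)
        assume *: "\<forall>X. differential M eucl \<phi> x X = 0"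
        have "inner_at M x (W x \<alpha>) (W x \<beta>) = 0" for \<alpha> \<beta>
          using D[OF x, of "W x \<beta>" \<alpha>] * by simp
        then show ?thesis
          using that[of 0] by simp
      next
        assume *: "surj (differential M eucl \<phi> x)" "\<forall>X\<in>horizontal_space M eucl \<phi> x. \<forall>Y\<in>horizontal_space M eucl \<phi> x.
            differential M eucl \<phi> x X \<bullet> differential M eucl \<phi> x Y = (lam x)\<^sup>2 * inner_at M x X Y"
        show ?thesis
          by (rule that, rule conformal_imp_gram_scalar[OF B Bsym[OF x] Bpos[OF x] D[OF x] *(1)])
            (use *(2) in \<open>auto simp: horizontal_space_def\<close>)
      qed
      then show "grad_inner M (\<lambda>z. \<phi> z $ \<alpha>) (\<lambda>z. \<phi> z $ \<beta>) x =
         (if \<alpha> = \<beta> then grad_inner M (\<lambda>z. \<phi> z $ \<kappa>) (\<lambda>z. \<phi> z $ \<kappa>) x else 0)"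
        by (simp add: gd)
    qed
  next
    define l where "l x = grad_inner M (\<lambda>z. \<phi> z $ \<kappa>) (\<lambda>z. \<phi> z $ \<kappa>) x" for x
    assume "\<forall>x\<in>mcarrier M. \<forall>\<alpha> \<beta>. grad_inner M (\<lambda>z. \<phi> z $ \<alpha>) (\<lambda>z. \<phi> z $ \<beta>) x =
       (if \<alpha> = \<beta> then grad_inner M (\<lambda>z. \<phi> z $ \<kappa>) (\<lambda>z. \<phi> z $ \<kappa>) x else 0)"
    then have gram: "inner_at M x (W x \<alpha>) (W x \<beta>) = (if \<alpha> = \<beta> then l x else 0)" if "x \<in> mcarrier M" for x \<alpha> \<beta>
      using that unfolding gd[symmetric] l_def by blast
    have zero: "inner_at M x v 0 = 0" "inner_at M x 0 v = 0" for x v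
      by (simp_all add: inner_at_def)
    have l0: "l x \<ge> 0" if "x \<in> mcarrier M" for x
      using Bpos[OF that, of "W x \<kappa>"] zero by (cases "W x \<kappa> = 0") (auto simp: l_def gd)
    have "(\<forall>X. differential M eucl \<phi> x X = 0) \<or>
         surj (differential M eucl \<phi> x) \<and>
         (\<forall>X\<in>horizontal_space M eucl \<phi> x. \<forall>Y\<in>horizontal_space M eucl \<phi> x.
            differential M eucl \<phi> x X \<bullet> differential M eucl \<phi> x Y = (sqrt (l x))\<^sup>2 * inner_at M x X Y)"
      if x: "x \<in> mcarrier M" for x
    proof (cases "l x = 0")
      case True
      have "W x \<alpha> = 0" for \<alpha>
        using Bpos[OF x, of "W x \<alpha>"] gram[OF x, of \<alpha> \<alpha>] True by force
      then have "differential M eucl \<phi> x X $ \<alpha> = 0" for X \<alpha>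
        by (simp add: D[OF x] zero)
      then have "differential M eucl \<phi> x X = 0" for X
        by (simp add: vec_eq_iff)
      then show ?thesis
        by blast
    next
      case False
      then have pos: "l x > 0"
        using l0[OF x] by simp
      note conf = gram_scalar_imp_conformal[OF B Bpos[OF x] D[OF x] gram[OF x] pos]
      show ?thesis
        using conf l0[OF x] by (auto simp: horizontal_space_def)
    qed
    then show "horizontally_weakly_conformal M eucl \<phi>"
      unfolding horizontally_weakly_conformal_def inner_at_eucl using l0
      by (intro exI[of _ "\<lambda>x. sqrt (l x)"]) simp
  qed
qed

section \<open>The bilaplacian of products\<close>

text \<open>The real and imaginary parts \<open>p\<close>, \<open>q\<close> of a complex function \<open>w\<close> with \<open>\<Delta>w = 0\<close> and \<open>\<Gamma>(w,w) = 0\<close>, where \<open>\<Gamma>\<close>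
  is extended complex bilinearly.  On a connected open subset of the plane, these are the
  holomorphic and the antiholomorphic functions.\<close>

definition holomorphic_pair ::
  "('a, 'm::finite) rmanifold \<Rightarrow> 'a set \<Rightarrow> ('a \<Rightarrow> real) \<Rightarrow> ('a \<Rightarrow> real) \<Rightarrow> bool" where
  "holomorphic_pair M V p q \<longleftrightarrow> smooth_fun_on M V p \<and> smooth_fun_on M V q \<and>
     (\<forall>x\<in>V. laplacian M p x = 0 \<and> laplacian M q x = 0 \<and> grad_inner M p p x = grad_inner M q q x \<and> grad_inner M p q x = 0)"

context
  fixes M :: "('a, 'm::finite) rmanifold" and V :: "'a set"
  assumes M: "riemannian_manifold M" and V: "openin (mtop M) V"
begin

lemma bilaplacian_add:
  assumes "smooth_fun_on M V u" "smooth_fun_on M V v" "x \<in> V"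
  shows "laplacian M (laplacian M (\<lambda>z. u z + v z)) x = laplacian M (laplacian M u) x + laplacian M (laplacian M v) x"
proof -
  have "laplacian M (laplacian M (\<lambda>z. u z + v z)) x = laplacian M (\<lambda>z. laplacian M u z + laplacian M v z) x"
    by (rule laplacian_cong[OF M V assms(3)]) (rule laplacian_add[OF M V assms(1,2)])
  then show ?thesis
    by (simp add: laplacian_add[OF M V smooth_fun_on_laplacian[OF M assms(1)] smooth_fun_on_laplacian[OF M assms(2)] assms(3)])
qed

lemma bilaplacian_cmult:
  assumes "smooth_fun_on M V u" "x \<in> V"
  shows "laplacian M (laplacian M (\<lambda>z. k * u z)) x = k * laplacian M (laplacian M u) x"
proof -
  have "laplacian M (laplacian M (\<lambda>z. k * u z)) x = laplacian M (\<lambda>z. k * laplacian M u z) x"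
    by (rule laplacian_cong[OF M V assms(2)]) (rule laplacian_cmult[OF M V assms(1)])
  then show ?thesis
    by (simp add: laplacian_cmult[OF M V smooth_fun_on_laplacian[OF M assms(1)] assms(2)])
qed

text \<open>For \<open>u = \<phi>\<^sup>\<alpha>\<close> and \<open>v = \<phi>\<^sup>\<beta>\<close> this is the identity that turns biharmonicity of \<open>(\<phi>\<^sup>\<alpha> + i\<phi>\<^sup>\<beta>)\<^sup>2\<close> into conditions on
  first order data of \<open>\<phi>\<close> and \<open>\<Delta>\<phi>\<close>.\<close>

lemma bilaplacian_mult:
  assumes u: "smooth_fun_on M V u" "laplacian M (laplacian M u) x = 0"
    and v: "smooth_fun_on M V v" "laplacian M (laplacian M v) x = 0" and x: "x \<in> V"
  shows "laplacian M (laplacian M (\<lambda>z. u z * v z)) x =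
    2 * (laplacian M u x * laplacian M v x + grad_inner M u (laplacian M v) x + grad_inner M v (laplacian M u) x) +
    2 * laplacian M (grad_inner M u v) x"
proof -
  note s = u(1) v(1) smooth_fun_on_laplacian[OF M u(1)] smooth_fun_on_laplacian[OF M v(1)] smooth_fun_on_grad_inner[OF M u(1) v(1)]
  have "laplacian M (laplacian M (\<lambda>z. u z * v z)) x =
      laplacian M (\<lambda>z. u z * laplacian M v z + laplacian M u z * v z + 2 * grad_inner M u v z) x"
    by (rule laplacian_cong[OF M V x]) (rule laplacian_mult[OF M V s(1,2)])
  also have "\<dots> = laplacian M (\<lambda>z. u z * laplacian M v z) x + laplacian M (\<lambda>z. laplacian M u z * v z) x +
      2 * laplacian M (grad_inner M u v) x"
    using s
    by (simp add: smooth_fun_on_const[OF M V] laplacian_add[OF M V] laplacian_cmult[OF M V] smooth_fun_on_add[OF M] smooth_fun_on_mult[OF M] x)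
  finally show ?thesis
    using s u v x by (simp add: laplacian_mult[OF M V] grad_inner_commute[OF M V, of x "laplacian M u" v])
qed

lemma laplacian_triple_product_at_zero:
  assumes "smooth_fun_on M V a" "smooth_fun_on M V b" "smooth_fun_on M V c" "x \<in> V" "a x = 0" "b x = 0"
  shows "laplacian M (\<lambda>z. (a z * b z) * c z) x = 2 * grad_inner M a b x * c x"
  using assms by (simp add: laplacian_mult[OF M V] grad_inner_mult[OF M V] smooth_fun_on_mult[OF M])

text \<open>At a common zero of \<open>p\<close>, \<open>q\<close>, \<open>r\<close> and \<open>s\<close>, every term in which fewer than all four factors are differentiated
  vanishes, so only the principal symbol of \<open>\<Delta>\<^sup>2\<close>, the symmetrised square of the inverse metric, acts on the product.\<close>

lemma bilaplacian_quartic_at_zero: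
  assumes p: "smooth_fun_on M V p" and q: "smooth_fun_on M V q" and r: "smooth_fun_on M V r" and s: "smooth_fun_on M V s"
    and x: "x \<in> V" and zero: "p x = 0" "q x = 0" "r x = 0" "s x = 0"
  shows "laplacian M (laplacian M (\<lambda>z. (p z * q z) * (r z * s z))) x =
    8 * (grad_inner M p q x * grad_inner M r s x + grad_inner M p r x * grad_inner M q s x + grad_inner M p s x * grad_inner M q r x)"
proof -
  let ?L = "laplacian M" and ?\<Gamma> = "grad_inner M"
  note sm = p q r s smooth_fun_on_mult[OF M] smooth_fun_on_laplacian[OF M] smooth_fun_on_grad_inner[OF M]
    smooth_fun_on_add[OF M] smooth_fun_on_const[OF M V]
  have \<Gamma>: "?\<Gamma> (\<lambda>z. p z * q z) (\<lambda>z. r z * s z) z =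
    (p z * r z) * ?\<Gamma> q s z + (p z * s z) * ?\<Gamma> q r z + (q z * r z) * ?\<Gamma> p s z + (q z * s z) * ?\<Gamma> p r z" if z: "z \<in> V" for z
  proof -
    have "?\<Gamma> w (\<lambda>z. r z * s z) z = r z * ?\<Gamma> w s z + s z * ?\<Gamma> w r z" for w
      using grad_inner_mult[OF M V r s z, of w] grad_inner_commute[OF M V z, of w] by simp
    then show ?thesis
      by (simp add: grad_inner_mult[OF M V p q z] algebra_simps)
  qed
  have "?L (?L (\<lambda>z. (p z * q z) * (r z * s z))) x =
    ?L (\<lambda>z. (p z * q z) * ?L (\<lambda>z. r z * s z) z + (r z * s z) * ?L (\<lambda>z. p z * q z) z +
      2 * ((p z * r z) * ?\<Gamma> q s z + (p z * s z) * ?\<Gamma> q r z + (q z * r z) * ?\<Gamma> p s z + (q z * s z) * ?\<Gamma> p r z)) x"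
    by (rule laplacian_cong[OF M V x])
      (simp add: laplacian_mult[OF M V smooth_fun_on_mult[OF M p q] smooth_fun_on_mult[OF M r s]] \<Gamma>)
  also have "\<dots> = ?L (\<lambda>z. (p z * q z) * ?L (\<lambda>z. r z * s z) z) x + ?L (\<lambda>z. (r z * s z) * ?L (\<lambda>z. p z * q z) z) x +
      2 * (?L (\<lambda>z. (p z * r z) * ?\<Gamma> q s z) x + ?L (\<lambda>z. (p z * s z) * ?\<Gamma> q r z) x +
        ?L (\<lambda>z. (q z * r z) * ?\<Gamma> p s z) x + ?L (\<lambda>z. (q z * s z) * ?\<Gamma> p r z) x)"
    using x by (simp add: laplacian_add[OF M V] laplacian_cmult[OF M V] sm)
  also have "\<dots> = 8 * (?\<Gamma> p q x * ?\<Gamma> r s x + ?\<Gamma> p r x * ?\<Gamma> q s x + ?\<Gamma> p s x * ?\<Gamma> q r x)"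
    using x zero by (simp add: laplacian_triple_product_at_zero laplacian_mult[OF M V] sm)
  finally show ?thesis .
qed

text \<open>With \<open>w = p + iq\<close> the new pair is \<open>w\<^sup>2\<close>, and \<open>\<Delta>(w\<^sup>2) = 2w\<Delta>w + 2\<Gamma>(w,w)\<close> and
  \<open>\<Gamma>(w\<^sup>2,w\<^sup>2) = 4w\<^sup>2\<Gamma>(w,w)\<close>.  This produces the harmonic test polynomials of degree two and four without any
  computation of partial derivatives.\<close>

lemma holomorphic_pair_square:
  assumes "holomorphic_pair M V p q"
  shows "holomorphic_pair M V (\<lambda>z. p z * p z + (-1) * (q z * q z)) (\<lambda>z. 2 * (p z * q z))" (is "holomorphic_pair _ _ ?a ?b")
proof -
  have p: "smooth_fun_on M V p" and q: "smooth_fun_on M V q"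
    and pq: "\<And>x. x \<in> V \<Longrightarrow> laplacian M p x = 0" "\<And>x. x \<in> V \<Longrightarrow> laplacian M q x = 0"
      "\<And>x. x \<in> V \<Longrightarrow> grad_inner M p p x = grad_inner M q q x" "\<And>x. x \<in> V \<Longrightarrow> grad_inner M p q x = 0"
    using assms by (auto simp: holomorphic_pair_def)
  note sm = p q smooth_fun_on_mult[OF M] smooth_fun_on_add[OF M] smooth_fun_on_const[OF M V]
  have qp: "grad_inner M q p x = 0" if "x \<in> V" for x
    using grad_inner_commute[OF M V that, of q p] pq(4)[OF that] by simp
  have a: "grad_inner M ?a w x = 2 * p x * grad_inner M p w x - 2 * q x * grad_inner M q w x" if "x \<in> V" for x w
    using grad_inner_add[OF M V smooth_fun_on_mult[OF M p p] smooth_fun_on_mult[OF M smooth_fun_on_const[OF M V] smooth_fun_on_mult[OF M q q]] that, of "-1" w]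
      grad_inner_cmult[OF M V smooth_fun_on_mult[OF M q q] that, of "-1" w]
      grad_inner_mult[OF M V p p that, of w] grad_inner_mult[OF M V q q that, of w] by simp
  have b: "grad_inner M ?b w x = 2 * p x * grad_inner M q w x + 2 * q x * grad_inner M p w x" if "x \<in> V" for x w
    using grad_inner_cmult[OF M V smooth_fun_on_mult[OF M p q] that, of 2 w] grad_inner_mult[OF M V p q that, of w] by simp
  have a': "grad_inner M w ?a x = 2 * p x * grad_inner M p w x - 2 * q x * grad_inner M q w x"
    and b': "grad_inner M w ?b x = 2 * p x * grad_inner M q w x + 2 * q x * grad_inner M p w x" if "x \<in> V" for x w
    using a[OF that, of w] b[OF that, of w] grad_inner_commute[OF M V that, of w] by simp_all
  have La: "laplacian M ?a x = 0" if "x \<in> V" for x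
    using laplacian_add[OF M V smooth_fun_on_mult[OF M p p] smooth_fun_on_mult[OF M smooth_fun_on_const[OF M V] smooth_fun_on_mult[OF M q q]] that, of "-1"]
      laplacian_cmult[OF M V smooth_fun_on_mult[OF M q q] that, of "-1"]
      laplacian_mult[OF M V p p that] laplacian_mult[OF M V q q that] pq[OF that] by simp
  have Lb: "laplacian M ?b x = 0" if "x \<in> V" for x
    using laplacian_cmult[OF M V smooth_fun_on_mult[OF M p q] that, of 2] laplacian_mult[OF M V p q that] pq[OF that] by simp
  have "smooth_fun_on M V ?a" "smooth_fun_on M V ?b"
    by (intro sm)+
  moreover have "grad_inner M ?a ?a x = grad_inner M ?b ?b x" "grad_inner M ?a ?b x = 0" if "x \<in> V" for x
    unfolding a[OF that] b[OF that] a'[OF that] b'[OF that] using pq[OF that] qp[OF that] by (simp_all add: algebra_simps)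
  ultimately show ?thesis
    using La Lb unfolding holomorphic_pair_def by blast
qed

end

section \<open>Euclidean space\<close>

lemma smooth_fun_on_eucl: "smooth_fun_on eucl U f \<longleftrightarrow> open U \<and> smooth_on U f"
  by (simp add: smooth_fun_on_def comp_def)

lemma smooth_on_laplacian_eucl: "open U \<Longrightarrow> smooth_on U f \<Longrightarrow> smooth_on U (laplacian eucl f)"
  using smooth_fun_on_laplacian[OF riemannian_manifold_eucl, of U f] by (simp add: smooth_fun_on_eucl)

lemma grad_inner_eucl: "grad_inner eucl u v y = (\<Sum>i\<in>UNIV. pd i u y * pd i v y)"
  by (simp add: grad_inner_def inner_at_eucl grad_def comp_def inner_vec_def)

lemma pd_affine_coordinate: "pd \<gamma> (\<lambda>y. y $ \<alpha> + k) y = (if \<gamma> = \<alpha> then 1 else 0)"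
proof -
  have "((\<lambda>y. y $ \<alpha> + k) has_derivative (\<lambda>v. v $ \<alpha>)) (at y)"
    by (auto intro!: derivative_eq_intros bounded_linear.has_derivative[OF bounded_linear_vec_nth])
  then show ?thesis
    using pd_eqI by (fastforce simp: axis_def)
qed

lemma holomorphic_pair_eucl:
  fixes \<alpha> \<beta> :: "'n::finite"
  assumes "\<alpha> \<noteq> \<beta>"
  shows "holomorphic_pair eucl UNIV (\<lambda>y. y $ \<alpha> + k) (\<lambda>y. y $ \<beta> + l)"
proof -
  have 1: "pd \<gamma> (\<lambda>y. y $ \<alpha> + k) = (\<lambda>_. if \<gamma> = \<alpha> then 1 else 0)" for \<gamma> \<alpha> :: 'n and k
    by (rule ext) (rule pd_affine_coordinate)
  have 2: "smooth_on UNIV (\<lambda>y::real^'n. y $ \<alpha> + k)" for \<alpha> :: 'n and k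
    by (intro smooth_on_add smooth_on_nth smooth_on_const smooth_on_ident open_UNIV)
  show ?thesis
    using assms unfolding holomorphic_pair_def
    by (simp add: smooth_fun_on_eucl 2 laplacian_eucl grad_inner_eucl 1 if_distrib[of "\<lambda>t. t * _"] cong: if_cong)
qed

lemma holomorphic_pair_harmonic:
  "holomorphic_pair eucl V p q \<Longrightarrow> harmonic_on eucl V p \<and> harmonic_on eucl V q"
  by (simp add: holomorphic_pair_def harmonic_on_def)

section \<open>Consequences of being a generalized harmonic morphism\<close>

lemma gen_harmonic_morphism_imp_biharmonic:
  fixes M :: "('a, 'm::finite) rmanifold"
  assumes M: "riemannian_manifold M" and \<phi>: "gen_harmonic_morphism M eucl \<phi>" and f: "harmonic_on eucl UNIV f"
  shows "biharmonic_on M (mcarrier M) (\<lambda>x. f (\<phi> x))"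
proof (cases "mcarrier M = {}")
  \<comment> \<open>The definition says nothing about open sets with empty preimage, so an empty manifold is treated apart.\<close>
  case True
  have "Ck_on k {} u" for k and u :: "real^'m \<Rightarrow> real"
    by (induction k arbitrary: u) auto
  then show ?thesis
    unfolding True using openin_topspace[of "mtop M"] True by (simp add: biharmonic_on_def smooth_fun_on_def smooth_on_def)
next
  case False
  with \<phi> f show ?thesis
    unfolding gen_harmonic_morphism_def by (force simp: comp_def)
qed

text \<open>The test function is \<open>w\<^sup>4\<close> for \<open>w = (y\<^sub>\<alpha> - c\<^sub>\<alpha>) + i (y\<^sub>\<beta> - c\<^sub>\<beta>)\<close> with \<open>c = \<phi>(x)\<close>, whose pullback \<open>(p + iq)\<^sup>4\<close> has
  the bilaplacian \<open>24 (\<Gamma>\<^sub>\<alpha>\<^sub>\<alpha> - \<Gamma>\<^sub>\<beta>\<^sub>\<beta> + 2i \<Gamma>\<^sub>\<alpha>\<^sub>\<beta>)\<^sup>2\<close> at \<open>x\<close>.\<close>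

lemma gen_harmonic_morphism_imp_conformal_pair:
  fixes M :: "('a, 'm::finite) rmanifold" and \<phi> :: "'a \<Rightarrow> real^'n"
  assumes M: "riemannian_manifold M" and s: "smooth_fun_on M (mcarrier M) \<phi>" and \<phi>: "gen_harmonic_morphism M eucl \<phi>"
    and x: "x \<in> mcarrier M" and ne: "\<alpha> \<noteq> \<beta>"
  shows "grad_inner M (\<lambda>z. \<phi> z $ \<alpha>) (\<lambda>z. \<phi> z $ \<beta>) x = 0"
    "grad_inner M (\<lambda>z. \<phi> z $ \<alpha>) (\<lambda>z. \<phi> z $ \<alpha>) x = grad_inner M (\<lambda>z. \<phi> z $ \<beta>) (\<lambda>z. \<phi> z $ \<beta>) x"
proof -
  note V = openin_topspace[of "mtop M"]
  define p q where "p = (\<lambda>z. \<phi> z $ \<alpha> + (- \<phi> x $ \<alpha>))" and "q = (\<lambda>z. \<phi> z $ \<beta> + (- \<phi> x $ \<beta>))"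
  note nth = smooth_fun_on_nth[OF M s]
  have p: "smooth_fun_on M (mcarrier M) p" and q: "smooth_fun_on M (mcarrier M) q"
    unfolding p_def q_def by (intro smooth_fun_on_add[OF M] nth smooth_fun_on_const[OF M V])+
  have zero: "p x = 0" "q x = 0"
    by (simp_all add: p_def q_def)
  note sm = smooth_fun_on_mult[OF M p p] smooth_fun_on_mult[OF M p q] smooth_fun_on_mult[OF M q q]
  note sm4 = smooth_fun_on_mult[OF M sm(1) sm(1)] smooth_fun_on_mult[OF M sm(1) sm(2)] smooth_fun_on_mult[OF M sm(1) sm(3)]
    smooth_fun_on_mult[OF M sm(2) sm(3)] smooth_fun_on_mult[OF M sm(3) sm(3)]
  have gc: "grad_inner M (\<lambda>z. \<phi> z $ \<gamma> + k) w x = grad_inner M (\<lambda>z. \<phi> z $ \<gamma>) w x" for \<gamma> k w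
    using grad_inner_add[OF M V nth smooth_fun_on_const[OF M V] x] grad_inner_const[OF M V x] by simp
  have gc': "grad_inner M w (\<lambda>z. \<phi> z $ \<gamma> + k) x = grad_inner M w (\<lambda>z. \<phi> z $ \<gamma>) x" for \<gamma> k w
    using gc grad_inner_commute[OF M V x, of w] by simp
  have pq: "grad_inner M p p x = grad_inner M (\<lambda>z. \<phi> z $ \<alpha>) (\<lambda>z. \<phi> z $ \<alpha>) x" "grad_inner M p q x = grad_inner M (\<lambda>z. \<phi> z $ \<alpha>) (\<lambda>z. \<phi> z $ \<beta>) x"
    "grad_inner M q q x = grad_inner M (\<lambda>z. \<phi> z $ \<beta>) (\<lambda>z. \<phi> z $ \<beta>) x"
    unfolding p_def q_def gc gc' by simp_all
  have qp: "grad_inner M q p x = grad_inner M p q x"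
    by (rule grad_inner_commute[OF M V x])
  note quartic = bilaplacian_quartic_at_zero[OF M V _ _ _ _ x]
  let ?a = "\<lambda>z. p z * p z + (-1) * (q z * q z)" and ?b = "\<lambda>z. 2 * (p z * q z)"
  \<comment> \<open>With \<open>a + ib = w\<^sup>2\<close>, the two choices of \<open>F\<close> give the real and the imaginary part of \<open>w\<^sup>4\<close>.\<close>
  have harm: "harmonic_on eucl UNIV (\<lambda>y. F ((y $ \<alpha> + (- \<phi> x $ \<alpha>)) * (y $ \<alpha> + (- \<phi> x $ \<alpha>)) + (-1) * ((y $ \<beta> + (- \<phi> x $ \<beta>)) * (y $ \<beta> + (- \<phi> x $ \<beta>))))
     (2 * ((y $ \<alpha> + (- \<phi> x $ \<alpha>)) * (y $ \<beta> + (- \<phi> x $ \<beta>)))))"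
    if "F = (\<lambda>a b. a * a + (-1) * (b * b)) \<or> F = (\<lambda>a b. 2 * (a * b))" for F :: "real \<Rightarrow> real \<Rightarrow> real"
    using that holomorphic_pair_harmonic[OF holomorphic_pair_square[OF riemannian_manifold_eucl _
          holomorphic_pair_square[OF riemannian_manifold_eucl _ holomorphic_pair_eucl[OF ne, of "- \<phi> x $ \<alpha>" "- \<phi> x $ \<beta>"]]]]
    by auto
  have bih: "laplacian M (laplacian M (\<lambda>z. F (?a z) (?b z))) x = 0"
    if "F = (\<lambda>a b. a * a + (-1) * (b * b)) \<or> F = (\<lambda>a b. 2 * (a * b))" for F :: "real \<Rightarrow> real \<Rightarrow> real"
    using gen_harmonic_morphism_imp_biharmonic[OF M \<phi> harm[OF that]] x by (simp add: biharmonic_on_def p_def q_def)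
  have "(\<lambda>z. ?a z * ?a z + (-1) * (?b z * ?b z)) =
    (\<lambda>z. ((p z * p z) * (p z * p z) + (-6) * ((p z * p z) * (q z * q z))) + (q z * q z) * (q z * q z))"
    by (rule ext) algebra
  with bih[of "\<lambda>a b. a * a + (-1) * (b * b)"]
  have "laplacian M (laplacian M (\<lambda>z. ((p z * p z) * (p z * p z) + (-6) * ((p z * p z) * (q z * q z))) + (q z * q z) * (q z * q z))) x = 0"
    by simp
  then have "24 * (grad_inner M p p x * grad_inner M p p x) + (-6) * (8 * (grad_inner M p p x * grad_inner M q q x + 2 * (grad_inner M p q x * grad_inner M p q x))) +
      24 * (grad_inner M q q x * grad_inner M q q x) = 0"
    using quartic[OF p p p p] quartic[OF p p q q] quartic[OF q q q q] zero
      bilaplacian_add[OF M V smooth_fun_on_add[OF M sm4(1) smooth_fun_on_mult[OF M smooth_fun_on_const[OF M V] sm4(3)]] sm4(5) x, of "-6"]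
      bilaplacian_add[OF M V sm4(1) smooth_fun_on_mult[OF M smooth_fun_on_const[OF M V] sm4(3)] x, of "-6"]
      bilaplacian_cmult[OF M V sm4(3) x, of "-6"]
    by simp
  then have re: "(grad_inner M p p x - grad_inner M q q x)\<^sup>2 = 4 * (grad_inner M p q x)\<^sup>2"
    by (simp add: power2_eq_square algebra_simps)
  have "(\<lambda>z. 2 * (?a z * ?b z)) = (\<lambda>z. 4 * ((p z * p z) * (p z * q z)) + (-4) * ((p z * q z) * (q z * q z)))"
    by (rule ext) algebra
  with bih[of "\<lambda>a b. 2 * (a * b)"]
  have "laplacian M (laplacian M (\<lambda>z. 4 * ((p z * p z) * (p z * q z)) + (-4) * ((p z * q z) * (q z * q z)))) x = 0"
    by simp
  then have im: "(grad_inner M p p x - grad_inner M q q x) * grad_inner M p q x = 0"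
    using quartic[OF p p p q] quartic[OF p q q q] zero
      bilaplacian_add[OF M V smooth_fun_on_mult[OF M smooth_fun_on_const[OF M V] sm4(2)] smooth_fun_on_mult[OF M smooth_fun_on_const[OF M V] sm4(4)] x, of 4 "-4"]
      bilaplacian_cmult[OF M V sm4(2) x, of 4] bilaplacian_cmult[OF M V sm4(4) x, of "-4"]
    by (simp add: qp algebra_simps)
  have "grad_inner M p q x = 0" "grad_inner M p p x = grad_inner M q q x"
    using re im by auto
  then show "grad_inner M (\<lambda>z. \<phi> z $ \<alpha>) (\<lambda>z. \<phi> z $ \<beta>) x = 0"
    "grad_inner M (\<lambda>z. \<phi> z $ \<alpha>) (\<lambda>z. \<phi> z $ \<alpha>) x = grad_inner M (\<lambda>z. \<phi> z $ \<beta>) (\<lambda>z. \<phi> z $ \<beta>) x"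
    by (simp_all add: pq)
qed

lemma biharmonic_map_vec_iff:
  "biharmonic_map M (\<phi> :: 'a \<Rightarrow> real^'n) \<longleftrightarrow> (\<forall>\<alpha>. biharmonic_on M (mcarrier M) (\<lambda>x. \<phi> x $ \<alpha>))"
  by (auto simp: biharmonic_map_def Basis_vec_def inner_axis)

lemma biharmonic_map_square_iff:
  "biharmonic_map M (\<lambda>x. (complex_of_real (u x) + \<i> * complex_of_real (v x))\<^sup>2) \<longleftrightarrow>
   biharmonic_on M (mcarrier M) (\<lambda>x. u x * u x + (-1) * (v x * v x)) \<and> biharmonic_on M (mcarrier M) (\<lambda>x. 2 * (u x * v x))"
  by (simp add: biharmonic_map_def Basis_complex_def power2_eq_square algebra_simps)

lemma gen_harmonic_morphism_imp:
  fixes M :: "('a, 'm::finite) rmanifold" and \<phi> :: "'a \<Rightarrow> real^'n"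
  assumes M: "riemannian_manifold M" and s: "smooth_fun_on M (mcarrier M) \<phi>" and \<phi>: "gen_harmonic_morphism M eucl \<phi>"
  shows "horizontally_weakly_conformal M eucl \<phi>" "biharmonic_map M \<phi>"
    "\<alpha> \<noteq> \<beta> \<Longrightarrow> biharmonic_map M (\<lambda>x. (complex_of_real (\<phi> x $ \<alpha>) + \<i> * complex_of_real (\<phi> x $ \<beta>))\<^sup>2)"
proof -
  show "horizontally_weakly_conformal M eucl \<phi>"
    unfolding horizontally_weakly_conformal_iff[OF M s, of undefined]
    using gen_harmonic_morphism_imp_conformal_pair[OF M s \<phi>] by metis
  have "harmonic_on eucl UNIV (\<lambda>y::real^'n. y $ \<alpha>)" for \<alpha>
  proof -
    have "pd \<gamma> (\<lambda>y. y $ \<alpha>) = (\<lambda>_. if \<gamma> = \<alpha> then 1 else 0)" for \<gamma>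
      using pd_affine_coordinate[of \<gamma> \<alpha> 0] by (simp add: fun_eq_iff)
    then show ?thesis
      by (simp add: harmonic_on_def smooth_fun_on_eucl smooth_on_nth smooth_on_ident laplacian_eucl)
  qed
  then show "biharmonic_map M \<phi>"
    unfolding biharmonic_map_vec_iff using gen_harmonic_morphism_imp_biharmonic[OF M \<phi>] by blast
  assume "\<alpha> \<noteq> \<beta>"
  from holomorphic_pair_harmonic[OF holomorphic_pair_square[OF riemannian_manifold_eucl _ holomorphic_pair_eucl[OF this, of 0 0]]]
  show "biharmonic_map M (\<lambda>x. (complex_of_real (\<phi> x $ \<alpha>) + \<i> * complex_of_real (\<phi> x $ \<beta>))\<^sup>2)"
    unfolding biharmonic_map_square_iff
    using gen_harmonic_morphism_imp_biharmonic[OF M \<phi>, of "\<lambda>y. y $ \<alpha> * y $ \<alpha> + (-1) * (y $ \<beta> * y $ \<beta>)"]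
      gen_harmonic_morphism_imp_biharmonic[OF M \<phi>, of "\<lambda>y. 2 * (y $ \<alpha> * y $ \<beta>)"] by simp
qed

section \<open>The bilaplacian of a composition\<close>

lemma grad_inner_self_nonneg:
  assumes M: "riemannian_manifold M" and x: "x \<in> mcarrier M"
  shows "grad_inner M u u x \<ge> 0"
proof -
  define c where "c = chart_at M x"
  have c: "c \<in> atlas M" "x \<in> dom_chart c"
    using chart_at[OF M x] by (auto simp: c_def)
  then have "coord c x \<in> coord c ` dom_chart c"
    by simp
  from coordinate_metricD(4)[OF coordinate_metric_chart[OF M c(1)] this, of "grad M u x"]
  show ?thesis
    by (cases "grad M u x = 0") (simp_all add: grad_inner_def inner_at_def c_def[symmetric] coord_inv_coord[OF M c])
qed

text \<open>For \<open>u = \<phi>\<^sup>\<alpha>\<close> and \<open>v = \<phi>\<^sup>\<beta>\<close> this is, up to the term with \<open>\<Delta>\<mu>\<close>, the symmetrised coefficient of \<open>\<partial>\<^sub>\<beta>\<partial>\<^sub>\<alpha>f\<close> in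
  \<open>\<Delta>\<^sup>2(f \<circ> \<phi>)\<close>.\<close>

definition second_coeff :: "('a, 'm::finite) rmanifold \<Rightarrow> ('a \<Rightarrow> real) \<Rightarrow> ('a \<Rightarrow> real) \<Rightarrow> 'a \<Rightarrow> real" where
  "second_coeff M u v x = laplacian M u x * laplacian M v x + grad_inner M u (laplacian M v) x + grad_inner M v (laplacian M u) x"

text \<open>By \<open>bilaplacian_mult\<close>, \<open>\<Delta>\<^sup>2(\<phi>\<^sup>\<alpha>\<phi>\<^sup>\<beta>)\<close> is twice this coefficient plus \<open>2\<delta>\<^sub>\<alpha>\<^sub>\<beta>\<Delta>\<mu>\<close>.  The real part
  \<open>\<phi>\<^sup>\<alpha>\<phi>\<^sup>\<alpha> - \<phi>\<^sup>\<beta>\<phi>\<^sup>\<beta>\<close> of the square therefore compares two diagonal entries, and the imaginary part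
  \<open>2\<phi>\<^sup>\<alpha>\<phi>\<^sup>\<beta>\<close> isolates an off-diagonal one.\<close>

lemma second_coeff_scalar:
  fixes M :: "('a, 'm::finite) rmanifold" and \<phi> :: "'a \<Rightarrow> real^'n"
  assumes M: "riemannian_manifold M" and s: "smooth_fun_on M (mcarrier M) \<phi>"
    and conf: "\<And>x \<alpha> \<beta>. x \<in> mcarrier M \<Longrightarrow> grad_inner M (\<lambda>z. \<phi> z $ \<alpha>) (\<lambda>z. \<phi> z $ \<beta>) x = (if \<alpha> = \<beta> then \<mu> x else 0)"
    and bih: "biharmonic_map M \<phi>"
    and sq: "\<And>\<alpha> \<beta>. \<alpha> \<noteq> \<beta> \<Longrightarrow> biharmonic_map M (\<lambda>x. (complex_of_real (\<phi> x $ \<alpha>) + \<i> * complex_of_real (\<phi> x $ \<beta>))\<^sup>2)"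
    and x: "x \<in> mcarrier M"
  shows "second_coeff M (\<lambda>z. \<phi> z $ \<alpha>) (\<lambda>z. \<phi> z $ \<beta>) x =
    (if \<alpha> = \<beta> then second_coeff M (\<lambda>z. \<phi> z $ \<kappa>) (\<lambda>z. \<phi> z $ \<kappa>) x else 0)"
proof -
  note V = openin_topspace[of "mtop M"]
  note nth = smooth_fun_on_nth[OF M s]
  have b0: "laplacian M (laplacian M (\<lambda>z. \<phi> z $ \<alpha>)) x = 0" for \<alpha>
    using bih x by (simp add: biharmonic_map_vec_iff biharmonic_on_def)
  have mult: "laplacian M (laplacian M (\<lambda>z. \<phi> z $ \<alpha> * \<phi> z $ \<beta>)) x =
    2 * second_coeff M (\<lambda>z. \<phi> z $ \<alpha>) (\<lambda>z. \<phi> z $ \<beta>) x + 2 * (if \<alpha> = \<beta> then laplacian M \<mu> x else 0)" for \<alpha> \<beta>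
  proof -
    have "laplacian M (grad_inner M (\<lambda>z. \<phi> z $ \<alpha>) (\<lambda>z. \<phi> z $ \<beta>)) x = laplacian M (\<lambda>z. if \<alpha> = \<beta> then \<mu> z else 0) x"
      by (rule laplacian_cong[OF M V x]) (rule conf)
    also have "\<dots> = (if \<alpha> = \<beta> then laplacian M \<mu> x else 0)"
      using laplacian_const[OF M V x, of 0] by simp
    finally show ?thesis
      using bilaplacian_mult[OF M V nth b0 nth b0 x] by (simp add: second_coeff_def)
  qed
  have sm: "smooth_fun_on M (mcarrier M) (\<lambda>z. \<phi> z $ \<alpha> * \<phi> z $ \<beta>)" for \<alpha> \<beta>
    by (rule smooth_fun_on_mult[OF M nth nth])
  have off: "second_coeff M (\<lambda>z. \<phi> z $ \<alpha>) (\<lambda>z. \<phi> z $ \<beta>) x = 0"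
    and diag: "second_coeff M (\<lambda>z. \<phi> z $ \<alpha>) (\<lambda>z. \<phi> z $ \<alpha>) x = second_coeff M (\<lambda>z. \<phi> z $ \<beta>) (\<lambda>z. \<phi> z $ \<beta>) x"
    if ne: "\<alpha> \<noteq> \<beta>" for \<alpha> \<beta>
  proof -
    have 1: "laplacian M (laplacian M (\<lambda>z. \<phi> z $ \<alpha> * \<phi> z $ \<alpha> + (-1) * (\<phi> z $ \<beta> * \<phi> z $ \<beta>))) x = 0"
      and 2: "laplacian M (laplacian M (\<lambda>z. 2 * (\<phi> z $ \<alpha> * \<phi> z $ \<beta>))) x = 0"
      using sq[OF ne] x unfolding biharmonic_map_square_iff biharmonic_on_def by blast+
    show "second_coeff M (\<lambda>z. \<phi> z $ \<alpha>) (\<lambda>z. \<phi> z $ \<beta>) x = 0"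
      using 2 bilaplacian_cmult[OF M V sm x, of 2 \<alpha> \<beta>] mult[of \<alpha> \<beta>] ne by simp
    show "second_coeff M (\<lambda>z. \<phi> z $ \<alpha>) (\<lambda>z. \<phi> z $ \<alpha>) x = second_coeff M (\<lambda>z. \<phi> z $ \<beta>) (\<lambda>z. \<phi> z $ \<beta>) x"
      using 1 bilaplacian_cmult[OF M V sm x, of "-1" \<beta> \<beta>] mult[of \<alpha> \<alpha>] mult[of \<beta> \<beta>]
        bilaplacian_add[OF M V sm smooth_fun_on_mult[OF M smooth_fun_on_const[OF M V] sm] x, of \<alpha> \<alpha> "-1" \<beta> \<beta>] by simp
  qed
  show ?thesis
    using off diag by metis
qed

lemma laplacian_compose_conformal:
  fixes M :: "('a, 'm::finite) rmanifold" and \<phi> :: "'a \<Rightarrow> real^'n"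
  assumes M: "riemannian_manifold M" and s: "smooth_fun_on M W \<phi>"
    and conf: "\<And>x \<alpha> \<beta>. x \<in> W \<Longrightarrow> grad_inner M (\<lambda>z. \<phi> z $ \<alpha>) (\<lambda>z. \<phi> z $ \<beta>) x = (if \<alpha> = \<beta> then \<mu> x else 0)"
    and U: "open U" "\<phi> ` W \<subseteq> U" "smooth_on U g" and x: "x \<in> W"
  shows "laplacian M (\<lambda>z. g (\<phi> z)) x =
    \<mu> x * laplacian eucl g (\<phi> x) + (\<Sum>\<alpha>\<in>UNIV. pd \<alpha> g (\<phi> x) * laplacian M (\<lambda>z. \<phi> z $ \<alpha>) x)"
  using laplacian_compose[OF M smooth_fun_onD(1)[OF M s] s U x] conf[OF x]
  by (simp add: laplacian_eucl sum_distrib_left if_distrib mult.commute cong: if_cong)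

text \<open>The chain rule for conformal maps, applied to \<open>f\<close> and then to \<open>\<Delta>f\<close> and each \<open>\<partial>\<^sub>\<alpha>f\<close>.  Since mixed partial
  derivatives commute, \<open>\<Delta>\<partial>\<^sub>\<alpha>f = \<partial>\<^sub>\<alpha>\<Delta>f\<close>, and the coefficient of \<open>\<partial>\<^sub>\<beta>\<partial>\<^sub>\<alpha>f\<close> may be symmetrised, after which the
  hypothesis on \<open>second_coeff\<close> applies.\<close>

lemma bilaplacian_compose_conformal:
  fixes M :: "('a, 'm::finite) rmanifold" and \<phi> :: "'a \<Rightarrow> real^'n"
  assumes M: "riemannian_manifold M" and s: "smooth_fun_on M W \<phi>" and \<mu>: "smooth_fun_on M W \<mu>"
    and conf: "\<And>x \<alpha> \<beta>. x \<in> W \<Longrightarrow> grad_inner M (\<lambda>z. \<phi> z $ \<alpha>) (\<lambda>z. \<phi> z $ \<beta>) x = (if \<alpha> = \<beta> then \<mu> x else 0)"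
    and bih: "\<And>\<alpha>. laplacian M (laplacian M (\<lambda>z. \<phi> z $ \<alpha>)) x = 0"
    and coeff: "\<And>\<alpha> \<beta>. second_coeff M (\<lambda>z. \<phi> z $ \<alpha>) (\<lambda>z. \<phi> z $ \<beta>) x = (if \<alpha> = \<beta> then \<tau> else 0)"
    and U: "open U" "\<phi> ` W \<subseteq> U" "smooth_on U f" and x: "x \<in> W"
  shows "laplacian M (laplacian M (\<lambda>z. f (\<phi> z))) x =
    (\<mu> x)\<^sup>2 * laplacian eucl (laplacian eucl f) (\<phi> x) +
    2 * (\<Sum>\<alpha>\<in>UNIV. (\<mu> x * laplacian M (\<lambda>z. \<phi> z $ \<alpha>) x + grad_inner M \<mu> (\<lambda>z. \<phi> z $ \<alpha>) x) * pd \<alpha> (laplacian eucl f) (\<phi> x)) +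
    (laplacian M \<mu> x + \<tau>) * laplacian eucl f (\<phi> x)"
proof -
  let ?L = "laplacian M" and ?F = "laplacian eucl f" and ?y = "\<phi> x" and ?\<Gamma> = "grad_inner M"
  let ?\<phi> = "\<lambda>\<alpha> z. \<phi> z $ \<alpha>"
  note W = smooth_fun_onD(1)[OF M s]
  have comp: "?L (\<lambda>z. g (\<phi> z)) z = \<mu> z * laplacian eucl g (\<phi> z) + (\<Sum>\<alpha>\<in>UNIV. pd \<alpha> g (\<phi> z) * ?L (?\<phi> \<alpha>) z)"
    if "z \<in> W" "smooth_on U g" for g z
    by (rule laplacian_compose_conformal[OF M s _ U(1,2) that(2,1)]) (rule conf)
  have y: "?y \<in> U"
    using x U by blast
  have F: "smooth_on U ?F"
    by (rule smooth_on_laplacian_eucl[OF U(1,3)])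
  have pf: "smooth_on U (pd \<alpha> f)" for \<alpha>
    by (rule smooth_on_pd[OF U(3)])
  have s\<phi>: "smooth_fun_on M W (?\<phi> \<alpha>)" and sL: "smooth_fun_on M W (?L (?\<phi> \<alpha>))" for \<alpha>
    using smooth_fun_on_nth[OF M s] smooth_fun_on_laplacian[OF M smooth_fun_on_nth[OF M s]] by auto
  have sc: "smooth_fun_on M W (\<lambda>z. g (\<phi> z))" if "smooth_on U g" for g :: "real^'n \<Rightarrow> real"
    by (rule smooth_fun_on_compose[OF M s U(1,2) that])
  have s1: "smooth_fun_on M W (\<lambda>z. \<mu> z * ?F (\<phi> z))"
    by (rule smooth_fun_on_mult[OF M \<mu> sc[OF F]])
  have s2: "smooth_fun_on M W (\<lambda>z. pd \<alpha> f (\<phi> z) * ?L (?\<phi> \<alpha>) z)" for \<alpha>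
    by (rule smooth_fun_on_mult[OF M sc[OF pf] sL])
  have coord_laplacian_pd: "laplacian eucl (pd \<alpha> f) ?y = pd \<alpha> ?F ?y" for \<alpha>
  proof -
    have "laplacian eucl (pd \<alpha> f) ?y = (\<Sum>\<gamma>\<in>UNIV. pd \<alpha> (pd \<gamma> (pd \<gamma> f)) ?y)"
      unfolding laplacian_eucl
    proof (rule sum.cong[OF refl])
      fix \<gamma>
      have "pd \<gamma> (pd \<gamma> (pd \<alpha> f)) ?y = pd \<gamma> (pd \<alpha> (pd \<gamma> f)) ?y"
        by (rule pd_cong_open[OF U(1) y]) (rule pd_commute[OF U(1) _ U(3)])
      also have "\<dots> = pd \<alpha> (pd \<gamma> (pd \<gamma> f)) ?y"
        by (rule pd_commute[OF U(1) y pf])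
      finally show "pd \<gamma> (pd \<gamma> (pd \<alpha> f)) ?y = pd \<alpha> (pd \<gamma> (pd \<gamma> f)) ?y" .
    qed
    also have "\<dots> = pd \<alpha> (\<lambda>z. \<Sum>\<gamma>\<in>UNIV. pd \<gamma> (pd \<gamma> f) z) ?y"
      by (rule pd_sum[OF smooth_on_pd[OF pf] y, symmetric])
    finally show ?thesis
      by (simp add: laplacian_eucl[abs_def])
  qed
  have "?L (?L (\<lambda>z. f (\<phi> z))) x = ?L (\<lambda>z. \<mu> z * ?F (\<phi> z) + (\<Sum>\<alpha>\<in>UNIV. pd \<alpha> f (\<phi> z) * ?L (?\<phi> \<alpha>) z)) x"
    by (rule laplacian_cong[OF M W x]) (rule comp[OF _ U(3)])
  also have "\<dots> = ?L (\<lambda>z. \<mu> z * ?F (\<phi> z)) x + (\<Sum>\<alpha>\<in>UNIV. ?L (\<lambda>z. pd \<alpha> f (\<phi> z) * ?L (?\<phi> \<alpha>) z) x)"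
    unfolding laplacian_add[OF M W s1 smooth_fun_on_sum[OF M W s2] x] laplacian_sum[OF M W s2 x] ..
  finally have split: "?L (?L (\<lambda>z. f (\<phi> z))) x = \<dots>" .
  have first: "?L (\<lambda>z. \<mu> z * ?F (\<phi> z)) x = (\<mu> x)\<^sup>2 * laplacian eucl ?F ?y + ?L \<mu> x * ?F ?y +
    (\<Sum>\<alpha>\<in>UNIV. (\<mu> x * ?L (?\<phi> \<alpha>) x + 2 * ?\<Gamma> \<mu> (?\<phi> \<alpha>) x) * pd \<alpha> ?F ?y)"
  proof -
    have "?\<Gamma> \<mu> (\<lambda>z. ?F (\<phi> z)) x = (\<Sum>\<alpha>\<in>UNIV. pd \<alpha> ?F ?y * ?\<Gamma> \<mu> (?\<phi> \<alpha>) x)"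
      using grad_inner_compose[OF M W s U(1,2) F x, of \<mu>] grad_inner_commute[OF M W x, of \<mu>] by simp
    then show ?thesis
      unfolding laplacian_mult[OF M W \<mu> sc[OF F] x] comp[OF x F]
      by (simp add: power2_eq_square algebra_simps sum.distrib sum_distrib_left)
  qed
  have second: "?L (\<lambda>z. pd \<alpha> f (\<phi> z) * ?L (?\<phi> \<alpha>) z) x = \<mu> x * ?L (?\<phi> \<alpha>) x * pd \<alpha> ?F ?y +
    (\<Sum>\<beta>\<in>UNIV. pd \<beta> (pd \<alpha> f) ?y * (?L (?\<phi> \<alpha>) x * ?L (?\<phi> \<beta>) x + 2 * ?\<Gamma> (?\<phi> \<beta>) (?L (?\<phi> \<alpha>)) x))" for \<alpha>
    unfolding laplacian_mult[OF M W sc[OF pf] sL x] comp[OF x pf] grad_inner_compose[OF M W s U(1,2) pf x] bih coord_laplacian_pd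
    by (simp add: algebra_simps sum.distrib sum_distrib_left)
  let ?t = "\<lambda>\<alpha> \<beta>. pd \<beta> (pd \<alpha> f) ?y * (?L (?\<phi> \<alpha>) x * ?L (?\<phi> \<beta>) x + 2 * ?\<Gamma> (?\<phi> \<beta>) (?L (?\<phi> \<alpha>)) x)"
  have "2 * (\<Sum>\<alpha>\<in>UNIV. \<Sum>\<beta>\<in>UNIV. ?t \<alpha> \<beta>) = (\<Sum>\<alpha>\<in>UNIV. \<Sum>\<beta>\<in>UNIV. ?t \<alpha> \<beta>) + (\<Sum>\<alpha>\<in>UNIV. \<Sum>\<beta>\<in>UNIV. ?t \<beta> \<alpha>)"
    using sum.swap[of ?t UNIV UNIV] by simp
  also have "\<dots> = (\<Sum>\<alpha>\<in>UNIV. \<Sum>\<beta>\<in>UNIV. 2 * (pd \<beta> (pd \<alpha> f) ?y * second_coeff M (?\<phi> \<alpha>) (?\<phi> \<beta>) x))"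
    unfolding sum.distrib[symmetric]
  proof (intro sum.cong refl)
    fix \<alpha> \<beta>
    show "?t \<alpha> \<beta> + ?t \<beta> \<alpha> = 2 * (pd \<beta> (pd \<alpha> f) ?y * second_coeff M (?\<phi> \<alpha>) (?\<phi> \<beta>) x)"
      using pd_commute[OF U(1) y U(3), of \<alpha> \<beta>] by (simp add: second_coeff_def algebra_simps)
  qed
  also have "\<dots> = 2 * (\<tau> * ?F ?y)"
    by (simp add: coeff laplacian_eucl sum_distrib_left if_distrib mult.commute cong: if_cong)
  finally have third: "(\<Sum>\<alpha>\<in>UNIV. \<Sum>\<beta>\<in>UNIV. ?t \<alpha> \<beta>) = \<tau> * ?F ?y"
    by simp
  show ?thesis
    unfolding split first second sum.distrib third by (simp add: algebra_simps sum.distrib sum_distrib_left)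
qed

section \<open>The characterization\<close>

theorem theorem2p2:
  fixes M :: "('a, 'm::finite) rmanifold"
    and \<phi> :: "'a \<Rightarrow> real^'n::{finite,linorder}"
  assumes "riemannian_manifold M"
    and "smooth_fun_on M (mcarrier M) \<phi>"
  shows "(gen_harmonic_morphism M eucl \<phi> \<longleftrightarrow>
            horizontally_weakly_conformal M eucl \<phi> \<and> biharmonic_map M \<phi> \<and>
            (\<forall>\<alpha> \<beta>. \<alpha> \<noteq> \<beta> \<longrightarrow>
               biharmonic_map M (\<lambda>x. (complex_of_real (\<phi> x $ \<alpha>) + \<i> * complex_of_real (\<phi> x $ \<beta>))\<^sup>2)))
       \<and> (gen_harmonic_morphism M eucl \<phi> \<longleftrightarrow>
            (\<exists>lam::'a \<Rightarrow> real. (\<forall>x\<in>mcarrier M. lam x \<ge> 0) \<and> smooth_fun_on M (mcarrier M) (\<lambda>x. (lam x)\<^sup>2) \<and>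
               (\<forall>U f. open U \<longrightarrow> mcarrier M \<inter> \<phi> -` U \<noteq> {} \<longrightarrow> smooth_on U f \<longrightarrow>
                  (\<forall>x \<in> mcarrier M \<inter> \<phi> -` U.
                     laplacian M (laplacian M (f \<circ> \<phi>)) x =
                       (lam x)^4 * laplacian eucl (laplacian eucl f) (\<phi> x)
                       + 2 * (\<Sum>\<alpha>\<in>UNIV.
                           ((lam x)\<^sup>2 * laplacian M (\<lambda>z. \<phi> z $ \<alpha>) x
                            + inner_at M x (grad M (\<lambda>z. (lam z)\<^sup>2) x) (grad M (\<lambda>z. \<phi> z $ \<alpha>) x))
                           * pd \<alpha> (laplacian eucl f) (\<phi> x))
                       + (laplacian M (\<lambda>z. (lam z)\<^sup>2) x
                          + 2 * inner_at M x (grad M (\<lambda>z. \<phi> z $ first_index) x)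
                                (grad M (laplacian M (\<lambda>z. \<phi> z $ first_index)) x)
                          + (laplacian M (\<lambda>z. \<phi> z $ first_index) x)\<^sup>2)
                         * laplacian eucl f (\<phi> x)))))"
    (is "(?i \<longleftrightarrow> ?hwc \<and> ?bih \<and> ?sq) \<and> (?i \<longleftrightarrow> (\<exists>lam. ?iii lam))")
proof -
  note M = assms(1) and s = assms(2)
  have i_ii: "?hwc \<and> ?bih \<and> ?sq" if ?i
    using gen_harmonic_morphism_imp[OF M s that] by blast
  have ii_iii: "\<exists>lam. ?iii lam" if hwc: ?hwc and bih: ?bih and sq: ?sq
  proof
    let ?\<kappa> = "first_index :: 'n"
    define \<mu> where "\<mu> = grad_inner M (\<lambda>z. \<phi> z $ ?\<kappa>) (\<lambda>z. \<phi> z $ ?\<kappa>)"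
    define lam where "lam x = sqrt (\<mu> x)" for x
    have lam: "(lam x)\<^sup>2 = \<mu> x" if "x \<in> mcarrier M" for x
      using grad_inner_self_nonneg[OF M that] by (simp add: lam_def \<mu>_def)
    have nonneg: "lam x \<ge> 0" if "x \<in> mcarrier M" for x
      using grad_inner_self_nonneg[OF M that] by (simp add: lam_def \<mu>_def)
    have s\<mu>: "smooth_fun_on M (mcarrier M) \<mu>"
      unfolding \<mu>_def by (intro smooth_fun_on_grad_inner[OF M] smooth_fun_on_nth[OF M s])
    have conf: "grad_inner M (\<lambda>z. \<phi> z $ \<alpha>) (\<lambda>z. \<phi> z $ \<beta>) x = (if \<alpha> = \<beta> then \<mu> x else 0)" if "x \<in> mcarrier M" for x \<alpha> \<beta>
      using hwc that unfolding horizontally_weakly_conformal_iff[OF M s, of ?\<kappa>] \<mu>_def by blast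
    note V = openin_topspace[of "mtop M"]
    show "?iii lam"
    proof (intro conjI ballI allI impI)
      show "smooth_fun_on M (mcarrier M) (\<lambda>x. (lam x)\<^sup>2)"
        by (rule smooth_fun_on_cong[OF M s\<mu>]) (rule lam[symmetric])
      fix U and f :: "_ \<Rightarrow> real" and x
      assume U: "open U" "smooth_on U f" and x: "x \<in> mcarrier M \<inter> \<phi> -` U"
      let ?W = "mcarrier M \<inter> \<phi> -` U"
      have W: "openin (mtop M) ?W"
        by (rule openin_preimage[OF M s U(1)])
      have "laplacian M (laplacian M (\<lambda>z. f (\<phi> z))) x =
        (\<mu> x)\<^sup>2 * laplacian eucl (laplacian eucl f) (\<phi> x) +
        2 * (\<Sum>\<alpha>\<in>UNIV. (\<mu> x * laplacian M (\<lambda>z. \<phi> z $ \<alpha>) x + grad_inner M \<mu> (\<lambda>z. \<phi> z $ \<alpha>) x) * pd \<alpha> (laplacian eucl f) (\<phi> x)) +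
        (laplacian M \<mu> x + second_coeff M (\<lambda>z. \<phi> z $ ?\<kappa>) (\<lambda>z. \<phi> z $ ?\<kappa>) x) * laplacian eucl f (\<phi> x)"
      proof (rule bilaplacian_compose_conformal[OF M smooth_fun_on_subset[OF M s W] smooth_fun_on_subset[OF M s\<mu> W] _ _ _ U(1) _ U(2) x])
        show "laplacian M (laplacian M (\<lambda>z. \<phi> z $ \<alpha>)) x = 0" for \<alpha>
          using bih x by (simp add: biharmonic_map_vec_iff biharmonic_on_def)
        show "second_coeff M (\<lambda>z. \<phi> z $ \<alpha>) (\<lambda>z. \<phi> z $ \<beta>) x =
            (if \<alpha> = \<beta> then second_coeff M (\<lambda>z. \<phi> z $ ?\<kappa>) (\<lambda>z. \<phi> z $ ?\<kappa>) x else 0)" for \<alpha> \<beta>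
          by (rule second_coeff_scalar[OF M s conf bih]) (use sq x in auto)
      qed (use conf in auto)
      moreover have "laplacian M (\<lambda>z. (lam z)\<^sup>2) x = laplacian M \<mu> x"
        using laplacian_cong[OF M V, of x "\<lambda>z. (lam z)\<^sup>2" \<mu>] lam x by simp
      moreover have "inner_at M x (grad M (\<lambda>z. (lam z)\<^sup>2) x) (grad M (\<lambda>z. \<phi> z $ \<alpha>) x) = grad_inner M \<mu> (\<lambda>z. \<phi> z $ \<alpha>) x" for \<alpha>
        using grad_inner_cong[OF M V, of x "\<lambda>z. (lam z)\<^sup>2" \<mu> "\<lambda>z. \<phi> z $ \<alpha>"] lam x by (simp add: grad_inner_def)
      moreover have "(lam x)^4 = (\<mu> x)\<^sup>2"
        using lam[of x] x power_mult[of "lam x" 2 2] by simp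
      moreover have "second_coeff M (\<lambda>z. \<phi> z $ ?\<kappa>) (\<lambda>z. \<phi> z $ ?\<kappa>) x =
        2 * inner_at M x (grad M (\<lambda>z. \<phi> z $ ?\<kappa>) x) (grad M (laplacian M (\<lambda>z. \<phi> z $ ?\<kappa>)) x) + (laplacian M (\<lambda>z. \<phi> z $ ?\<kappa>) x)\<^sup>2"
        by (simp add: second_coeff_def grad_inner_def power2_eq_square)
      ultimately show "laplacian M (laplacian M (f \<circ> \<phi>)) x =
                       (lam x)^4 * laplacian eucl (laplacian eucl f) (\<phi> x)
                       + 2 * (\<Sum>\<alpha>\<in>UNIV.
                           ((lam x)\<^sup>2 * laplacian M (\<lambda>z. \<phi> z $ \<alpha>) x
                            + inner_at M x (grad M (\<lambda>z. (lam z)\<^sup>2) x) (grad M (\<lambda>z. \<phi> z $ \<alpha>) x))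
                           * pd \<alpha> (laplacian eucl f) (\<phi> x))
                       + (laplacian M (\<lambda>z. (lam z)\<^sup>2) x
                          + 2 * inner_at M x (grad M (\<lambda>z. \<phi> z $ first_index) x)
                                (grad M (laplacian M (\<lambda>z. \<phi> z $ first_index)) x)
                          + (laplacian M (\<lambda>z. \<phi> z $ first_index) x)\<^sup>2)
                         * laplacian eucl f (\<phi> x)"
        using lam[of x] x by (simp add: comp_def add.assoc)
    qed (rule nonneg)
  qed
  have iii_i: ?i if "?iii lam" for lam
    unfolding gen_harmonic_morphism_def
  proof (intro allI impI)
    fix U and f :: "_ \<Rightarrow> real"
    assume U: "openin (mtop eucl) U" "mcarrier M \<inter> \<phi> -` U \<noteq> {}" and f: "harmonic_on eucl U f"
    have oU: "open U" and sf: "smooth_on U f" and harm: "\<And>y. y \<in> U \<Longrightarrow> laplacian eucl f y = 0"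
      using f by (auto simp: harmonic_on_def smooth_fun_on_eucl)
    let ?W = "mcarrier M \<inter> \<phi> -` U"
    have W: "openin (mtop M) ?W"
      by (rule openin_preimage[OF M s oU])
    have "smooth_fun_on M ?W (\<lambda>x. f (\<phi> x))"
      by (rule smooth_fun_on_compose[OF M smooth_fun_on_subset[OF M s W] oU _ sf]) auto
    moreover have "laplacian M (laplacian M (f \<circ> \<phi>)) x = 0" if x: "x \<in> ?W" for x
    proof -
      have y: "\<phi> x \<in> U"
        using x by simp
      have "laplacian eucl (laplacian eucl f) (\<phi> x) = laplacian eucl (\<lambda>_. 0) (\<phi> x)"
        by (rule laplacian_cong[OF riemannian_manifold_eucl _ y]) (use oU harm in auto)
      then have "laplacian eucl (laplacian eucl f) (\<phi> x) = 0"
        by (simp add: laplacian_eucl)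
      moreover have "pd \<alpha> (laplacian eucl f) (\<phi> x) = 0" for \<alpha>
        using pd_cong_open[OF oU y, of "laplacian eucl f" "\<lambda>_. 0"] harm by simp
      ultimately show ?thesis
        using that(1) \<open>?iii lam\<close> oU U(2) sf harm[OF y] by simp
    qed
    ultimately show "biharmonic_on M ?W (f \<circ> \<phi>)"
      by (simp add: biharmonic_on_def comp_def)
  qed
  show ?thesis
  proof (intro conjI iffI)
    assume ?i
    note ii = i_ii[OF this]
    show ?hwc
      by (rule ii[THEN conjunct1])
    show ?bih
      by (rule ii[THEN conjunct2, THEN conjunct1])
    show ?sq
      by (rule ii[THEN conjunct2, THEN conjunct2])
    from ii show "\<exists>lam. ?iii lam"
      by (elim conjE) (rule ii_iii)
  next
    assume "?hwc \<and> ?bih \<and> ?sq"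
    then have "\<exists>lam. ?iii lam"
      by (elim conjE) (rule ii_iii)
    then show ?i
      by (elim exE) (rule iii_i)
  next
    assume "\<exists>lam. ?iii lam"
    then show ?i
      by (elim exE) (rule iii_i)
  qed
qed

end
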